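(* Let $1\le p\le\infty$ and let $p'$ be the conjugate number of $p$. Let $\omega,\nu,K,T,V_{K,p},\delta_0,\Lambda,\phi_\lambda,V_{K,p}^N$ be as in the context; in particular $K$ satisfies $|K(x,y)|\,\omega(y-x)\le\widetilde C(1+\|x\|_1+\|y\|_1)^{-\alpha}$ with $\alpha>d$, and $\lim_{\delta\to0}\|\omega_\delta(K)\|_{\mathcal W}=0$. Let $M>0$ and $C_M=[-M,M]^d$. If $f\in V_{K,p}$ and $\|f\|_{L^p_\nu(\mathbb R^d)}=1$, then for any given $\varepsilon>0$ there exist $N=N(\varepsilon,M)$ (not depending on the particular $f$) and $f_N\in V_{K,p}^N$ such that $$\|f-f_N\|_{L^p_\nu(C_M)}\le\varepsilon\qquad\text{and}\qquad\|f-f_N\|_{L^\infty_\nu(C_M)}\le\frac{\varepsilon}{(2M)^{d/p}}.$$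
   Context: Convention: $1/p=0$ if $p=\infty$. Weights: $\omega$ is a weight function on $\mathbb R^d$ that is continuous, symmetric, positive and submultiplicative: $0<\omega(x+y)\le\omega(x)\omega(y)$. The weight $\nu$ is continuous, symmetric, positive and $\omega$-moderate: $0<\nu(x+y)\le C_0\,\omega(x)\nu(y)$ for all $x,y\in\mathbb R^d$, for some constant $C_0>0$. $\|f\|_{L^p_\nu(E)}=\|\nu f\|_{L^p(E)}$ and $L^p_\nu(\mathbb R^d)=\{f:\|f\|_{L^p_\nu}=\|\nu f\|_{L^p}<\infty\}$; $\ell^p_\nu(\Lambda)$ is the analogous weighted sequence space, with norm $\|(c(\lambda)\nu(\lambda))_\lambda\|_{\ell^p}$. $\langle f,g\rangle$ is the integral pairing of $f\in L^p_\nu$ with $g\in L^{p'}_{1/\nu}$. Kernel: $\|K\|_{\mathcal W}=\max\{\|\sup_{z\in\mathbb R^d}|K(z,\cdot+z)|\|_{L^1_\omega},\ \|\sup_{z\in\mathbb R^d}|K(\cdot+z,z)|\|_{L^1_\omega}\}$ and $\omega_\delta(K)(x,y)=\sup_{|x'|,|y'|\le\delta}|K(x+x',y+y')-K(x,y)|$. The decay condition on $K$ in the claim gives $\|K\|_{\mathcal W}<\infty$. $T$ is the integral operator $Tf(x)=\int_{\mathbb R^d}K(x,y)f(y)\,dy$ on $L^p_\nu(\mathbb R^d)$, assumed idempotent ($T^2=T$), and $V_{K,p}=\{Tf:f\in L^p_\nu(\mathbb R^d)\}=\{f\in L^p_\nu(\mathbb R^d):Tf=f\}$ is its range. Frame data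 (a result quoted from the literature, for $1\le p\le\infty$): $\delta_0>0$ is chosen with $\|K\|_{\mathcal W}\|\omega_{\delta_0}(K)\|_{\mathcal W}<1$, $\Lambda=\delta_0\mathbb Z^d$, $$K_{\delta_0}(x,y)=\delta_0^{-d}\int_{[-\delta_0/2,\delta_0/2]^d}\int_{[-\delta_0/2,\delta_0/2]^d}\sum_{\lambda\in\delta_0\mathbb Z^d}K(x,\lambda+z_1)K(\lambda+z_2,y)\,dz_1\,dz_2,$$ $$\phi_\lambda(x)=\delta_0^{-d/p}\int_{\mathbb R^d}\int_{[-\delta_0/2,\delta_0/2]^d}K_{\delta_0}(x,z_1)K(z_1,\lambda+z_2)\,dz_2\,dz_1,\qquad \widetilde\phi_\lambda(x)=\delta_0^{-d+d/p}\int_{[-\delta_0/2,\delta_0/2]^d}K(\lambda+z,x)\,dz .$$ Quoted properties: (i) $|\phi_\lambda(x)|+|\widetilde\phi_\lambda(x)|\le h(x-\lambda)$ for some $h\in L^1_\omega(\mathbb R^d)$; (ii) $\Phi=\{\phi_\lambda\}\subset V_{K,p}$ and $\widetilde\Phi=\{\widetilde\phi_\lambda\}\subset V_{K,p}^\ast$ form a dual frame pair for $V_{K,p}$ and $V_{K,p}^\ast$; in particular there are constants $A_p,B_p>0$ with $A_p\|f\|_{L^p_\nu}\le\|(\langle f,\widetilde\phi_\lambda\rangle)_{\lambda\in\Lambda}\|_{\ell^p_\nu}\le B_p\|f\|_{L^p_\nu}$ and $f=\sum_{\lambda\in\Lambda}\langle f,\widetilde\phi_\lambda\rangle\phi_\lambda$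 for all $f\in V_{K,p}$, and $g=\sum_{\lambda\in\Lambda}\langle g,\phi_\lambda\rangle\widetilde\phi_\lambda$ for all $g\in V_{K,p}^\ast$; (iii) $V_{K,p}=\{\sum_{\lambda\in\Lambda}c(\lambda)\phi_\lambda:c\in\ell^p_\nu(\Lambda)\}$ and $V_{K,p}^\ast=\{\sum_{\lambda\in\Lambda}\widetilde c(\lambda)\widetilde\phi_\lambda:\widetilde c\in\ell^{p/(p-1)}_{1/\nu}(\Lambda)\}$; (iv) $\|K_{\delta_0}\|_{\mathcal W}<\infty$ and $\lim_{\delta\to0}\|\omega_\delta(K_{\delta_0})\|_{\mathcal W}=0$. For a positive integer $N$, $V_{K,p}^N=\{\sum_{\lambda\in\Lambda\cap[-N,N]^d}c(\lambda)\phi_\lambda:c(\lambda)\in\mathbb R\}$. *)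

theory Defs
  imports "HOL-Analysis.Analysis" "HOL-Probability.Essential_Supremum"
begin

text \<open>
  Functions live on \<open>real ^ 'n\<close>, so the dimension \<open>d\<close> is \<open>CARD('n)\<close>.  Exponents
  \<open>1 \<le> p \<le> \<infinity>\<close> are elements of \<open>ennreal\<close>; measurability and integrals refer to Lebesgue
  measure.  Norms are \<open>ennreal\<close>-valued, with \<open>\<infinity>\<close> meaning that the norm is not finite.
\<close>

definition recip_exp :: "ennreal \<Rightarrow> real" where
  "recip_exp p = (if p = \<infinity> then 0 else 1 / enn2real p)"

definition norm_l1 :: "real ^ 'n \<Rightarrow> real" where
  "norm_l1 x = (\<Sum>i\<in>UNIV. \<bar>x $ i\<bar>)"

text \<open>The cube \<open>[-r, r]^d\<close>, i.e. the closed ball of radius \<open>r\<close> in the maximum norm.\<close>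

definition cube :: "real \<Rightarrow> (real ^ 'n) set" where
  "cube r = {x. \<forall>i. \<bar>x $ i\<bar> \<le> r}"

definition lattice :: "real \<Rightarrow> (real ^ 'n) set" where
  "lattice \<delta> = {x. \<forall>i. \<exists>k::int. x $ i = \<delta> * of_int k}"


subsection \<open>Weights and weighted Lebesgue spaces\<close>

definition submultiplicative_weight :: "(real ^ 'n \<Rightarrow> real) \<Rightarrow> bool" where
  "submultiplicative_weight \<omega> \<longleftrightarrow>
     continuous_on UNIV \<omega> \<and> (\<forall>x. \<omega> (- x) = \<omega> x) \<and> (\<forall>x. 0 < \<omega> x) \<and>
     (\<forall>x y. \<omega> (x + y) \<le> \<omega> x * \<omega> y)"

definition moderate_weight :: "(real ^ 'n \<Rightarrow> real) \<Rightarrow> (real ^ 'n \<Rightarrow> real) \<Rightarrow> bool" where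
  "moderate_weight \<omega> \<nu> \<longleftrightarrow>
     continuous_on UNIV \<nu> \<and> (\<forall>x. \<nu> (- x) = \<nu> x) \<and> (\<forall>x. 0 < \<nu> x) \<and>
     (\<exists>C\<^sub>0>0. \<forall>x y. \<nu> (x + y) \<le> C\<^sub>0 * \<omega> x * \<nu> y)"

definition Lp_norm_on ::
    "ennreal \<Rightarrow> (real ^ 'n \<Rightarrow> real) \<Rightarrow> (real ^ 'n) set \<Rightarrow> (real ^ 'n \<Rightarrow> real) \<Rightarrow> ennreal" where
  "Lp_norm_on p \<nu> E f =
     (if p = \<infinity> then esssup lebesgue (\<lambda>x. ennreal (indicator E x * \<bar>\<nu> x * f x\<bar>))
      else let I = (\<integral>\<^sup>+ x. ennreal (indicator E x * \<bar>\<nu> x * f x\<bar> powr enn2real p) \<partial>lebesgue)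
           in if I = \<infinity> then \<infinity> else ennreal (enn2real I powr (1 / enn2real p)))"

text \<open>Elements of \<open>Lp_space\<close> are functions, not classes; equality in it is equality a.e.\<close>

definition Lp_space :: "ennreal \<Rightarrow> (real ^ 'n \<Rightarrow> real) \<Rightarrow> (real ^ 'n \<Rightarrow> real) set" where
  "Lp_space p \<nu> = {f. f \<in> borel_measurable lebesgue \<and> Lp_norm_on p \<nu> UNIV f < \<infinity>}"


subsection \<open>Kernels\<close>

text \<open>
  The norm is formulated for kernels with values in \<open>[0, \<infinity>]\<close>, to be applied to \<open>|K|\<close>
  and to the modulus of continuity, whose supremum may a priori be infinite.
\<close>

definition W_norm ::
    "(real ^ 'n \<Rightarrow> real) \<Rightarrow> (real ^ 'n \<Rightarrow> real ^ 'n \<Rightarrow> ennreal) \<Rightarrow> ennreal" where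
  "W_norm \<omega> k =
     max (\<integral>\<^sup>+ x. (SUP z. k z (x + z)) * ennreal (\<omega> x) \<partial>lebesgue)
         (\<integral>\<^sup>+ x. (SUP z. k (x + z) z) * ennreal (\<omega> x) \<partial>lebesgue)"

abbreviation abs_kernel ::
    "(real ^ 'n \<Rightarrow> real ^ 'n \<Rightarrow> real) \<Rightarrow> real ^ 'n \<Rightarrow> real ^ 'n \<Rightarrow> ennreal" where
  "abs_kernel K \<equiv> (\<lambda>x y. ennreal \<bar>K x y\<bar>)"

text \<open>The condition \<open>|x'|, |y'| \<le> \<delta>\<close> on the shifts refers to the maximum norm.\<close>

definition modulus ::
    "real \<Rightarrow> (real ^ 'n \<Rightarrow> real ^ 'n \<Rightarrow> real) \<Rightarrow> real ^ 'n \<Rightarrow> real ^ 'n \<Rightarrow> ennreal" where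
  "modulus \<delta> K x y = (SUP x'\<in>cube \<delta>. SUP y'\<in>cube \<delta>. ennreal \<bar>K (x + x') (y + y') - K x y\<bar>)"

definition int_op ::
    "(real ^ 'n \<Rightarrow> real ^ 'n \<Rightarrow> real) \<Rightarrow> (real ^ 'n \<Rightarrow> real) \<Rightarrow> real ^ 'n \<Rightarrow> real" where
  "int_op K f x = (LINT y|lebesgue. K x y * f y)"

definition idempotent_on_Lp ::
    "ennreal \<Rightarrow> (real ^ 'n \<Rightarrow> real) \<Rightarrow> (real ^ 'n \<Rightarrow> real ^ 'n \<Rightarrow> real) \<Rightarrow> bool" where
  "idempotent_on_Lp p \<nu> K \<longleftrightarrow>
     (\<forall>f\<in>Lp_space p \<nu>. AE x in lebesgue. int_op K (int_op K f) x = int_op K f x)"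

definition V_space ::
    "ennreal \<Rightarrow> (real ^ 'n \<Rightarrow> real) \<Rightarrow> (real ^ 'n \<Rightarrow> real ^ 'n \<Rightarrow> real) \<Rightarrow> (real ^ 'n \<Rightarrow> real) set" where
  "V_space p \<nu> K =
     {g \<in> Lp_space p \<nu>. \<exists>f\<in>Lp_space p \<nu>. AE x in lebesgue. g x = int_op K f x}"


subsection \<open>The generators\<close>

definition K_disc ::
    "real \<Rightarrow> (real ^ 'n \<Rightarrow> real ^ 'n \<Rightarrow> real) \<Rightarrow> real ^ 'n \<Rightarrow> real ^ 'n \<Rightarrow> real" where
  "K_disc \<delta> K x y =
     \<delta> powr (- real CARD('n)) *
     (LINT z2:cube (\<delta> / 2)|lebesgue. (LINT z1:cube (\<delta> / 2)|lebesgue.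
        (\<Sum>\<^sub>\<infinity>l\<in>lattice \<delta>. K x (l + z1) * K (l + z2) y)))"

definition gen ::
    "ennreal \<Rightarrow> real \<Rightarrow> (real ^ 'n \<Rightarrow> real ^ 'n \<Rightarrow> real) \<Rightarrow> real ^ 'n \<Rightarrow> real ^ 'n \<Rightarrow> real" where
  "gen p \<delta> K l x =
     \<delta> powr (- (real CARD('n) * recip_exp p)) *
     (LINT z1|lebesgue. (LINT z2:cube (\<delta> / 2)|lebesgue. K_disc \<delta> K x z1 * K z1 (l + z2)))"

definition V_fin ::
    "ennreal \<Rightarrow> real \<Rightarrow> (real ^ 'n \<Rightarrow> real ^ 'n \<Rightarrow> real) \<Rightarrow> nat \<Rightarrow> (real ^ 'n \<Rightarrow> real) set" where
  "V_fin p \<delta> K N =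
     {g. \<exists>c :: real ^ 'n \<Rightarrow> real.
           g = (\<lambda>x. \<Sum>l\<in>lattice \<delta> \<inter> cube (real N). c l * gen p \<delta> K l x)}"

end

theory Submission
  imports Defs
begin

text \<open>
  Write \<open>P\<close> for averaging over the cells of the lattice.  Then \<open>K_disc\<close> is the kernel of \<open>TPT\<close>, and the
  generator at \<open>l\<close> is a multiple of \<open>TPT (T 1\<^sub>l)\<close>, where \<open>1\<^sub>l\<close> is the indicator of the cell of \<open>l\<close>.  On the
  range of \<open>T\<close> one has \<open>f - TPT f = T (1 - P) T f\<close>, and the hypothesis on \<open>\<delta>\<^sub>0\<close> makes this operator a
  contraction in a sup norm with a weight equivalent to \<open>\<nu>\<close>.  Hence \<open>f\<close> is approximated by
  \<open>TPT (TPT h)\<close>, i.e. by an infinite combination of generators with coefficients bounded in terms of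
  \<open>\<nu>\<close>.  The decay of \<open>K\<close> in both variables bounds \<open>f\<close> in the weighted sup norm by its \<open>L\<^sup>p\<close> norm and
  makes the tail of the combination uniformly small.  The \<open>L\<^sup>p\<close> estimate on the cube follows from
  the \<open>L\<^sup>\<infinity>\<close> estimate.
\<close>

subsection \<open>Lebesgue measure and semicontinuous envelopes\<close>

text \<open>Averaging displaces a point by at most one mesh width in the maximum norm. So the
  modulus of continuity at that width bounds (1 - P) T, the norm of \<open>K\<close> bounds the
  outer T, and their product is the contraction factor. TPT is applied twice because TPT h is only T
  of a step function; a second TPT turns each step into a generator. Three obstacles shape the
  details. Idempotence is given on one L^p space, whereas the argument runs in a weighted sup norm,
  so it is transferred by truncation to cubes. The weight \<nu> is moderate only up to a constant,
  which would spoil a product known merely to be below 1. The suprema inside the kernel norms need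
  not be measurable. N is uniform in f because the number of Neumann steps and the bound on the
  coefficients depend only on the bound for f. The error is small on the whole space:
  \<open>K\<close> has an integrable majorant in y alone, so the discarded tail is small uniformly
  in x, and M enters only through the required accuracy.\<close>

lemma distr_lebesgue_plus:
  fixes c :: "'a::euclidean_space"
  shows "distr lebesgue lebesgue ((+) c) = lebesgue"
proof -
  have eq: "(\<lambda>x. c + (\<Sum>j\<in>Basis. (1 * (x \<bullet> j)) *\<^sub>R j)) = (+) c"
    by (simp add: euclidean_representation)
  show ?thesis
    using lebesgue_affine_euclidean[of "\<lambda>_. 1" c] unfolding eq by (simp add: density_1)
qed

lemma measurable_lebesgue_plus: "(+) (c :: 'a::euclidean_space) \<in> lebesgue \<rightarrow>\<^sub>M lebesgue"
proof -
  have eq: "(\<lambda>x. c + (\<Sum>j\<in>Basis. (1 * (x \<bullet> j)) *\<^sub>R j)) = (+) c"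
    by (simp add: euclidean_representation)
  show ?thesis
    using lebesgue_affine_measurable[of "\<lambda>_. 1" c] unfolding eq by simp
qed

lemma nn_integral_lebesgue_shift:
  assumes "f \<in> borel_measurable lebesgue"
  shows "(\<integral>\<^sup>+y. f (c + y) \<partial>lebesgue) = (\<integral>\<^sup>+y. f (y :: 'a::euclidean_space) \<partial>lebesgue)"
  using nn_integral_distr[OF measurable_lebesgue_plus, of f c] assms
  by (simp add: distr_lebesgue_plus)

lemma integral_lebesgue_shift:
  fixes f :: "'a::euclidean_space \<Rightarrow> real"
  assumes "f \<in> borel_measurable lebesgue"
  shows "(LINT y|lebesgue. f (c + y)) = (LINT y|lebesgue. f y)"
  using integral_distr[OF measurable_lebesgue_plus, of f c] assms
  by (simp add: distr_lebesgue_plus)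

lemma borel_measurable_lebesgue_borel: "f \<in> borel_measurable borel \<Longrightarrow> f \<in> borel_measurable lebesgue"
  by (simp add: measurable_completion)

lemma AE_lebesgue_shift:
  fixes c :: "'a::euclidean_space"
  assumes "AE x in lebesgue. P x"
  shows "AE x in lebesgue. P (c + x)"
proof -
  have "AE x in distr lebesgue lebesgue ((+) c). P x" using assms by (simp only: distr_lebesgue_plus)
  from AE_distrD[OF measurable_lebesgue_plus this] show ?thesis .
qed

text \<open>
  \<open>nn_integral\<close> of a non-measurable function is its lower integral.  The norm hypotheses concern
  suprema over uncountably many shifts, for which measurability is not known; the lower
  semicontinuous envelope is a Borel minorant of such a supremum, and almost everywhere it
  still dominates the quantities that are to be estimated.
\<close>

definition lsc_env :: "('a::metric_space \<Rightarrow> ennreal) \<Rightarrow> 'a \<Rightarrow> ennreal" where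
  "lsc_env F x = (SUP e\<in>{0<..}. INF y\<in>ball x e. F y)"

lemma lsc_env_le: "lsc_env F x \<le> F x"
  unfolding lsc_env_def by (rule SUP_least, rule INF_lower) auto

lemma le_lsc_envI: "e > 0 \<Longrightarrow> (\<And>y. dist x y < e \<Longrightarrow> a \<le> F y) \<Longrightarrow> a \<le> lsc_env F x"
  unfolding lsc_env_def by (rule SUP_upper2[of e]) (auto intro!: INF_greatest)

text \<open>A ball of half the radius about a nearby point lies in the original ball, so its infimum
  is no smaller. This is lower semicontinuity, and it yields a Borel function whatever
  \<open>F\<close> is.\<close>

lemma open_lsc_env: "open {x. a < lsc_env F x}"
  unfolding open_dist
proof safe
  fix x assume "a < lsc_env F x"
  then obtain e where e: "e > 0" "a < (INF y\<in>ball x e. F y)"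
    unfolding lsc_env_def less_SUP_iff by auto
  show "\<exists>e>0. \<forall>y. dist y x < e \<longrightarrow> y \<in> {x. a < lsc_env F x}"
  proof (intro exI[of _ "e/2"] conjI allI impI, use e in simp)
    fix y assume y: "dist y x < e/2"
    have "ball y (e/2) \<subseteq> ball x e"
    proof
      fix z assume "z \<in> ball y (e/2)"
      then show "z \<in> ball x e" using y dist_triangle[of x z y] by (simp add: dist_commute)
    qed
    then have "(INF y\<in>ball x e. F y) \<le> (INF z\<in>ball y (e/2). F z)" by (rule INF_superset_mono) auto
    also have "\<dots> \<le> lsc_env F y" unfolding lsc_env_def by (rule SUP_upper) (use e in auto)
    finally show "y \<in> {x. a < lsc_env F x}" using e(2) by simp
  qed
qed

lemma borel_measurable_lsc_env [measurable]: "lsc_env F \<in> borel_measurable borel"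
  by (rule borel_measurableI_greater) (auto intro!: borel_open open_lsc_env)

section \<open>Cubes and their volume\<close>

lemma cube_eq_cbox: "cube r = cbox (\<chi> i. - r) (\<chi> i. r)"
  by (auto simp: cube_def mem_box_cart abs_le_iff minus_le_iff)

lemma compact_cube: "compact (cube r)" by (simp add: cube_eq_cbox)

lemma sets_cube [measurable]: "cube r \<in> sets borel" by (simp add: cube_eq_cbox)

lemma emeasure_cube: "r \<ge> 0 \<Longrightarrow> emeasure lebesgue (cube r :: (real^'n) set) = ennreal ((2 * r) ^ CARD('n))"
proof -
  assume r: "r \<ge> 0"
  have ne: "cbox (\<chi> i. - r) (\<chi> i. r) \<noteq> ({} :: (real^'n) set)"
    using r by (subst interval_ne_empty_cart) auto
  have "emeasure lebesgue (cube r :: (real^'n) set) = emeasure lborel (cbox (\<chi> i. - r) (\<chi> i. r) :: (real^'n) set)"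
    by (simp add: cube_eq_cbox)
  also have "\<dots> = ennreal (measure lborel (cbox (\<chi> i. - r) (\<chi> i. r) :: (real^'n) set))"
    by (rule emeasure_eq_ennreal_measure) (simp add: emeasure_lborel_cbox_eq)
  also have "measure lborel (cbox (\<chi> i. - r) (\<chi> i. r) :: (real^'n) set) = (2 * r) ^ CARD('n)"
    using content_cbox_cart[OF ne] by simp
  finally show ?thesis .
qed

section \<open>The l1 norm and integrability of the decay weight\<close>

lemma norm_l1_nonneg: "norm_l1 x \<ge> 0" by (simp add: norm_l1_def sum_nonneg)

lemma abs_nth_le_norm_l1: "\<bar>x $ i\<bar> \<le> norm_l1 x"
  unfolding norm_l1_def by (rule member_le_sum) auto

lemma continuous_norm_l1 [continuous_intros]: "continuous_on S norm_l1"
  unfolding norm_l1_def[abs_def] by (intro continuous_intros)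

lemma norm_l1_add_le: "norm_l1 (x + y) \<le> norm_l1 x + norm_l1 y"
  unfolding norm_l1_def sum.distrib[symmetric] by (intro sum_mono) (simp add: abs_triangle_ineq)

lemma integrable_inverse_powr_abs:
  assumes "a > (1::real)"
  shows "(\<integral>\<^sup>+t. ennreal ((1 + \<bar>t\<bar>) powr (- a)) \<partial>lborel) < \<infinity>"
proof -
  have A: "(\<integral>\<^sup>+t. ennreal ((1 + t) powr (- a)) * indicator {0..} t \<partial>lborel) < \<infinity>"
  proof -
    \<comment> \<open>The antiderivative is normalised to vanish at infinity, which is possible
      since \<open>a > 1\<close>.\<close>
    have "((\<lambda>x. - ((1+x) powr (1 - a)) / (a - 1)) \<longlongrightarrow> 0) at_top"
    proof -
      have "((\<lambda>x::real. (1+x) powr (1 - a)) \<longlongrightarrow> 0) at_top"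
        by (rule tendsto_neg_powr) (use assms in \<open>auto intro: filterlim_tendsto_add_at_top filterlim_ident\<close>)
      from tendsto_divide[OF tendsto_minus[OF this] tendsto_const[of "a - 1"]] assms show ?thesis by simp
    qed
    then have "(\<integral>\<^sup>+t. ennreal ((1 + t) powr (- a)) * indicator {0..} t \<partial>lborel) =
      ennreal (0 - (- ((1+0) powr (1 - a)) / (a - 1)))"
    proof (intro nn_integral_FTC_atLeast)
      fix t :: real assume t: "0 \<le> t"
      show "((\<lambda>x. - ((1+x) powr (1 - a)) / (a - 1)) has_real_derivative (1 + t) powr (- a)) (at t)"
        using t assms by (auto intro!: derivative_eq_intros) (simp add: field_simps)
    qed auto
    then show ?thesis by simp
  qed
  have B: "(\<integral>\<^sup>+t. ennreal ((1 - t) powr (- a)) * indicator {..0} t \<partial>lborel) =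
     (\<integral>\<^sup>+t. ennreal ((1 + t) powr (- a)) * indicator {0..} t \<partial>lborel)"
    by (subst nn_integral_real_affine[of _ "-1" 0]) (auto intro!: nn_integral_cong split: split_indicator)
  have "(\<integral>\<^sup>+t. ennreal ((1 + \<bar>t\<bar>) powr (- a)) \<partial>lborel) \<le>
     (\<integral>\<^sup>+t. ennreal ((1 + t) powr (- a)) * indicator {0..} t + ennreal ((1 - t) powr (- a)) * indicator {..0} t \<partial>lborel)"
    by (intro nn_integral_mono) (auto split: split_indicator)
  also have "\<dots> = (\<integral>\<^sup>+t. ennreal ((1 + t) powr (- a)) * indicator {0..} t \<partial>lborel) +
     (\<integral>\<^sup>+t. ennreal ((1 - t) powr (- a)) * indicator {..0} t \<partial>lborel)"
    by (rule nn_integral_add) auto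
  also have "\<dots> < \<infinity>" unfolding B using A by simp
  finally show ?thesis .
qed

lemma borel_measurable_decay_weight:
  "(\<lambda>y :: real^'n. (1 + norm_l1 y) powr (- \<alpha>)) \<in> borel_measurable borel"
proof (intro borel_measurable_continuous_onI continuous_intros ballI)
  show "1 + norm_l1 y \<noteq> 0" for y :: "real^'n" using norm_l1_nonneg[of y] by linarith
qed

text \<open>Each \<open>1 + \<bar>y $ i\<bar>\<close> is at most \<open>1 + norm_l1 y\<close>.
  Splitting the exponent \<alpha> into d equal parts, each above 1, gives a product of integrable
  functions of one variable as majorant.\<close>

lemma integrable_decay_weight:
  assumes "\<alpha> > real CARD('n)"
  shows "integrable lebesgue (\<lambda>y :: real^'n. (1 + norm_l1 y) powr (- \<alpha>))"
proof -
  let ?a = "\<alpha> / CARD('n)"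
  have a: "?a > 1" using assms by (simp add: field_simps)
  have le: "(1 + norm_l1 y) powr (- \<alpha>) \<le> (\<Prod>b\<in>Basis. (1 + \<bar>y \<bullet> b\<bar>) powr (- ?a))" for y :: "real^'n"
  proof -
    have "(1 + norm_l1 y) powr (- \<alpha>) = (\<Prod>b\<in>(Basis :: (real^'n) set). (1 + norm_l1 y) powr (- ?a))"
      using assms norm_l1_nonneg[of y] by (simp add: powr_power del: power_Suc)
    also have "\<dots> \<le> (\<Prod>b\<in>Basis. (1 + \<bar>y \<bullet> b\<bar>) powr (- ?a))"
    proof (intro prod_mono conjI)
      fix b :: "real^'n" assume "b \<in> Basis"
      then obtain i where "b = axis i 1" by (auto simp: Basis_vec_def)
      then have "\<bar>y \<bullet> b\<bar> \<le> norm_l1 y" using abs_nth_le_norm_l1[of y i] by (simp add: inner_axis)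
      then show "(1 + norm_l1 y) powr (- ?a) \<le> (1 + \<bar>y \<bullet> b\<bar>) powr (- ?a)"
        using a by (intro powr_mono2') auto
    qed auto
    finally show ?thesis .
  qed
  have "(\<integral>\<^sup>+y. ennreal ((1 + norm_l1 (y :: real^'n)) powr (- \<alpha>)) \<partial>lborel) \<le>
     (\<integral>\<^sup>+y. (\<Prod>b\<in>(Basis :: (real^'n) set). ennreal ((1 + \<bar>y \<bullet> b\<bar>) powr (- ?a))) \<partial>lborel)"
  proof (intro nn_integral_mono)
    fix y :: "real^'n"
    have "(\<Prod>b\<in>(Basis :: (real^'n) set). ennreal ((1 + \<bar>y \<bullet> b\<bar>) powr (- ?a)))
      = ennreal (\<Prod>b\<in>(Basis :: (real^'n) set). (1 + \<bar>y \<bullet> b\<bar>) powr (- ?a))"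
      by (rule prod_ennreal) simp
    then show "ennreal ((1 + norm_l1 y) powr (- \<alpha>)) \<le> (\<Prod>b\<in>(Basis :: (real^'n) set). ennreal ((1 + \<bar>y \<bullet> b\<bar>) powr (- ?a)))"
      using ennreal_leI[OF le[of y]] by simp
  qed
  also have "\<dots> = (\<Prod>b\<in>(Basis :: (real^'n) set). (\<integral>\<^sup>+t. ennreal ((1 + \<bar>t\<bar>) powr (- ?a)) \<partial>lborel))"
    by (rule nn_integral_lborel_prod) auto
  also have "\<dots> = (\<integral>\<^sup>+t. ennreal ((1 + \<bar>t\<bar>) powr (- ?a)) \<partial>lborel) ^ card (Basis :: (real^'n) set)"
    by (rule prod_constant)
  also have "\<dots> < \<infinity>" using integrable_inverse_powr_abs[OF a]
    unfolding infinity_ennreal_def power_less_top_ennreal by (rule disjI1)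
  finally have fin: "(\<integral>\<^sup>+y. ennreal ((1 + norm_l1 (y :: real^'n)) powr (- \<alpha>)) \<partial>lebesgue) < \<infinity>"
    by (simp only: nn_integral_completion)
  show ?thesis
    by (rule integrableI_nonneg[OF borel_measurable_lebesgue_borel[OF borel_measurable_decay_weight] _ fin]) simp
qed

subsection \<open>Integral operators with decaying kernels\<close>

lemma AE_lebesgue_reflect:
  fixes c :: "'a::euclidean_space"
  assumes "AE x in lebesgue. P x"
  shows "AE x in lebesgue. P (c - x)"
proof -
  have eq: "(\<lambda>x. c + (\<Sum>j\<in>Basis. (- 1 * (x \<bullet> j)) *\<^sub>R j)) = (-) c"
    by (simp add: euclidean_representation sum_negf)
  have m: "(-) c \<in> lebesgue \<rightarrow>\<^sub>M lebesgue"
    using lebesgue_affine_measurable[of "\<lambda>_. - 1" c] unfolding eq by simp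
  have d: "distr lebesgue lebesgue ((-) c) = lebesgue"
    using lebesgue_affine_euclidean[of "\<lambda>_. - 1" c] unfolding eq by (simp add: density_1)
  have "AE x in distr lebesgue lebesgue ((-) c). P x" using assms by (simp only: d)
  from AE_distrD[OF m this] show ?thesis .
qed

text \<open>This is for single slices of a kernel: joint Lebesgue measurability controls only almost
  every slice, while almost everywhere continuity controls a given one.\<close>

lemma borel_measurable_lebesgue_AE_isCont:
  fixes f :: "'a::euclidean_space \<Rightarrow> real"
  assumes "AE x in lebesgue. isCont f x"
  shows "f \<in> borel_measurable lebesgue"
proof -
  obtain N where N: "N \<in> null_sets lebesgue" "\<And>x. x \<notin> N \<Longrightarrow> isCont f x"
    using assms unfolding completion.AE_iff_null_sets by auto
  have s: "- N \<in> sets lebesgue" using N(1) by (metis Compl_in_sets_lebesgue null_setsD2)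
  have "continuous_on (- N) f"
    using N(2) by (auto intro: continuous_at_imp_continuous_on)
  then have "f \<in> borel_measurable (lebesgue_on (- N))"
    using s by (rule continuous_imp_measurable_on_sets_lebesgue)
  then have "(\<lambda>x. indicator (- N) x *\<^sub>R f x) \<in> borel_measurable lebesgue"
    using s by (subst (asm) borel_measurable_restrict_space_iff) auto
  moreover have "AE x in lebesgue. indicator (- N) x *\<^sub>R f x = f x"
    using AE_not_in[OF N(1)] by eventually_elim auto
  ultimately show ?thesis by (rule borel_measurable_AE)
qed

text \<open>
  \<open>E\<close> is the set of differences \<open>y - x\<close> at which \<open>K\<close> may be discontinuous: the modulus condition
  does not force \<open>K\<close> to be continuous everywhere.
\<close>

locale decaying_kernel =
  fixes \<omega> \<mu> :: "real ^ 'n \<Rightarrow> real" and K :: "real ^ 'n \<Rightarrow> real ^ 'n \<Rightarrow> real"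
    and C \<alpha> :: real and E :: "(real ^ 'n) set"
  assumes cont_\<omega>: "continuous_on UNIV \<omega>"
    and \<omega>_ge1: "1 \<le> \<omega> x"
    and \<mu>_pos: "0 < \<mu> x"
    and \<mu>_mod: "\<mu> x \<le> \<omega> (y - x) * \<mu> y"
    and \<alpha>_gt: "\<alpha> > real CARD('n)"
    and decay: "\<bar>K x y\<bar> * \<omega> (y - x) \<le> C * (1 + norm_l1 x + norm_l1 y) powr (- \<alpha>)"
    and K_meas: "(\<lambda>z. K (fst z) (snd z)) \<in> borel_measurable lebesgue"
    and E_null: "AE v in lebesgue. v \<notin> E"
    and K_cont: "y - x \<notin> E \<Longrightarrow> isCont (\<lambda>z. K (fst z) (snd z)) (x, y)"
begin

text \<open>The decay of \<open>K\<close> with the first variable dropped. A majorant uniform in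
  \<open>x\<close> and integrable in \<open>y\<close> provides boundedness of \<open>T\<close>,
  domination for limits and small tails at once.\<close>

definition wt :: "real ^ 'n \<Rightarrow> real" where "wt y = (1 + norm_l1 y) powr (- \<alpha>)"

abbreviation "T \<equiv> int_op K"

text \<open>The bound is imposed at every point, not almost everywhere, so that averaging and
  pointwise evaluation need no exceptional sets.\<close>

definition bdd :: "real \<Rightarrow> (real ^ 'n \<Rightarrow> real) \<Rightarrow> bool" where
  "bdd D u \<longleftrightarrow> u \<in> borel_measurable lebesgue \<and> (\<forall>x. \<mu> x * \<bar>u x\<bar> \<le> D)"

text \<open>A bound for \<open>T\<close> in the weighted sup norm. It is finite but not small; the
  contraction rests on the kernel norms instead.\<close>

definition "CT = C * (LINT y|lebesgue. wt y)"

lemma \<alpha>_pos: "\<alpha> > 0" using \<alpha>_gt by (meson of_nat_0_le_iff order_le_less_trans)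

lemma wt_nonneg [simp]: "0 \<le> wt y" by (simp add: wt_def)

lemma wt_le1: "wt y \<le> 1"
  unfolding wt_def using norm_l1_nonneg[of y] \<alpha>_pos
  by (simp add: powr_minus inverse_eq_divide) (rule ge_one_powr_ge_zero, auto)

lemma wt_integrable [simp]: "integrable lebesgue wt"
  unfolding wt_def[abs_def] by (rule integrable_decay_weight[OF \<alpha>_gt])

lemma C_nonneg: "0 \<le> C"
proof -
  have "0 \<le> \<bar>K 0 0\<bar> * \<omega> (0 - 0)" using \<omega>_ge1[of 0] by simp
  then have "0 \<le> C * (1 + norm_l1 (0 :: real ^ 'n) + norm_l1 (0 :: real ^ 'n)) powr (- \<alpha>)"
    using decay[of 0 0] by simp
  then show ?thesis by (simp add: norm_l1_def)
qed

lemma CT_nonneg: "0 \<le> CT"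
  unfolding CT_def using C_nonneg by (intro mult_nonneg_nonneg integral_nonneg) auto

lemma decay_right: "\<bar>K x y\<bar> * \<omega> (y - x) \<le> C * wt y"
  using norm_l1_nonneg[of x] norm_l1_nonneg[of y] \<alpha>_pos C_nonneg
  by (intro order_trans[OF decay]) (auto simp: wt_def intro!: mult_left_mono powr_mono2')

lemma abs_K_le: "\<bar>K x y\<bar> \<le> \<bar>K x y\<bar> * \<omega> (y - x)"
  using mult_left_mono[OF \<omega>_ge1[of "y - x"], of "\<bar>K x y\<bar>"] by simp

lemma abs_K_le_right: "\<bar>K x y\<bar> \<le> C * wt y" by (rule order_trans[OF abs_K_le decay_right])
lemma isCont_K_right: "y - x \<notin> E \<Longrightarrow> isCont (K x) y"
  using isCont_o2[of y "\<lambda>y. (x, y)" "\<lambda>z. K (fst z) (snd z)"] K_cont[of y x] by simp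

lemma isCont_K_left: "y - x \<notin> E \<Longrightarrow> isCont (\<lambda>x. K x y) x"
  using isCont_o2[of x "\<lambda>x. (x, y)" "\<lambda>z. K (fst z) (snd z)"] K_cont[of y x] by simp

lemma AE_E_right: "AE y in lebesgue. y - x \<notin> E"
  using AE_lebesgue_shift[OF E_null, of "- x"] by simp

lemma AE_E_left: "AE x in lebesgue. y - x \<notin> E"
  by (rule AE_lebesgue_reflect[OF E_null])

lemma K_meas_right [measurable]: "K x \<in> borel_measurable lebesgue"
  using AE_E_right[of x] by (intro borel_measurable_lebesgue_AE_isCont) (auto elim!: eventually_mono intro: isCont_K_right)

lemma K_meas_left [measurable]: "(\<lambda>x. K x y) \<in> borel_measurable lebesgue"
  using AE_E_left[of y] by (intro borel_measurable_lebesgue_AE_isCont) (auto elim!: eventually_mono intro: isCont_K_left)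

lemma bdd_meas: "bdd D u \<Longrightarrow> u \<in> borel_measurable lebesgue" by (simp add: bdd_def)

lemma bdd_le: "bdd D u \<Longrightarrow> \<mu> x * \<bar>u x\<bar> \<le> D" by (simp add: bdd_def)

lemma bdd_nonneg: "bdd D u \<Longrightarrow> 0 \<le> D"
  using bdd_le[of D u 0] \<mu>_pos[of 0] by (meson abs_ge_zero less_imp_le mult_nonneg_nonneg order_trans)

text \<open>Moderateness moves the weight from \<open>x\<close> to \<open>y\<close> at the cost of
  \<open>\<omega> (y - x)\<close>, exactly the factor that the decay hypothesis absorbs.\<close>

lemma kernel_bound:
  assumes "bdd D u"
  shows "\<mu> x * \<bar>K x y * u y\<bar> \<le> D * C * wt y"
proof -
  have "\<mu> x * \<bar>K x y * u y\<bar> \<le> (\<omega> (y - x) * \<mu> y) * \<bar>K x y * u y\<bar>"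
    by (intro mult_right_mono \<mu>_mod) auto
  also have "\<dots> = (\<bar>K x y\<bar> * \<omega> (y - x)) * (\<mu> y * \<bar>u y\<bar>)" by (simp add: abs_mult)
  also have "\<dots> \<le> (C * wt y) * D"
    using \<mu>_pos[of y] C_nonneg by (intro mult_mono[OF decay_right bdd_le[OF assms]]) auto
  finally show ?thesis by (simp add: mult_ac)
qed

lemma kernel_bound': "bdd D u \<Longrightarrow> \<bar>K x y * u y\<bar> \<le> D * C / \<mu> x * wt y"
  using kernel_bound[of D u x y] \<mu>_pos[of x] by (simp add: field_simps)

lemma T_integrable:
  assumes u: "bdd D u"
  shows "integrable lebesgue (\<lambda>y. K x y * u y)"
proof (rule Bochner_Integration.integrable_bound)
  show "integrable lebesgue (\<lambda>y. D * C / \<mu> x * wt y)" by simp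
  show "(\<lambda>y. K x y * u y) \<in> borel_measurable lebesgue"
    by (rule borel_measurable_times[OF K_meas_right bdd_meas[OF u]])
  show "AE y in lebesgue. norm (K x y * u y) \<le> norm (D * C / \<mu> x * wt y)"
  proof (rule AE_I2)
    fix y show "norm (K x y * u y) \<le> norm (D * C / \<mu> x * wt y)"
      using kernel_bound'[OF u, of x y] abs_ge_self[of "D * C / \<mu> x * wt y"] by simp
  qed
qed

text \<open>Only \<open>y\<close> in \<open>A\<close> contributes, and the majorant does not depend
  on \<open>x\<close>. \<open>A = UNIV\<close> gives boundedness of \<open>T\<close>; the complement
  of a large cube gives the tail estimate.\<close>

lemma T_bound_tail:
  assumes u: "bdd D u" and A: "A \<in> sets lebesgue" and off: "\<And>y. y \<notin> A \<Longrightarrow> u y = 0"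
  shows "\<mu> x * \<bar>T u x\<bar> \<le> D * C * (LINT y:A|lebesgue. wt y)"
proof -
  have "\<mu> x * \<bar>T u x\<bar> \<le> \<mu> x * (LINT y|lebesgue. \<bar>K x y * u y\<bar>)"
    unfolding int_op_def using \<mu>_pos[of x] by (intro mult_left_mono integral_abs_bound) auto
  also have "\<dots> = (LINT y|lebesgue. \<mu> x * \<bar>K x y * u y\<bar>)" by simp
  also have "\<dots> \<le> (LINT y|lebesgue. D * C * (indicator A y * wt y))"
  proof (rule integral_mono)
    show "integrable lebesgue (\<lambda>y. \<mu> x * \<bar>K x y * u y\<bar>)" using T_integrable[OF u, of x] by auto
    show "integrable lebesgue (\<lambda>y. D * C * (indicator A y * wt y))"
      using integrable_mult_indicator[OF A wt_integrable] by simp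
    show "\<mu> x * \<bar>K x y * u y\<bar> \<le> D * C * (indicator A y * wt y)" for y
      using kernel_bound[OF u, of x y] off[of y] by (cases "y \<in> A") auto
  qed
  also have "\<dots> = D * C * (LINT y:A|lebesgue. wt y)" by (simp add: set_lebesgue_integral_def)
  finally show ?thesis .
qed

lemma T_bound: "bdd D u \<Longrightarrow> \<mu> x * \<bar>T u x\<bar> \<le> D * CT"
  using T_bound_tail[of D u UNIV x] by (simp add: CT_def set_lebesgue_integral_def mult_ac)

text \<open>Dominated convergence applies because \<open>K\<close> is continuous at
  \<open>(x, y)\<close> for almost every \<open>y\<close>. Continuity later upgrades almost
  everywhere identities to identities.\<close>

lemma T_cont:
  assumes u: "bdd D u"
  shows "continuous_on UNIV (T u)"
proof (rule continuous_at_imp_continuous_on, rule ballI)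
  fix x
  show "isCont (T u) x"
    unfolding continuous_at_sequentially
  proof (intro allI impI)
    fix s assume s: "s \<longlonglongrightarrow> x"
    have "(\<lambda>n. \<omega> (s n - x)) \<longlonglongrightarrow> \<omega> (x - x)"
      using cont_\<omega> by (intro continuous_on_tendsto_compose[OF cont_\<omega>] tendsto_intros s) auto
    then have "Bseq (\<lambda>n. \<omega> (s n - x))" by (intro convergent_imp_Bseq) (auto simp: convergent_def)
    then obtain B where B: "\<And>n. \<bar>\<omega> (s n - x)\<bar> \<le> B" by (auto simp: Bseq_def)
    \<comment> \<open>\<mu> is not assumed continuous. Moderateness and the boundedness of \<omega>
      along \<open>s n - x\<close> keep \<open>1 / \<mu> (s n)\<close> bounded, as the dominating
      function requires.\<close>
    have le: "1 / \<mu> (s n) \<le> B / \<mu> x" for n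
    proof -
      have "\<mu> x \<le> B * \<mu> (s n)"
        by (rule order_trans[OF \<mu>_mod[of x "s n"]], rule mult_right_mono)
          (use B[of n] \<mu>_pos[of "s n"] in auto)
      then show ?thesis using \<mu>_pos[of x] \<mu>_pos[of "s n"] by (simp add: field_simps)
    qed
    show "(T u \<circ> s) \<longlonglongrightarrow> T u x"
      unfolding int_op_def o_def
    proof (rule integral_dominated_convergence[where w="\<lambda>y. D * C * (B / \<mu> x) * wt y"])
      show "(\<lambda>y. K x y * u y) \<in> borel_measurable lebesgue" "(\<lambda>y. K (s i) y * u y) \<in> borel_measurable lebesgue" for i
        by (rule borel_measurable_times[OF K_meas_right bdd_meas[OF u]])+
      show "integrable lebesgue (\<lambda>y. D * C * (B / \<mu> x) * wt y)" by simp
      show "AE y in lebesgue. (\<lambda>n. K (s n) y * u y) \<longlonglongrightarrow> K x y * u y"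
        using AE_E_right[of x]
      proof eventually_elim
        case (elim y)
        show ?case by (intro tendsto_mult tendsto_const isCont_tendsto_compose[OF isCont_K_left[OF elim] s])
      qed
      show "AE y in lebesgue. norm (K (s n) y * u y) \<le> D * C * (B / \<mu> x) * wt y" for n
      proof (rule AE_I2)
        fix y
        have "norm (K (s n) y * u y) \<le> D * C * (1 / \<mu> (s n)) * wt y" using kernel_bound'[OF u] by simp
        also have "\<dots> \<le> D * C * (B / \<mu> x) * wt y"
          using le[of n] bdd_nonneg[OF u] C_nonneg by (intro mult_right_mono mult_left_mono) auto
        finally show "norm (K (s n) y * u y) \<le> D * C * (B / \<mu> x) * wt y" .
      qed
    qed
  qed
qed

lemma cont_meas: "continuous_on UNIV (g :: real^'n \<Rightarrow> real) \<Longrightarrow> g \<in> borel_measurable lebesgue"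
  by (intro borel_measurable_lebesgue_borel borel_measurable_continuous_onI)

lemma T_bdd: "bdd D u \<Longrightarrow> bdd (D * CT) (T u)"
  unfolding bdd_def[of "D * CT"] using T_bound T_cont cont_meas by auto

lemma T_diff: "bdd D u \<Longrightarrow> bdd D' v \<Longrightarrow> T (\<lambda>y. u y - v y) x = T u x - T v x"
  unfolding int_op_def using T_integrable[of D u x] T_integrable[of D' v x]
  by (simp add: right_diff_distrib)

lemma bdd_diff: "bdd D u \<Longrightarrow> bdd D' v \<Longrightarrow> bdd (D + D') (\<lambda>y. u y - v y)"
proof -
  assume a: "bdd D u" "bdd D' v"
  have "\<mu> x * \<bar>u x - v x\<bar> \<le> D + D'" for x
  proof -
    have "\<mu> x * \<bar>u x - v x\<bar> \<le> \<mu> x * (\<bar>u x\<bar> + \<bar>v x\<bar>)" using \<mu>_pos[of x] by (intro mult_left_mono) auto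
    also have "\<dots> \<le> D + D'" using bdd_le[OF a(1), of x] bdd_le[OF a(2), of x] by (simp add: distrib_left)
    finally show ?thesis .
  qed
  then show ?thesis using a by (auto simp: bdd_def)
qed

lemma bdd_add: "bdd D u \<Longrightarrow> bdd D' v \<Longrightarrow> bdd (D + D') (\<lambda>y. u y + v y)"
  using bdd_diff[of D u D' "\<lambda>y. - v y"] by (simp add: bdd_def)

lemma T_add: "bdd D u \<Longrightarrow> bdd D' v \<Longrightarrow> T (\<lambda>y. u y + v y) x = T u x + T v x"
  unfolding int_op_def using T_integrable[of D u x] T_integrable[of D' v x]
  by (simp add: distrib_left)

text \<open>\<open>B\<close> may be infinite, so that \<open>g = 0\<close> needs no separate treatment.\<close>

lemma schur:
  assumes G: "G \<in> borel_measurable borel" and Gi: "(\<integral>\<^sup>+v. G v * ennreal (\<omega> v) \<partial>lebesgue) \<le> g"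
    and k: "AE y in lebesgue. ennreal \<bar>k y\<bar> \<le> G (y - x)"
    and u: "\<And>y. ennreal (\<mu> y * \<bar>u y\<bar>) \<le> B"
  shows "ennreal (\<mu> x * \<bar>LINT y|lebesgue. k y * u y\<bar>) \<le> g * B"
proof (cases "integrable lebesgue (\<lambda>y. k y * u y)")
  \<comment> \<open>A non-integrable integrand has integral 0 by convention, which makes the bound
    trivial.\<close>
  case False
  then show ?thesis by (simp add: not_integrable_integral_eq)
next
  case True
  have m\<omega>: "(\<lambda>v. ennreal (\<omega> v)) \<in> borel_measurable borel"
    using cont_\<omega> by (intro measurable_compose[OF borel_measurable_continuous_onI measurable_ennreal])
  have mG: "(\<lambda>v. G v * ennreal (\<omega> v)) \<in> borel_measurable lebesgue"
    using G m\<omega> by (intro borel_measurable_lebesgue_borel borel_measurable_times_ennreal)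
  have "ennreal (\<mu> x * \<bar>LINT y|lebesgue. k y * u y\<bar>) = ennreal (\<mu> x) * ennreal \<bar>LINT y|lebesgue. k y * u y\<bar>"
    using \<mu>_pos[of x] by (simp add: ennreal_mult)
  also have "\<dots> \<le> ennreal (\<mu> x) * (\<integral>\<^sup>+y. ennreal \<bar>k y * u y\<bar> \<partial>lebesgue)"
    using integral_norm_bound_ennreal[OF True] by (intro mult_left_mono) auto
  also have "\<dots> = (\<integral>\<^sup>+y. ennreal (\<mu> x) * ennreal \<bar>k y * u y\<bar> \<partial>lebesgue)"
    using True by (intro nn_integral_cmult[symmetric]) auto
  \<comment> \<open>Once \<open>\<mu> x\<close> is traded for
    \<open>\<omega> (y - x) * \<mu> y\<close>, the majorant depends on \<open>y - x\<close> only,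
    and translation invariance makes the bound uniform in \<open>x\<close>.\<close>
  also have "\<dots> \<le> (\<integral>\<^sup>+y. (G (- x + y) * ennreal (\<omega> (- x + y))) * B \<partial>lebesgue)"
  proof (rule nn_integral_mono_AE)
    show "AE y in lebesgue. ennreal (\<mu> x) * ennreal \<bar>k y * u y\<bar> \<le> (G (- x + y) * ennreal (\<omega> (- x + y))) * B"
      using k
    proof eventually_elim
      case (elim y)
      have w: "0 \<le> \<omega> (y - x)" using \<omega>_ge1[of "y - x"] by simp
      have "ennreal (\<mu> x) * ennreal \<bar>k y * u y\<bar> \<le> ennreal (\<omega> (y - x) * \<mu> y) * ennreal \<bar>k y * u y\<bar>"
        by (intro mult_right_mono ennreal_leI \<mu>_mod) auto
      also have "\<dots> = ennreal \<bar>k y\<bar> * ennreal (\<omega> (y - x)) * ennreal (\<mu> y * \<bar>u y\<bar>)"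
        using w \<mu>_pos[of y] by (simp add: ennreal_mult abs_mult mult_ac)
      also have "\<dots> \<le> G (y - x) * ennreal (\<omega> (y - x)) * B"
        using elim u[of y] by (intro mult_mono mult_right_mono) auto
      finally show ?case by simp
    qed
  qed
  also have "\<dots> = (\<integral>\<^sup>+y. (G (- x + y) * ennreal (\<omega> (- x + y))) \<partial>lebesgue) * B"
    by (rule nn_integral_multc) (rule measurable_compose[OF measurable_lebesgue_plus mG])
  also have "(\<integral>\<^sup>+y. (G (- x + y) * ennreal (\<omega> (- x + y))) \<partial>lebesgue) = (\<integral>\<^sup>+v. G v * ennreal (\<omega> v) \<partial>lebesgue)"
    by (rule nn_integral_lebesgue_shift[OF mG, of "- x"])
  also have "\<dots> * B \<le> g * B" by (intro mult_right_mono Gi) auto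
  finally show ?thesis .
qed

end

subsection \<open>Averaging over lattice cells\<close>

text \<open>Coordinatewise rounding with ties upwards, so that the cells are half-open cubes and
  partition the space exactly.\<close>

definition nearest :: "real \<Rightarrow> real ^ 'n \<Rightarrow> real ^ 'n" where
  "nearest \<delta> x = (\<chi> i. \<delta> * of_int \<lfloor>x $ i / \<delta> + 1 / 2\<rfloor>)"

definition cell :: "real \<Rightarrow> real ^ 'n \<Rightarrow> (real ^ 'n) set" where
  "cell \<delta> l = {x. nearest \<delta> x = l}"

lemma nearest_in_lattice: "nearest \<delta> x \<in> lattice \<delta>"
  by (auto simp: nearest_def lattice_def)

lemma diff_nearest_in_cube:
  assumes "\<delta> > 0"
  shows "x - nearest \<delta> x \<in> cube (\<delta> / 2)"
  unfolding cube_def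
proof (intro CollectI allI)
  fix i
  let ?k = "\<lfloor>x $ i / \<delta> + 1 / 2\<rfloor>"
  have "of_int ?k \<le> x $ i / \<delta> + 1 / 2" "x $ i / \<delta> + 1 / 2 < of_int ?k + 1"
    using floor_correct[of "x $ i / \<delta> + 1 / 2"] by auto
  then have "\<delta> * of_int ?k \<le> x $ i + \<delta> / 2" "x $ i + \<delta> / 2 \<le> \<delta> * of_int ?k + \<delta>"
    using assms mult_left_mono[of "of_int ?k" "x $ i / \<delta> + 1 / 2" \<delta>]
      mult_left_mono[of "x $ i / \<delta> + 1 / 2" "of_int ?k + 1" \<delta>]
    by (simp_all add: distrib_left)
  then show "\<bar>(x - nearest \<delta> x) $ i\<bar> \<le> \<delta> / 2" by (auto simp: nearest_def abs_if)
qed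

lemma nearest_eq_iff:
  assumes "\<delta> > 0" "l \<in> lattice \<delta>"
  shows "nearest \<delta> x = l \<longleftrightarrow> (\<forall>i. l $ i - \<delta> / 2 \<le> x $ i \<and> x $ i < l $ i + \<delta> / 2)"
proof -
  have "(nearest \<delta> x) $ i = l $ i \<longleftrightarrow> l $ i - \<delta> / 2 \<le> x $ i \<and> x $ i < l $ i + \<delta> / 2" for i
  proof -
    obtain k :: int where k: "l $ i = \<delta> * of_int k" using assms(2) by (auto simp: lattice_def)
    have "(nearest \<delta> x) $ i = l $ i \<longleftrightarrow> \<lfloor>x $ i / \<delta> + 1 / 2\<rfloor> = k"
      using assms(1) by (simp add: nearest_def k)
    also have "\<dots> \<longleftrightarrow> of_int k \<le> x $ i / \<delta> + 1 / 2 \<and> x $ i / \<delta> + 1 / 2 < of_int k + 1"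
      by (auto simp: floor_eq_iff)
    also have "\<dots> \<longleftrightarrow> l $ i - \<delta> / 2 \<le> x $ i \<and> x $ i < l $ i + \<delta> / 2"
      using assms(1) by (simp add: k field_simps)
    finally show ?thesis .
  qed
  then show ?thesis by (simp add: vec_eq_iff)
qed

lemma countable_lattice: "countable (lattice \<delta> :: (real ^ 'n) set)"
proof -
  have "lattice \<delta> \<subseteq> range (\<lambda>k :: 'n \<Rightarrow> int. (\<chi> i. \<delta> * of_int (k i)) :: real ^ 'n)"
  proof
    fix x :: "real ^ 'n" assume "x \<in> lattice \<delta>"
    then have "\<forall>i. \<exists>k::int. x $ i = \<delta> * of_int k" by (simp add: lattice_def)
    then obtain k where "\<And>i. x $ i = \<delta> * of_int (k i :: int)" by metis
    then have "x = (\<chi> i. \<delta> * of_int (k i))" by (simp add: vec_eq_iff)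
    then show "x \<in> range (\<lambda>k :: 'n \<Rightarrow> int. (\<chi> i. \<delta> * of_int (k i)) :: real ^ 'n)" by blast
  qed
  then show ?thesis by (rule countable_subset) blast
qed

lemma infinite_lattice:
  assumes "\<delta> > 0"
  shows "infinite (lattice \<delta> :: (real ^ 'n) set)"
proof -
  have "inj (\<lambda>k :: nat. (\<chi> i. \<delta> * of_int (int k)) :: real ^ 'n)"
    using assms by (auto simp: inj_def vec_eq_iff)
  then have "infinite (range (\<lambda>k :: nat. (\<chi> i. \<delta> * of_int (int k)) :: real ^ 'n))"
    by (rule range_inj_infinite)
  moreover have "range (\<lambda>k :: nat. (\<chi> i. \<delta> * of_int (int k)) :: real ^ 'n) \<subseteq> lattice \<delta>"
    by (auto simp: lattice_def simp del: of_int_of_nat_eq)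
  ultimately show ?thesis using finite_subset by blast
qed

lemma cell_sets: "\<delta> > 0 \<Longrightarrow> l \<in> lattice \<delta> \<Longrightarrow> cell \<delta> l \<in> sets borel"
proof -
  assume a: "\<delta> > 0" "l \<in> lattice \<delta>"
  have "cell \<delta> l = (\<Inter>i. {x. l $ i - \<delta> / 2 \<le> x $ i} \<inter> {x. x $ i < l $ i + \<delta> / 2})"
    using nearest_eq_iff[OF a] by (auto simp: cell_def)
  also have "\<dots> \<in> sets borel"
    by (intro sets.countable_INT' sets.Int borel_closed borel_open closed_Collect_le open_Collect_less continuous_intros) auto
  finally show ?thesis .
qed

lemma measurable_nearest:
  assumes "\<delta> > 0"
  shows "nearest \<delta> \<in> lebesgue \<rightarrow>\<^sub>M count_space (lattice \<delta> :: (real ^ 'n) set)"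
proof (subst measurable_count_space_eq_countable[OF countable_lattice], intro conjI ballI)
  show "nearest \<delta> \<in> space lebesgue \<rightarrow> (lattice \<delta> :: (real ^ 'n) set)" by (auto simp: nearest_in_lattice)
  fix l :: "real ^ 'n" assume "l \<in> lattice \<delta>"
  moreover have "nearest \<delta> -` {l} \<inter> space lebesgue = cell \<delta> l" by (auto simp: cell_def)
  ultimately show "nearest \<delta> -` {l} \<inter> space lebesgue \<in> sets lebesgue"
    using cell_sets[OF assms, of l] by simp
qed

lemma cell_subset_cube: "\<delta> > 0 \<Longrightarrow> x \<in> cell \<delta> l \<Longrightarrow> x - l \<in> cube (\<delta> / 2)"
  using diff_nearest_in_cube[of \<delta> x] by (auto simp: cell_def)

text \<open>The two sets differ only on faces, a null set. This reconciles the closed cubes in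
  \<open>K_disc\<close> and \<open>gen\<close> with the disjoint cells used in the proof.\<close>

lemma cell_eq_cube_AE:
  assumes "\<delta> > 0" "l \<in> lattice \<delta>"
  shows "AE x in lebesgue. x \<in> cell \<delta> l \<longleftrightarrow> x - l \<in> cube (\<delta> / 2)"
proof -
  let ?a = "(\<chi> i. - (\<delta> / 2)) :: real ^ 'n" and ?b = "(\<chi> i. \<delta> / 2) :: real ^ 'n"
  have "cbox ?a ?b - box ?a ?b \<in> null_sets lebesgue"
    using negligible_frontier_interval[of ?a ?b] by (simp add: negligible_iff_null_sets)
  then have "AE z in lebesgue. z \<notin> cbox ?a ?b - box ?a ?b" by (rule AE_not_in)
  then have "AE x in lebesgue. - l + x \<notin> cbox ?a ?b - box ?a ?b" by (rule AE_lebesgue_shift)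
  then show ?thesis
  proof eventually_elim
    case (elim x)
    show ?case
    proof
      assume "x - l \<in> cube (\<delta> / 2)"
      then have "x - l \<in> box ?a ?b" using elim by (auto simp: cube_eq_cbox)
      then have "\<And>i. - (\<delta> / 2) < x $ i - l $ i \<and> x $ i - l $ i < \<delta> / 2" by (auto simp: mem_box_cart)
      then have "nearest \<delta> x = l" unfolding nearest_eq_iff[OF assms] by (smt (verit))
      then show "x \<in> cell \<delta> l" by (simp add: cell_def)
    qed (use cell_subset_cube assms in auto)
  qed
qed

lemma integral_cube_shift:
  fixes f :: "real ^ 'n \<Rightarrow> real"
  assumes "\<delta> > 0" "l \<in> lattice \<delta>" and f: "f \<in> borel_measurable lebesgue"
  shows "(LINT z:cube (\<delta> / 2)|lebesgue. f (l + z)) = (LINT y:cell \<delta> l|lebesgue. f y)"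
proof -
  have m1: "(\<lambda>y. indicator (cell \<delta> l) y *\<^sub>R f y) \<in> borel_measurable lebesgue"
    using cell_sets[OF assms(1,2)] by (intro borel_measurable_scaleR borel_measurable_indicator f) simp
  have eq: "AE y in lebesgue. indicator (cell \<delta> l) y *\<^sub>R f y = indicator (cube (\<delta> / 2)) (- l + y) *\<^sub>R f y"
    using cell_eq_cube_AE[OF assms(1,2)] by eventually_elim (auto split: split_indicator)
  have m2: "(\<lambda>y. indicator (cube (\<delta> / 2)) (- l + y) *\<^sub>R f y) \<in> borel_measurable lebesgue"
    by (rule borel_measurable_AE[OF m1 eq])
  have "(LINT y:cell \<delta> l|lebesgue. f y) = (LINT y|lebesgue. indicator (cube (\<delta> / 2)) (- l + y) *\<^sub>R f y)"
    unfolding set_lebesgue_integral_def by (rule integral_cong_AE[OF m1 m2 eq])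
  also have "\<dots> = (LINT z|lebesgue. indicator (cube (\<delta> / 2)) (- l + (l + z)) *\<^sub>R f (l + z))"
    by (rule integral_lebesgue_shift[OF m2, symmetric])
  finally show ?thesis by (simp add: set_lebesgue_integral_def)
qed

section \<open>Integrals over a cube and cell averages\<close>

lemma cube_lmeasurable: "cube r \<in> lmeasurable"
  by (simp add: cube_eq_cbox lmeasurable_cbox)

lemma measure_cube: "\<delta> \<ge> 0 \<Longrightarrow> measure lebesgue (cube (\<delta> / 2) :: (real ^ 'n) set) = \<delta> ^ CARD('n)"
  using emeasure_cube[of "\<delta> / 2", where 'n='n] by (simp add: measure_def)

lemma set_integrable_cube:
  fixes h :: "real ^ 'n \<Rightarrow> real"
  assumes h: "h \<in> borel_measurable lebesgue" and B: "\<And>z. z \<in> cube r \<Longrightarrow> \<bar>h z\<bar> \<le> B"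
  shows "set_integrable lebesgue (cube r) h"
  unfolding set_integrable_def
proof (rule Bochner_Integration.integrable_bound)
  show "integrable lebesgue (\<lambda>z. indicator (cube r) z * B)"
    using cube_lmeasurable[of r] by (intro integrable_mult_left) (auto simp: fmeasurable_def)
  show "(\<lambda>z. indicator (cube r) z *\<^sub>R h z) \<in> borel_measurable lebesgue"
    using sets_cube[of r] by (intro borel_measurable_scaleR borel_measurable_indicator h) simp
  show "AE z in lebesgue. norm (indicator (cube r) z *\<^sub>R h z) \<le> norm (indicator (cube r) z * B)"
    using order_trans[OF B abs_ge_self] by (intro AE_I2) (auto split: split_indicator)
qed

lemma set_integral_cube_bound:
  fixes h :: "real ^ 'n \<Rightarrow> real"
  assumes "\<delta> \<ge> 0" and h: "h \<in> borel_measurable lebesgue" and B: "\<And>z. z \<in> cube (\<delta> / 2) \<Longrightarrow> \<bar>h z\<bar> \<le> B"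
  shows "\<bar>LINT z:cube (\<delta> / 2)|lebesgue. h z\<bar> \<le> \<delta> ^ CARD('n) * B"
proof -
  have i: "set_integrable lebesgue (cube (\<delta> / 2)) h" by (rule set_integrable_cube[OF h B])
  have ic: "set_integrable lebesgue (cube (\<delta> / 2)) (\<lambda>z :: real ^ 'n. B)"
    by (rule set_integrable_cube[of _ _ "\<bar>B\<bar>"]) auto
  have "\<bar>LINT z:cube (\<delta> / 2)|lebesgue. h z\<bar> \<le> (LINT z:cube (\<delta> / 2)|lebesgue. \<bar>h z\<bar>)"
    unfolding set_lebesgue_integral_def
    by (rule order_trans[OF integral_abs_bound]) (auto intro!: eq_refl Bochner_Integration.integral_cong split: split_indicator)
  also have "\<dots> \<le> (LINT z:(cube (\<delta> / 2) :: (real ^ 'n) set)|lebesgue. B)"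
    using set_integrable_abs[OF i] ic B by (rule set_integral_mono)
  also have "\<dots> = \<delta> ^ CARD('n) * B"
    using measure_cube[OF assms(1), where 'n='n] by (simp add: set_lebesgue_integral_def)
  finally show ?thesis .
qed

lemma set_integral_suminf_cube:
  fixes f :: "nat \<Rightarrow> real ^ 'n \<Rightarrow> real"
  assumes "\<delta> \<ge> 0" and f: "\<And>n. f n \<in> borel_measurable lebesgue"
    and B: "\<And>n z. z \<in> cube (\<delta> / 2) \<Longrightarrow> \<bar>f n z\<bar> \<le> w n" and w: "summable w"
  shows "(LINT z:cube (\<delta> / 2)|lebesgue. (\<Sum>n. f n z)) = (\<Sum>n. LINT z:cube (\<delta> / 2)|lebesgue. f n z)"
proof -
  let ?c = "cube (\<delta> / 2) :: (real ^ 'n) set"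
  have z: "0 \<in> ?c" using assms(1) by (simp add: cube_def)
  have w0: "0 \<le> w n" for n using B[OF z, of n] by linarith
  have "(LINT z:?c|lebesgue. (\<Sum>n. f n z)) = (LINT z|lebesgue. (\<Sum>n. indicator ?c z *\<^sub>R f n z))"
    unfolding set_lebesgue_integral_def
    by (intro Bochner_Integration.integral_cong) (auto split: split_indicator)
  also have "\<dots> = (\<Sum>n. LINT z|lebesgue. indicator ?c z *\<^sub>R f n z)"
  proof (rule integral_suminf)
    show i: "integrable lebesgue (\<lambda>z. indicator ?c z *\<^sub>R f n z)" for n
      using set_integrable_cube[OF f B] by (simp add: set_integrable_def)
    show "AE z in lebesgue. summable (\<lambda>n. norm (indicator ?c z *\<^sub>R f n z))"
      using B w0 by (intro AE_I2 summable_comparison_test'[OF w, of 0]) (auto split: split_indicator)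
    show "summable (\<lambda>n. LINT z|lebesgue. norm (indicator ?c z *\<^sub>R f n z))"
    proof (rule summable_comparison_test'[OF summable_mult[OF w, of "\<delta> ^ CARD('n)"], of 0])
      fix n
      have "(LINT z|lebesgue. norm (indicator ?c z *\<^sub>R f n z)) = (LINT z:?c|lebesgue. \<bar>f n z\<bar>)"
        unfolding set_lebesgue_integral_def
        by (intro Bochner_Integration.integral_cong) (auto split: split_indicator)
      moreover have "\<bar>LINT z:?c|lebesgue. \<bar>f n z\<bar>\<bar> \<le> \<delta> ^ CARD('n) * w n"
        using f[of n] B by (intro set_integral_cube_bound assms(1)) auto
      ultimately show "norm (LINT z|lebesgue. norm (indicator ?c z *\<^sub>R f n z)) \<le> \<delta> ^ CARD('n) * w n"
        by simp
    qed
  qed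
  finally show ?thesis by (simp add: set_lebesgue_integral_def)
qed

text \<open>The operator P. It sees \<open>x\<close> only through \<open>nearest \<delta> x\<close>,
  so its values are step functions on the cells.\<close>

definition avg :: "real \<Rightarrow> (real ^ 'n \<Rightarrow> real) \<Rightarrow> real ^ 'n \<Rightarrow> real" where
  "avg \<delta> g x = (LINT z:cube (\<delta> / 2)|lebesgue. g (nearest \<delta> x + z)) / \<delta> ^ CARD('n)"

lemma avg_measurable:
  assumes "\<delta> > 0"
  shows "avg \<delta> g \<in> borel_measurable lebesgue"
  unfolding avg_def[abs_def]
  by (rule measurable_compose_countable'[OF _ measurable_nearest[OF assms] countable_lattice, where
      f="\<lambda>l x. (LINT z:cube (\<delta> / 2)|lebesgue. g (l + z)) / \<delta> ^ CARD('n)"]) simp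

text \<open>Subtracting a constant commutes with taking the mean. \<open>c = 0\<close> bounds the
  size of an average; \<open>c\<close> equal to the value at \<open>x\<close> bounds its distance
  from the function.\<close>

lemma avg_bound:
  fixes g :: "real ^ 'n \<Rightarrow> real"
  assumes d: "\<delta> > 0" and g: "g \<in> borel_measurable lebesgue"
    and B: "\<And>z. z \<in> cube (\<delta> / 2) \<Longrightarrow> \<bar>g (nearest \<delta> x + z) - c\<bar> \<le> B"
  shows "\<bar>avg \<delta> g x - c\<bar> \<le> B"
proof -
  let ?c = "cube (\<delta> / 2) :: (real ^ 'n) set" and ?h = "\<lambda>z. g (nearest \<delta> x + z) - c"
  have m: "?h \<in> borel_measurable lebesgue"
    using measurable_compose[OF measurable_lebesgue_plus[of "nearest \<delta> x"] g] by simp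
  have i: "set_integrable lebesgue ?c ?h" by (rule set_integrable_cube[OF m B])
  have ic: "set_integrable lebesgue ?c (\<lambda>z. c)"
    by (rule set_integrable_cube[of _ _ "\<bar>c\<bar>"]) auto
  have "(LINT z:?c|lebesgue. g (nearest \<delta> x + z)) = (LINT z:?c|lebesgue. ?h z + c)" by simp
  also have "\<dots> = (LINT z:?c|lebesgue. ?h z) + (LINT z:?c|lebesgue. c)"
    by (rule set_integral_add(2)[OF i ic])
  also have "(LINT z:?c|lebesgue. c) = c * \<delta> ^ CARD('n)"
    using measure_cube[of \<delta>, where 'n='n] d by (simp add: set_lebesgue_integral_def)
  finally have e: "avg \<delta> g x - c = (LINT z:?c|lebesgue. ?h z) / \<delta> ^ CARD('n)"
    using d by (simp add: avg_def add_divide_distrib)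
  have "\<bar>LINT z:?c|lebesgue. ?h z\<bar> \<le> \<delta> ^ CARD('n) * B"
    using d by (intro set_integral_cube_bound m B) auto
  then show ?thesis unfolding e using d by (simp add: field_simps abs_divide)
qed

lemma cube_minus: "x \<in> cube r \<Longrightarrow> - x \<in> cube r" by (simp add: cube_def)

lemma cube_add: "x \<in> cube r \<Longrightarrow> y \<in> cube s \<Longrightarrow> x + y \<in> cube (r + s)"
  unfolding cube_def by (auto intro!: order_trans[OF abs_triangle_ineq] add_mono)

text \<open>Two half-meshes add up, from \<open>x\<close> to its lattice point and from there to the
  averaged point. This is why the modulus is taken at \<delta> and not at half of it.\<close>

lemma nearest_cube:
  "\<delta> > 0 \<Longrightarrow> z \<in> cube (\<delta> / 2) \<Longrightarrow> (nearest \<delta> x + z) - x \<in> cube \<delta>"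
  using cube_add[OF _ cube_minus[OF diff_nearest_in_cube[of \<delta> x]], of z "\<delta> / 2"] by (simp add: algebra_simps)

section \<open>Fubini for the kernel over bounded sets\<close>

context decaying_kernel begin

text \<open>\<open>K\<close> is measurable only for the completed measure on the product, whereas
  Fubini is applied to \<open>lborel\<close>. Hence a Borel version is taken; the exceptional null
  set has null sections in both directions.\<close>

lemma K_borel:
  obtains K' :: "(real ^ 'n) \<times> (real ^ 'n) \<Rightarrow> real"
  where "K' \<in> borel_measurable (lborel \<Otimes>\<^sub>M lborel)"
    "AE x in lborel. AE y in lborel. K x y = K' (x, y)"
    "AE y in lborel. AE x in lborel. K x y = K' (x, y)"
proof -
  obtain K' where K': "K' \<in> borel_measurable lborel" "AE z in lborel. K (fst z) (snd z) = K' z"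
    using completion_ex_borel_measurable_real[OF K_meas] by auto
  obtain N where N: "{z \<in> space lborel. K (fst z) (snd z) \<noteq> K' z} \<subseteq> N"
      "emeasure lborel N = 0" "N \<in> sets lborel"
    using AE_E[OF K'(2)] .
  have NN: "K x y \<noteq> K' (x, y) \<Longrightarrow> (x, y) \<in> N" for x y using N(1) by auto
  have N': "N \<in> sets (lborel \<Otimes>\<^sub>M lborel)" using N(3) unfolding lborel_prod .
  have "AE z in lborel. z \<notin> N" by (rule AE_not_in) (use N in auto)
  then have "AE z in lborel \<Otimes>\<^sub>M lborel. z \<notin> N" unfolding lborel_prod .
  then have 1: "AE x in lborel. AE y in lborel. (x, y) \<notin> N"
    by (rule lborel_pair.AE_pair)
  have "{z \<in> space (lborel \<Otimes>\<^sub>M lborel). (fst z, snd z) \<notin> N} = space (lborel \<Otimes>\<^sub>M lborel) - N"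
    by auto
  then have "{z \<in> space (lborel \<Otimes>\<^sub>M lborel). (fst z, snd z) \<notin> N} \<in> sets (lborel \<Otimes>\<^sub>M lborel)"
    using sets.Diff[OF sets.top N'] by (simp only:)
  from lborel_pair.AE_commute[OF this] 1 have 2: "AE y in lborel. AE x in lborel. (x, y) \<notin> N"
    by blast
  show thesis
  proof (rule that)
    show "K' \<in> borel_measurable (lborel \<Otimes>\<^sub>M lborel)" using K'(1) unfolding lborel_prod .
    show "AE x in lborel. AE y in lborel. K x y = K' (x, y)"
      using 1 by eventually_elim (erule eventually_mono, use NN in blast)
    show "AE y in lborel. AE x in lborel. K x y = K' (x, y)"
      using 2 by eventually_elim (erule eventually_mono, use NN in blast)
  qed
qed

text \<open>\<mu> need not be continuous, so compactness is used for \<omega> and transported by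
  comparing \<open>\<mu> x\<close> with \<open>\<mu> 0\<close>.\<close>

lemma \<mu>_bounded_below:
  assumes "compact S"
  obtains m where "m > 0" "\<And>x. x \<in> S \<Longrightarrow> 1 / \<mu> x \<le> m"
proof -
  have "compact ((\<lambda>x. \<omega> (x - 0)) ` S)"
    by (intro compact_continuous_image continuous_on_compose2[OF cont_\<omega>] continuous_intros assms) auto
  then have "bounded ((\<lambda>x. \<omega> (x - 0)) ` S)" by (rule compact_imp_bounded)
  then obtain B where "\<And>r. r \<in> (\<lambda>x. \<omega> (x - 0)) ` S \<Longrightarrow> norm r \<le> B" by (auto simp: bounded_iff)
  then have B: "\<And>x. x \<in> S \<Longrightarrow> \<omega> (x - 0) \<le> B" by fastforce
  show thesis
  proof (rule that[of "(\<bar>B\<bar> + 1) / \<mu> 0"])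
    show "(\<bar>B\<bar> + 1) / \<mu> 0 > 0" using \<mu>_pos[of 0] by simp
    fix x assume x: "x \<in> S"
    have "\<mu> 0 \<le> \<omega> (x - 0) * \<mu> x" by (rule \<mu>_mod)
    also have "\<dots> \<le> (\<bar>B\<bar> + 1) * \<mu> x" using B[OF x] \<mu>_pos[of x] by (intro mult_right_mono) auto
    finally show "1 / \<mu> x \<le> (\<bar>B\<bar> + 1) / \<mu> 0" using \<mu>_pos[of 0] \<mu>_pos[of x] by (simp add: field_simps)
  qed
qed

lemma wt_borel: "wt \<in> borel_measurable borel"
  unfolding wt_def[abs_def] by (rule borel_measurable_decay_weight)

text \<open>On the bounded set \<open>S\<close> the factor \<open>1 / \<mu> x\<close> is bounded, so
  the integrand is dominated by an indicator of finite measure times \<open>wt\<close>. The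
  resulting interchange is what produces the middle average when \<open>K_disc\<close> is rewritten
  as \<open>TPT\<close>.\<close>

lemma
  assumes v: "bdd D v" "continuous_on UNIV v" and S: "S \<in> sets borel" "S \<subseteq> S'" "compact S'"
  shows slice_measurable: "(\<lambda>y. LINT x:S|lebesgue. K x y) \<in> borel_measurable lebesgue"
    and slice_fubini: "(LINT y|lebesgue. (LINT x:S|lebesgue. K x y) * v y) = (LINT x:S|lebesgue. T v x)"
proof -
  obtain K' :: "(real ^ 'n) \<times> (real ^ 'n) \<Rightarrow> real" where K'[measurable]: "K' \<in> borel_measurable (lborel \<Otimes>\<^sub>M lborel)"
    and xy: "AE x in lborel. AE y in lborel. K x y = K' (x, y)"
    and yx: "AE y in lborel. AE x in lborel. K x y = K' (x, y)"
    by (rule K_borel)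
  have vb[measurable]: "v \<in> borel_measurable borel" using v(2) by (rule borel_measurable_continuous_onI)
  have Sb[measurable]: "S \<in> sets borel" by (rule S(1))
  note wt_borel[measurable]
  have m1: "(\<lambda>x. K' (x, y)) \<in> borel_measurable lborel" and m2: "(\<lambda>y. K' (x, y)) \<in> borel_measurable lborel" for x y
    by measurable
  have leb: "f \<in> borel_measurable lborel \<Longrightarrow> f \<in> borel_measurable lebesgue" for f :: "real ^ 'n \<Rightarrow> real"
    by (rule measurable_completion)
  have ind: "(\<lambda>x. indicator S x :: real) \<in> borel_measurable lebesgue"
    by (rule leb) measurable
  have y_eq: "AE y in lebesgue. (LINT x|lborel. indicator S x * K' (x, y)) = (LINT x:S|lebesgue. K x y)"
    using AE_completion[OF yx]
  proof eventually_elim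
    case (elim y)
    have m: "(\<lambda>x. indicator S x * K' (x, y)) \<in> borel_measurable lborel" by measurable
    have "(LINT x|lborel. indicator S x * K' (x, y)) = (LINT x|lebesgue. indicator S x * K' (x, y))"
      by (rule integral_completion[OF m, symmetric])
    also have "\<dots> = (LINT x|lebesgue. indicator S x * K x y)"
    proof (rule integral_cong_AE[OF leb[OF m]])
      show "(\<lambda>x. indicator S x * K x y) \<in> borel_measurable lebesgue"
        by (intro borel_measurable_times ind K_meas_left)
      show "AE x in lebesgue. indicator S x * K' (x, y) = indicator S x * K x y"
        using AE_completion[OF elim] by eventually_elim simp
    qed
    finally show ?case by (simp add: set_lebesgue_integral_def)
  qed
  have my: "(\<lambda>y. LINT x|lborel. indicator S x * K' (x, y)) \<in> borel_measurable lborel"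
    by measurable
  show slice: "(\<lambda>y. LINT x:S|lebesgue. K x y) \<in> borel_measurable lebesgue"
    by (rule borel_measurable_AE[OF leb[OF my] y_eq])
  obtain m where m: "m > 0" "\<And>x. x \<in> S' \<Longrightarrow> 1 / \<mu> x \<le> m" using \<mu>_bounded_below[OF S(3)] by blast
  define F where "F x y = indicator S x * K' (x, y) * v y" for x y
  have Fm[measurable]: "case_prod F \<in> borel_measurable (lborel \<Otimes>\<^sub>M lborel)"
    unfolding F_def by measurable
  have Fm': "F x \<in> borel_measurable lborel" for x unfolding F_def by measurable
  have nn: "0 \<le> D * C" using bdd_nonneg[OF v(1)] C_nonneg by simp
  have Kb: "\<bar>indicator S x * K x y * v y\<bar> \<le> indicator S x * (D * C * m) * wt y" for x y
  proof (cases "x \<in> S")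
    case True
    have "\<bar>K x y * v y\<bar> \<le> D * C * (1 / \<mu> x) * wt y" using kernel_bound'[OF v(1)] by simp
    also have "\<dots> \<le> D * C * m * wt y"
      using m(2)[of x] True S(2) nn by (intro mult_right_mono mult_left_mono) auto
    finally show ?thesis using True by simp
  qed simp
  have iw: "integrable lborel wt"
    using wt_integrable integrable_completion[of wt lborel] wt_borel by simp
  have xF: "AE x in lborel. integrable lborel (F x) \<and> (LINT y|lborel. norm (F x y)) \<le> indicator S x * (D * C * m * (LINT y|lborel. wt y))"
    using xy
  proof eventually_elim
    case (elim x)
    have b: "AE y in lborel. norm (F x y) \<le> indicator S x * (D * C * m) * wt y"
      using elim by eventually_elim (metis F_def Kb real_norm_def)
    have i: "integrable lborel (F x)"
      by (rule Bochner_Integration.integrable_bound[OF _ Fm', of "\<lambda>y. indicator S x * (D * C * m) * wt y"])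
        (use b iw nn m(1) in \<open>auto elim!: eventually_mono intro: order_trans[OF _ abs_ge_self]\<close>)
    have "(LINT y|lborel. norm (F x y)) \<le> (LINT y|lborel. indicator S x * (D * C * m) * wt y)"
      using i iw b by (intro integral_mono_AE) auto
    then show ?case using i by simp
  qed
  have iF: "integrable (lborel \<Otimes>\<^sub>M lborel) (case_prod F)"
  proof (rule lborel_pair.Fubini_integrable)
    show "case_prod F \<in> borel_measurable (lborel \<Otimes>\<^sub>M lborel)" by (rule Fm)
    show "AE x in lborel. integrable lborel (\<lambda>y. case_prod F (x, y))"
      using xF by eventually_elim simp
    have "S \<in> lmeasurable"
      by (intro bounded_set_imp_lmeasurable bounded_subset[OF compact_imp_bounded[OF S(3)] S(2)]) (simp add: S(1))
    then have "emeasure lborel S < \<infinity>" using S(1) by (auto simp: fmeasurable_def)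
    then have iS: "integrable lborel (\<lambda>x. indicator S x * (D * C * m * (LINT y|lborel. wt y)))"
      by (intro integrable_mult_left integrable_real_indicator) auto
    show "integrable lborel (\<lambda>x. LINT y|lborel. norm (case_prod F (x, y)))"
    proof (rule Bochner_Integration.integrable_bound[OF iS])
      show "(\<lambda>x. LINT y|lborel. norm (case_prod F (x, y))) \<in> borel_measurable lborel" by measurable
      show "AE x in lborel. norm (LINT y|lborel. norm (case_prod F (x, y))) \<le> norm (indicator S x * (D * C * m * (LINT y|lborel. wt y)))"
        using xF by eventually_elim (auto intro: order_trans[OF _ abs_ge_self])
    qed
  qed
  have "(LINT y|lebesgue. (LINT x:S|lebesgue. K x y) * v y) = (LINT y|lebesgue. (LINT x|lborel. F x y))"
  proof (rule integral_cong_AE)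
    show "(\<lambda>y. (LINT x:S|lebesgue. K x y) * v y) \<in> borel_measurable lebesgue"
      by (intro borel_measurable_times slice bdd_meas[OF v(1)])
    show "(\<lambda>y. LINT x|lborel. F x y) \<in> borel_measurable lebesgue"
      by (rule leb) measurable
    show "AE y in lebesgue. (LINT x:S|lebesgue. K x y) * v y = (LINT x|lborel. F x y)"
      using y_eq by eventually_elim (simp add: F_def)
  qed
  also have "\<dots> = (LINT y|lborel. (LINT x|lborel. F x y))"
    by (rule integral_completion) measurable
  also have "\<dots> = (LINT x|lborel. (LINT y|lborel. F x y))"
    by (rule lborel_pair.Fubini_integral[OF iF])
  also have "\<dots> = (LINT x|lebesgue. (LINT y|lborel. F x y))"
    by (rule integral_completion[symmetric]) measurable
  also have "\<dots> = (LINT x|lebesgue. indicator S x * T v x)"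
  proof (rule integral_cong_AE)
    show "(\<lambda>x. LINT y|lborel. F x y) \<in> borel_measurable lebesgue"
      by (rule leb) measurable
    show "(\<lambda>x. indicator S x * T v x) \<in> borel_measurable lebesgue"
      by (intro borel_measurable_times ind bdd_meas[OF T_bdd[OF v(1)]])
    show "AE x in lebesgue. (LINT y|lborel. F x y) = indicator S x * T v x"
      using AE_completion[OF xy]
    proof eventually_elim
      case (elim x)
      have "(LINT y|lborel. F x y) = (LINT y|lebesgue. F x y)"
        by (rule integral_completion[OF Fm', symmetric])
      also have "\<dots> = (LINT y|lebesgue. indicator S x * (K x y * v y))"
      proof (rule integral_cong_AE[OF leb[OF Fm']])
        show "(\<lambda>y. indicator S x * (K x y * v y)) \<in> borel_measurable lebesgue"
          by (intro borel_measurable_times borel_measurable_const K_meas_right bdd_meas[OF v(1)])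
        show "AE y in lebesgue. F x y = indicator S x * (K x y * v y)"
          using AE_completion[OF elim] by eventually_elim (simp add: F_def)
      qed
      finally show ?case by (simp add: int_op_def)
    qed
  qed
  finally show "(LINT y|lebesgue. (LINT x:S|lebesgue. K x y) * v y) = (LINT x:S|lebesgue. T v x)"
    by (simp add: set_lebesgue_integral_def)
qed

end

subsection \<open>The discretised kernel\<close>

text \<open>For positive mesh the lattice is countably infinite, so sums over it become series,
  which can be integrated term by term.\<close>

definition lat_enum :: "real \<Rightarrow> nat \<Rightarrow> real ^ 'n" where
  "lat_enum \<delta> = from_nat_into (lattice \<delta>)"

lemma bij_lat_enum: "\<delta> > 0 \<Longrightarrow> bij_betw (lat_enum \<delta>) UNIV (lattice \<delta> :: (real ^ 'n) set)"
  unfolding lat_enum_def by (intro bij_betw_from_nat_into countable_lattice infinite_lattice)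

lemma lat_enum_in: "\<delta> > 0 \<Longrightarrow> lat_enum \<delta> n \<in> lattice \<delta>"
  using bij_lat_enum[of \<delta>] by (auto simp: bij_betw_def)

lemma lat_enum_eq_iff: "\<delta> > 0 \<Longrightarrow> lat_enum \<delta> m = (lat_enum \<delta> n :: real ^ 'n) \<longleftrightarrow> m = n"
  using bij_lat_enum[of \<delta>, where 'n='n] by (auto simp: bij_betw_def inj_def)

lemma UN_cells: "\<delta> > 0 \<Longrightarrow> (\<Union>n. cell \<delta> (lat_enum \<delta> n)) = (UNIV :: (real ^ 'n) set)"
proof -
  assume "\<delta> > 0"
  then have "nearest \<delta> x \<in> range (lat_enum \<delta>)" for x :: "real ^ 'n"
    using bij_lat_enum[of \<delta>, where 'n='n] nearest_in_lattice[of \<delta> x] by (simp add: bij_betw_def)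
  then show ?thesis by (auto simp: cell_def)
qed

lemma cells_disjoint: "\<delta> > 0 \<Longrightarrow> m \<noteq> n \<Longrightarrow> cell \<delta> (lat_enum \<delta> m) \<inter> cell \<delta> (lat_enum \<delta> n :: real ^ 'n) = {}"
  using lat_enum_eq_iff[of \<delta> m n, where 'n='n] by (auto simp: cell_def)

lemma measure_cell:
  fixes l :: "real ^ 'n"
  assumes "\<delta> > 0" "l \<in> lattice \<delta>"
  shows "(LINT y:cell \<delta> l|lebesgue. c) = \<delta> ^ CARD('n) * c"
  using integral_cube_shift[OF assms, of "\<lambda>_. c"] measure_cube[of \<delta>, where 'n='n] assms(1)
  by (auto simp: set_lebesgue_integral_def)

lemma integral_cells_suminf:
  fixes h :: "real ^ 'n \<Rightarrow> real"
  assumes "\<delta> > 0" "integrable lebesgue h"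
  shows "(LINT y|lebesgue. h y) = (\<Sum>n. LINT y:cell \<delta> (lat_enum \<delta> n)|lebesgue. h y)"
proof -
  have "(LINT y:(\<Union>n. cell \<delta> (lat_enum \<delta> n))|lebesgue. h y) = (\<Sum>n. LINT y:cell \<delta> (lat_enum \<delta> n)|lebesgue. h y)"
  proof (rule lebesgue_integral_countable_add)
    show "cell \<delta> (lat_enum \<delta> i :: real ^ 'n) \<in> sets lebesgue" for i
      by (simp add: cell_sets lat_enum_in assms(1))
    show "set_integrable lebesgue (\<Union>n. cell \<delta> (lat_enum \<delta> n)) h"
      using assms by (simp add: UN_cells set_integrable_def)
  qed (use cells_disjoint[OF assms(1)] in auto)
  then show ?thesis using assms(1) by (simp add: UN_cells set_lebesgue_integral_def)
qed

lemma summable_cells: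
  fixes h :: "real ^ 'n \<Rightarrow> real"
  assumes d: "\<delta> > 0" and h: "integrable lebesgue h" "\<And>y. 0 \<le> h y"
  shows "summable (\<lambda>n. LINT y:cell \<delta> (lat_enum \<delta> n)|lebesgue. h y)"
proof (rule summableI_nonneg_bounded)
  show "0 \<le> (LINT y:cell \<delta> (lat_enum \<delta> n)|lebesgue. h y)" for n
    unfolding set_lebesgue_integral_def by (intro integral_nonneg_AE) (simp add: h(2))
  fix N :: nat
  let ?A = "\<lambda>n. cell \<delta> (lat_enum \<delta> n) :: (real ^ 'n) set"
  have s: "?A n \<in> sets lebesgue" for n
    by (simp add: cell_sets lat_enum_in d)
  have i: "integrable lebesgue (\<lambda>y. indicator (?A n) y *\<^sub>R h y)" for n
    by (rule integrable_mult_indicator[OF s h(1)])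
  have "(\<Sum>n<N. LINT y:?A n|lebesgue. h y) = (LINT y|lebesgue. (\<Sum>n<N. indicator (?A n) y *\<^sub>R h y))"
    unfolding set_lebesgue_integral_def by (rule Bochner_Integration.integral_sum[symmetric]) (rule i)
  also have "\<dots> \<le> (LINT y|lebesgue. h y)"
  proof (rule integral_mono[OF _ h(1)])
    show "integrable lebesgue (\<lambda>y. \<Sum>n<N. indicator (?A n) y *\<^sub>R h y)"
      using i by (intro Bochner_Integration.integrable_sum)
    fix y
    have "disjoint_family_on ?A {..<N}"
      using cells_disjoint[OF d] by (auto simp: disjoint_family_on_def)
    then have "(\<Sum>n<N. indicator (?A n) y :: real) = indicator (\<Union>n<N. ?A n) y"
      by (intro indicator_UN_disjoint[symmetric]) auto
    also have "\<dots> \<le> 1" by (auto split: split_indicator)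
    finally have "(\<Sum>n<N. indicator (?A n) y) * h y \<le> 1 * h y" by (intro mult_right_mono h(2))
    then show "(\<Sum>n<N. indicator (?A n) y *\<^sub>R h y) \<le> h y" by (simp add: sum_distrib_right)
  qed
  finally show "(\<Sum>n<N. LINT y:?A n|lebesgue. h y) \<le> (LINT y|lebesgue. h y)" .
qed

section \<open>Cellwise majorants and the operator of the discretised kernel\<close>

context decaying_kernel begin

text \<open>A shift by at most \<delta> in the maximum norm changes the l1 norm by at most d times
  \<delta>, hence \<open>1 + norm_l1\<close> by at most the factor
  \<open>1 + real CARD('n) * \<delta>\<close>.\<close>

lemma wt_le_shift:
  assumes "x - y \<in> cube \<delta>" "\<delta> > 0"
  shows "wt x \<le> (1 + real CARD('n) * \<delta>) powr \<alpha> * wt y"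
proof -
  let ?k = "1 + real CARD('n) * \<delta>"
  have k: "?k \<ge> 1" using assms(2) by simp
  have "norm_l1 (y - x) \<le> (\<Sum>i\<in>(UNIV :: 'n set). \<delta>)"
    unfolding norm_l1_def using assms(1) by (intro sum_mono) (auto simp: cube_def abs_minus_commute)
  then have "norm_l1 (y - x) \<le> real CARD('n) * \<delta>" by simp
  moreover have "norm_l1 y \<le> norm_l1 x + norm_l1 (y - x)"
    using norm_l1_add_le[of x "y - x"] by simp
  moreover have "0 \<le> (real CARD('n) * \<delta>) * norm_l1 x" using norm_l1_nonneg[of x] assms(2) by simp
  ultimately have "1 + norm_l1 y \<le> ?k * (1 + norm_l1 x)" by (simp add: algebra_simps)
  moreover have p: "1 + norm_l1 y > 0" "1 + norm_l1 x > 0"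
    using norm_l1_nonneg[of x] norm_l1_nonneg[of y] by linarith+
  ultimately have "(?k * (1 + norm_l1 x)) powr (- \<alpha>) \<le> wt y"
    unfolding wt_def using \<alpha>_pos by (intro powr_mono2') auto
  then have "?k powr (- \<alpha>) * wt x \<le> wt y"
    using k p by (simp add: wt_def powr_mult)
  then have "?k powr \<alpha> * (?k powr (- \<alpha>) * wt x) \<le> ?k powr \<alpha> * wt y"
    by (rule mult_left_mono) simp
  then show ?thesis using k by (simp add: powr_minus field_simps)
qed

text \<open>The mean of \<open>wt\<close> over a cell, enlarged by the factor of
  \<open>wt_le_shift\<close> so as to dominate \<open>wt\<close> on the closed cube. As a multiple
  of the cell integrals it is summable.\<close>

definition cell_wt :: "real \<Rightarrow> nat \<Rightarrow> real" where
  "cell_wt \<delta> n = (1 + real CARD('n) * \<delta>) powr \<alpha> / \<delta> ^ CARD('n) *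
     (LINT y:cell \<delta> (lat_enum \<delta> n :: real ^ 'n)|lebesgue. wt y)"

lemma summable_cell_wt: "\<delta> > 0 \<Longrightarrow> summable (cell_wt \<delta>)"
  unfolding cell_wt_def[abs_def] by (intro summable_mult summable_cells) auto

lemma wt_le_cell_wt:
  assumes d: "\<delta> > 0" and z: "z \<in> cube (\<delta> / 2)"
  shows "wt (lat_enum \<delta> n + z) \<le> cell_wt \<delta> n"
proof -
  let ?l = "lat_enum \<delta> n :: real ^ 'n" and ?k = "(1 + real CARD('n) * \<delta>) powr \<alpha>"
  have l: "?l \<in> lattice \<delta>" by (rule lat_enum_in[OF d])
  have s: "cell \<delta> ?l \<in> sets lebesgue" using cell_sets[OF d l] by simp
  have "cell \<delta> ?l \<subseteq> (+) ?l ` cube (\<delta> / 2)"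
  proof
    fix y assume "y \<in> cell \<delta> ?l"
    then have "y - ?l \<in> cube (\<delta> / 2)" by (rule cell_subset_cube[OF d])
    then show "y \<in> (+) ?l ` cube (\<delta> / 2)" by (intro image_eqI[of _ _ "y - ?l"]) auto
  qed
  then have f: "cell \<delta> ?l \<in> lmeasurable"
    by (intro bounded_set_imp_lmeasurable[OF _ s])
      (rule bounded_subset[OF bounded_translation[OF compact_imp_bounded[OF compact_cube]]])
  have "\<delta> ^ CARD('n) * wt (?l + z) = (LINT y:cell \<delta> ?l|lebesgue. wt (?l + z))"
    by (rule measure_cell[OF d l, symmetric])
  also have "\<dots> \<le> (LINT y:cell \<delta> ?l|lebesgue. ?k * wt y)"
  proof (rule set_integral_mono)
    show "set_integrable lebesgue (cell \<delta> ?l) (\<lambda>y. wt (?l + z))"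
      using f by (auto simp: set_integrable_def fmeasurable_def)
    show "set_integrable lebesgue (cell \<delta> ?l) (\<lambda>y. ?k * wt y)"
      unfolding set_integrable_def by (intro integrable_mult_indicator[OF s]) simp
    fix y assume "y \<in> cell \<delta> ?l"
    then have "y - ?l \<in> cube (\<delta> / 2)" by (rule cell_subset_cube[OF d])
    from cube_add[OF z cube_minus[OF this]] have "(?l + z) - y \<in> cube \<delta>"
      by (simp add: algebra_simps)
    then show "wt (?l + z) \<le> ?k * wt y" by (rule wt_le_shift[OF _ d])
  qed
  also have "\<dots> = ?k * (LINT y:cell \<delta> ?l|lebesgue. wt y)" by simp
  finally show ?thesis using d unfolding cell_wt_def by (simp add: field_simps)
qed

text \<open>Row and column integrals are the two factors of the rank-one terms into which
  \<open>K_disc\<close> decomposes.\<close>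

definition row_int :: "real \<Rightarrow> real ^ 'n \<Rightarrow> real ^ 'n \<Rightarrow> real" where
  "row_int \<delta> x l = (LINT z:cube (\<delta> / 2)|lebesgue. K x (l + z))"

definition col_int :: "real \<Rightarrow> real ^ 'n \<Rightarrow> real ^ 'n \<Rightarrow> real" where
  "col_int \<delta> l y = (LINT z:cube (\<delta> / 2)|lebesgue. K (l + z) y)"

lemma Kshift_right: "(\<lambda>z. K x (l + z)) \<in> borel_measurable lebesgue"
  by (rule measurable_compose[OF measurable_lebesgue_plus K_meas_right])

lemma Kshift_left: "(\<lambda>z. K (l + z) y) \<in> borel_measurable lebesgue"
  by (rule measurable_compose[OF measurable_lebesgue_plus K_meas_left])

lemma K_cell_le: "\<delta> > 0 \<Longrightarrow> z \<in> cube (\<delta> / 2) \<Longrightarrow> \<bar>K x (lat_enum \<delta> n + z)\<bar> \<le> C * cell_wt \<delta> n"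
  using abs_K_le_right[of x "lat_enum \<delta> n + z"] mult_left_mono[OF wt_le_cell_wt C_nonneg, of \<delta> z n] by linarith

lemma row_int_le: "\<delta> > 0 \<Longrightarrow> \<bar>row_int \<delta> x (lat_enum \<delta> n)\<bar> \<le> \<delta> ^ CARD('n) * (C * cell_wt \<delta> n)"
  unfolding row_int_def by (intro set_integral_cube_bound Kshift_right K_cell_le) auto

lemma K_le_C: "\<bar>K x y\<bar> \<le> C"
  using abs_K_le_right[of x y] mult_left_mono[OF wt_le1 C_nonneg, of y] by linarith

text \<open>\<open>cell_wt\<close> dominates the lattice sum uniformly on the cube, so it may be
  integrated term by term in each of the two cube variables.\<close>

lemma K_disc_eq:
  assumes d: "\<delta> > 0"
  shows "K_disc \<delta> K x y = (\<Sum>n. row_int \<delta> x (lat_enum \<delta> n) * col_int \<delta> (lat_enum \<delta> n) y) / \<delta> ^ CARD('n)"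
proof -
  let ?e = "lat_enum \<delta> :: nat \<Rightarrow> real ^ 'n" and ?c = "cube (\<delta> / 2) :: (real ^ 'n) set"
  \<comment> \<open>Absolute summability identifies the unordered sum with the series: the first
    factor is at most \<open>C * cell_wt \<delta> n\<close> and the second at most
    \<open>C\<close>.\<close>
  have 1: "(\<Sum>\<^sub>\<infinity>l\<in>lattice \<delta>. K x (l + z1) * K (l + z2) y) = (\<Sum>n. K x (?e n + z1) * K (?e n + z2) y)"
    if z1: "z1 \<in> ?c" for z1 z2
  proof -
    have "(\<Sum>\<^sub>\<infinity>l\<in>lattice \<delta>. K x (l + z1) * K (l + z2) y) = (\<Sum>\<^sub>\<infinity>n. K x (?e n + z1) * K (?e n + z2) y)"
      by (rule infsum_reindex_bij_betw[OF bij_lat_enum[OF d], symmetric])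
    also have "\<dots> = (\<Sum>n. K x (?e n + z1) * K (?e n + z2) y)"
    proof -
      have "summable (\<lambda>n. norm (K x (?e n + z1) * K (?e n + z2) y))"
      proof (rule summable_comparison_test'[OF summable_mult2[OF summable_mult[OF summable_cell_wt[OF d], of C], of C], of 0])
        fix n
        show "norm (norm (K x (?e n + z1) * K (?e n + z2) y)) \<le> C * cell_wt \<delta> n * C"
          using mult_mono[OF K_cell_le[OF d z1, of x n] K_le_C[of "?e n + z2" y]] order_trans[OF abs_ge_zero K_cell_le[OF d z1, of x n]]
          by (simp add: abs_mult)
      qed
      then have "(\<lambda>n. K x (?e n + z1) * K (?e n + z2) y) summable_on UNIV"
        by (rule norm_summable_imp_summable_on)
      from sums_unique[OF has_sum_imp_sums[OF has_sum_infsum[OF this]]] show ?thesis .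
    qed
    finally show ?thesis .
  qed
  have w0: "0 \<le> C * cell_wt \<delta> n" for n
  proof -
    have "(0 :: real ^ 'n) \<in> ?c" using d by (simp add: cube_def)
    from K_cell_le[OF d this, of 0 n] show ?thesis by linarith
  qed
  have 2: "(LINT z1:?c|lebesgue. (\<Sum>\<^sub>\<infinity>l\<in>lattice \<delta>. K x (l + z1) * K (l + z2) y))
      = (\<Sum>n. row_int \<delta> x (?e n) * K (?e n + z2) y)" for z2
  proof -
    have "(LINT z1:?c|lebesgue. (\<Sum>\<^sub>\<infinity>l\<in>lattice \<delta>. K x (l + z1) * K (l + z2) y))
      = (LINT z1:?c|lebesgue. (\<Sum>n. K x (?e n + z1) * K (?e n + z2) y))"
      using sets_cube[of "\<delta> / 2"] 1 by (intro set_lebesgue_integral_cong) auto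
    also have "\<dots> = (\<Sum>n. LINT z1:?c|lebesgue. K x (?e n + z1) * K (?e n + z2) y)"
    proof (rule set_integral_suminf_cube)
      show "(\<lambda>z1. K x (?e n + z1) * K (?e n + z2) y) \<in> borel_measurable lebesgue" for n
        by (intro borel_measurable_times borel_measurable_const Kshift_right)
      show "\<bar>K x (?e n + z1) * K (?e n + z2) y\<bar> \<le> C * cell_wt \<delta> n * C" if "z1 \<in> ?c" for n z1
        unfolding abs_mult using that w0 by (intro mult_mono K_cell_le[OF d] K_le_C) auto
      show "summable (\<lambda>n. C * cell_wt \<delta> n * C)"
        by (intro summable_mult summable_mult2 summable_cell_wt d)
    qed (use d in simp)
    finally show ?thesis by (simp add: row_int_def)
  qed
  have 3: "(LINT z2:?c|lebesgue. (\<Sum>n. row_int \<delta> x (?e n) * K (?e n + z2) y))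
      = (\<Sum>n. row_int \<delta> x (?e n) * col_int \<delta> (?e n) y)"
  proof -
    have "(LINT z2:?c|lebesgue. (\<Sum>n. row_int \<delta> x (?e n) * K (?e n + z2) y))
       = (\<Sum>n. LINT z2:?c|lebesgue. row_int \<delta> x (?e n) * K (?e n + z2) y)"
    proof (rule set_integral_suminf_cube)
      show "(\<lambda>z2. row_int \<delta> x (?e n) * K (?e n + z2) y) \<in> borel_measurable lebesgue" for n
        by (intro borel_measurable_times borel_measurable_const Kshift_left)
      show "\<bar>row_int \<delta> x (?e n) * K (?e n + z2) y\<bar> \<le> \<delta> ^ CARD('n) * (C * cell_wt \<delta> n) * C" if "z2 \<in> ?c" for n z2
        unfolding abs_mult using w0 d by (intro mult_mono row_int_le K_le_C) auto
      show "summable (\<lambda>n. \<delta> ^ CARD('n) * (C * cell_wt \<delta> n) * C)"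
        by (intro summable_mult summable_mult2 summable_cell_wt d)
    qed (use d in simp)
    then show ?thesis by (simp add: col_int_def)
  qed
  show ?thesis
    unfolding K_disc_def 2 3 using d by (simp add: powr_minus powr_realpow field_simps)
qed

text \<open>The factor by which \<mu> can change under a shift in \<open>cube \<delta>\<close>. The
  supremum is finite since \<omega> is continuous and the cube compact.\<close>

definition kap :: "real \<Rightarrow> real" where "kap \<delta> = (SUP v\<in>cube \<delta>. \<omega> v)"

lemma \<omega>_le_kap: "v \<in> cube \<delta> \<Longrightarrow> \<omega> v \<le> kap \<delta>"
proof -
  have "compact (\<omega> ` cube \<delta>)"
    by (intro compact_continuous_image compact_cube continuous_on_subset[OF cont_\<omega>]) auto
  then have "bdd_above (\<omega> ` cube \<delta>)" by (intro bounded_imp_bdd_above compact_imp_bounded)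
  then show "v \<in> cube \<delta> \<Longrightarrow> \<omega> v \<le> kap \<delta>" unfolding kap_def by (rule cSUP_upper[rotated])
qed

lemma \<mu>_le_kap: "y - x \<in> cube \<delta> \<Longrightarrow> \<mu> x \<le> kap \<delta> * \<mu> y"
  using \<mu>_mod[of x y] mult_right_mono[OF \<omega>_le_kap[of "y - x" \<delta>], of "\<mu> y"] \<mu>_pos[of y] by linarith

lemma kap_nonneg: "\<delta> > 0 \<Longrightarrow> 0 \<le> kap \<delta>"
  using \<omega>_le_kap[of 0 \<delta>] \<omega>_ge1[of 0] by (simp add: cube_def)

lemma avg_bdd:
  assumes d: "\<delta> > 0" and g: "bdd D g"
  shows "bdd (D * kap \<delta>) (avg \<delta> g)"
  unfolding bdd_def
proof (intro conjI allI avg_measurable d)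
  fix x
  have "\<bar>avg \<delta> g x - 0\<bar> \<le> D * kap \<delta> / \<mu> x"
  proof (rule avg_bound[OF d bdd_meas[OF g]])
    fix z :: "real ^ 'n" assume z: "z \<in> cube (\<delta> / 2)"
    let ?y = "nearest \<delta> x + z"
    have "\<mu> x * \<bar>g ?y\<bar> \<le> (kap \<delta> * \<mu> ?y) * \<bar>g ?y\<bar>"
      by (intro mult_right_mono \<mu>_le_kap nearest_cube[OF d z]) auto
    also have "\<dots> = kap \<delta> * (\<mu> ?y * \<bar>g ?y\<bar>)" by simp
    also have "\<dots> \<le> kap \<delta> * D" by (intro mult_left_mono bdd_le[OF g] kap_nonneg d)
    finally show "\<bar>g ?y - 0\<bar> \<le> D * kap \<delta> / \<mu> x" using \<mu>_pos[of x] by (simp add: field_simps)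
  qed
  then show "\<mu> x * \<bar>avg \<delta> g x\<bar> \<le> D * kap \<delta>" using \<mu>_pos[of x] by (simp add: field_simps)
qed

lemma cell_subset_image: "\<delta> > 0 \<Longrightarrow> cell \<delta> l \<subseteq> (+) l ` cube (\<delta> / 2)"
proof
  fix y assume "\<delta> > 0" "y \<in> cell \<delta> l"
  then have "y - l \<in> cube (\<delta> / 2)" by (rule cell_subset_cube)
  then show "y \<in> (+) l ` cube (\<delta> / 2)" by (intro image_eqI[of _ _ "y - l"]) auto
qed

lemma compact_shifted_cube: "compact ((+) l ` cube r)"
  by (rule compact_translation[OF compact_cube])

lemma col_int_eq: "\<delta> > 0 \<Longrightarrow> l \<in> lattice \<delta> \<Longrightarrow> col_int \<delta> l y = (LINT x:cell \<delta> l|lebesgue. K x y)"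
  unfolding col_int_def by (rule integral_cube_shift[OF _ _ K_meas_left])

lemma row_int_eq: "\<delta> > 0 \<Longrightarrow> l \<in> lattice \<delta> \<Longrightarrow> row_int \<delta> x l = (LINT y:cell \<delta> l|lebesgue. K x y)"
  unfolding row_int_def by (rule integral_cube_shift[OF _ _ K_meas_right])

text \<open>The weight travels from \<open>x\<close> to the first point of the cell, paid for by the
  decay of the first kernel, then within the cell at the cost \<open>kap \<delta>\<close>, then to
  \<open>y\<close> as in \<open>kernel_bound\<close>. The bound is summable in \<open>n\<close> and
  integrable in \<open>y\<close>, which justifies all later interchanges.\<close>

lemma K_K_bound:
  assumes d: "\<delta> > 0" and v: "bdd D v" and z1: "z1 \<in> cube (\<delta> / 2)" and z2: "z2 \<in> cube (\<delta> / 2)"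
  shows "\<bar>K x (lat_enum \<delta> n + z1) * (K (lat_enum \<delta> n + z2) y * v y)\<bar>
    \<le> C * cell_wt \<delta> n * (kap \<delta> * (D * C) / \<mu> x * wt y)"
proof -
  let ?a = "lat_enum \<delta> n + z1" and ?b = "lat_enum \<delta> n + z2"
  have "?b - ?a \<in> cube \<delta>" using cube_add[OF z2 cube_minus[OF z1]] by simp
  then have 1: "\<mu> ?a \<le> kap \<delta> * \<mu> ?b" by (rule \<mu>_le_kap)
  have "\<mu> x \<le> \<omega> (?a - x) * \<mu> ?a" by (rule \<mu>_mod)
  also have "\<dots> \<le> \<omega> (?a - x) * (kap \<delta> * \<mu> ?b)"
    using \<omega>_ge1[of "?a - x"] by (intro mult_left_mono 1) simp
  finally have 2: "1 / \<mu> ?b \<le> \<omega> (?a - x) * (kap \<delta> / \<mu> x)"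
    using \<mu>_pos[of x] \<mu>_pos[of ?b] by (simp add: field_simps)
  have nn: "0 \<le> D * C" using bdd_nonneg[OF v] C_nonneg by simp
  have "\<bar>K x ?a * (K ?b y * v y)\<bar> \<le> \<bar>K x ?a\<bar> * (D * C / \<mu> ?b * wt y)"
    unfolding abs_mult[of "K x ?a"] by (intro mult_left_mono kernel_bound'[OF v]) auto
  also have "\<dots> = \<bar>K x ?a\<bar> * (D * C * wt y) * (1 / \<mu> ?b)" by simp
  also have "\<dots> \<le> \<bar>K x ?a\<bar> * (D * C * wt y) * (\<omega> (?a - x) * (kap \<delta> / \<mu> x))"
    using nn by (intro mult_left_mono 2) auto
  also have "\<dots> = (\<bar>K x ?a\<bar> * \<omega> (?a - x)) * (kap \<delta> * (D * C) / \<mu> x * wt y)" by simp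
  also have "\<dots> \<le> (C * cell_wt \<delta> n) * (kap \<delta> * (D * C) / \<mu> x * wt y)"
    using nn kap_nonneg[OF d] \<mu>_pos[of x]
    by (intro mult_right_mono order_trans[OF decay_right] mult_left_mono wt_le_cell_wt d z1 C_nonneg) auto
  finally show ?thesis .
qed

lemma row_int_col_int_bound:
  assumes d: "\<delta> > 0" and v: "bdd D v"
  shows "\<bar>row_int \<delta> x (lat_enum \<delta> n) * (col_int \<delta> (lat_enum \<delta> n) y * v y)\<bar>
    \<le> \<delta> ^ CARD('n) * (\<delta> ^ CARD('n) * (C * cell_wt \<delta> n * (kap \<delta> * (D * C) / \<mu> x * wt y)))"
proof -
  let ?l = "lat_enum \<delta> n" and ?c = "cube (\<delta> / 2) :: (real ^ 'n) set"
  let ?Q = "C * cell_wt \<delta> n * (kap \<delta> * (D * C) / \<mu> x * wt y)"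
  have 1: "\<bar>row_int \<delta> x ?l * (K (?l + z2) y * v y)\<bar> \<le> \<delta> ^ CARD('n) * ?Q" if z2: "z2 \<in> ?c" for z2
  proof -
    have "\<bar>LINT z1:?c|lebesgue. K x (?l + z1) * (K (?l + z2) y * v y)\<bar> \<le> \<delta> ^ CARD('n) * ?Q"
      using d by (intro set_integral_cube_bound K_K_bound d v z2 borel_measurable_times borel_measurable_const Kshift_right) auto
    then show ?thesis by (simp add: row_int_def)
  qed
  have "\<bar>LINT z2:?c|lebesgue. K (?l + z2) y * (row_int \<delta> x ?l * v y)\<bar> \<le> \<delta> ^ CARD('n) * (\<delta> ^ CARD('n) * ?Q)"
    using d 1 by (intro set_integral_cube_bound borel_measurable_times borel_measurable_const Kshift_left) (auto simp: mult_ac)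
  then show ?thesis by (simp add: col_int_def mult_ac)
qed

text \<open>Integrate the rank-one series term by term; \<open>slice_fubini\<close> turns the
  pairing of a column integral with \<open>v\<close> into the cell integral of
  \<open>T v\<close>.\<close>

lemma int_op_K_disc:
  assumes d: "\<delta> > 0" and v: "bdd D v" "continuous_on UNIV v"
  shows "int_op (K_disc \<delta> K) v x
    = (\<Sum>n. row_int \<delta> x (lat_enum \<delta> n) * ((LINT z:cube (\<delta> / 2)|lebesgue. T v (lat_enum \<delta> n + z)) / \<delta> ^ CARD('n)))"
proof -
  let ?e = "lat_enum \<delta> :: nat \<Rightarrow> real ^ 'n"
  let ?f = "\<lambda>n y. row_int \<delta> x (?e n) * (col_int \<delta> (?e n) y * v y) / \<delta> ^ CARD('n)"
  \<comment> \<open>The constants of \<open>row_int_col_int_bound\<close> after one cell volume has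
    cancelled against the division.\<close>
  define M where "M = \<delta> ^ CARD('n) * (C * (kap \<delta> * (D * C) / \<mu> x))"
  have M: "0 \<le> M"
    using d C_nonneg kap_nonneg[OF d] bdd_nonneg[OF v(1)] \<mu>_pos[of x] by (simp add: M_def)
  have e: "?e n \<in> lattice \<delta>" for n by (rule lat_enum_in[OF d])
  have le: "norm (?f n y) \<le> cell_wt \<delta> n * (M * wt y)" for n y
    using row_int_col_int_bound[OF d v(1), of x n y] d by (simp add: M_def field_simps)
  have cs: "cell \<delta> (?e n) \<in> sets borel" for n using cell_sets[OF d e] .
  have col_int_meas: "col_int \<delta> (?e n) \<in> borel_measurable lebesgue" for n
  proof -
    have "col_int \<delta> (?e n) = (\<lambda>y. LINT x:cell \<delta> (?e n)|lebesgue. K x y)"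
      by (rule ext) (rule col_int_eq[OF d e])
    then show ?thesis
      using slice_measurable[OF v cs cell_subset_image[OF d] compact_shifted_cube] by (simp only:)
  qed
  have fm: "?f n \<in> borel_measurable lebesgue" for n
    by (intro borel_measurable_divide borel_measurable_times borel_measurable_const col_int_meas bdd_meas[OF v(1)])
  have iw: "integrable lebesgue (\<lambda>y. cell_wt \<delta> n * (M * wt y))" for n by simp
  have ifn: "integrable lebesgue (?f n)" for n
  proof (rule Bochner_Integration.integrable_bound[OF iw fm])
    show "AE y in lebesgue. norm (?f n y) \<le> norm (cell_wt \<delta> n * (M * wt y))"
    proof (rule AE_I2)
      fix y show "norm (?f n y) \<le> norm (cell_wt \<delta> n * (M * wt y))"
        by (rule order_trans[OF le]) simp
    qed
  qed
  have "int_op (K_disc \<delta> K) v x = (LINT y|lebesgue. (\<Sum>n. ?f n y))"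
    unfolding int_op_def
  proof (rule Bochner_Integration.integral_cong[OF refl])
    fix y
    have "summable (\<lambda>n. row_int \<delta> x (?e n) * col_int \<delta> (?e n) y)"
    proof (rule summable_comparison_test'[OF summable_mult2[OF summable_mult[OF summable_cell_wt[OF d], of "\<delta> ^ CARD('n) * C"], of "\<delta> ^ CARD('n) * C"], of 0])
      fix n
      have "\<bar>col_int \<delta> (?e n) y\<bar> \<le> \<delta> ^ CARD('n) * C"
        unfolding col_int_def using d by (intro set_integral_cube_bound Kshift_left K_le_C) auto
      then show "norm (row_int \<delta> x (?e n) * col_int \<delta> (?e n) y) \<le> \<delta> ^ CARD('n) * C * cell_wt \<delta> n * (\<delta> ^ CARD('n) * C)"
        using mult_mono[OF row_int_le[OF d, of x n]] order_trans[OF abs_ge_zero row_int_le[OF d, of x n]]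
        by (simp add: abs_mult mult.assoc)
    qed
    from suminf_mult2[OF this, of "v y / \<delta> ^ CARD('n)"]
    show "K_disc \<delta> K x y * v y = (\<Sum>n. ?f n y)"
      unfolding K_disc_eq[OF d] by (simp add: mult_ac)
  qed
  also have "\<dots> = (\<Sum>n. LINT y|lebesgue. ?f n y)"
  proof (rule integral_suminf[OF ifn])
    show "AE y in lebesgue. summable (\<lambda>n. norm (?f n y))"
    proof (rule AE_I2)
      fix y
      show "summable (\<lambda>n. norm (?f n y))"
        by (rule summable_comparison_test'[OF summable_mult2[OF summable_cell_wt[OF d], of "M * wt y"], of 0])
          (use le in auto)
    qed
    show "summable (\<lambda>n. LINT y|lebesgue. norm (?f n y))"
    proof (rule summable_comparison_test'[OF summable_mult2[OF summable_cell_wt[OF d], of "M * (LINT y|lebesgue. wt y)"], of 0])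
      fix n
      have "(LINT y|lebesgue. norm (?f n y)) \<le> (LINT y|lebesgue. cell_wt \<delta> n * (M * wt y))"
        using ifn iw le by (intro integral_mono integrable_norm)
      then show "norm (LINT y|lebesgue. norm (?f n y)) \<le> cell_wt \<delta> n * (M * (LINT y|lebesgue. wt y))" by simp
    qed
  qed
  also have "\<dots> = (\<Sum>n. row_int \<delta> x (?e n) * ((LINT z:cube (\<delta> / 2)|lebesgue. T v (?e n + z)) / \<delta> ^ CARD('n)))"
  proof (rule arg_cong[where f=suminf], rule ext)
    fix n
    have "(LINT y|lebesgue. col_int \<delta> (?e n) y * v y) = (LINT x:cell \<delta> (?e n)|lebesgue. T v x)"
      using slice_fubini[OF v cs cell_subset_image[OF d] compact_shifted_cube] col_int_eq[OF d e] by simp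
    also have "\<dots> = (LINT z:cube (\<delta> / 2)|lebesgue. T v (?e n + z))"
      by (rule integral_cube_shift[OF d e bdd_meas[OF T_bdd[OF v(1)]], symmetric])
    finally show "(LINT y|lebesgue. ?f n y) = row_int \<delta> x (?e n) * ((LINT z:cube (\<delta> / 2)|lebesgue. T v (?e n + z)) / \<delta> ^ CARD('n))"
      by simp
  qed
  finally show ?thesis .
qed

text \<open>The average is constant on each cell, so integration against \<open>K x\<close> gives
  row integrals times cell means. For \<open>g = T v\<close> this is the series of
  \<open>int_op_K_disc\<close>.\<close>

lemma T_avg:
  assumes d: "\<delta> > 0" and g: "bdd D g"
  shows "T (avg \<delta> g) x
    = (\<Sum>n. row_int \<delta> x (lat_enum \<delta> n) * ((LINT z:cube (\<delta> / 2)|lebesgue. g (lat_enum \<delta> n + z)) / \<delta> ^ CARD('n)))"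
proof -
  let ?e = "lat_enum \<delta> :: nat \<Rightarrow> real ^ 'n"
  have e: "?e n \<in> lattice \<delta>" for n by (rule lat_enum_in[OF d])
  have "T (avg \<delta> g) x = (\<Sum>n. LINT y:cell \<delta> (?e n)|lebesgue. K x y * avg \<delta> g y)"
    unfolding int_op_def by (rule integral_cells_suminf[OF d T_integrable[OF avg_bdd[OF d g]]])
  also have "\<dots> = (\<Sum>n. row_int \<delta> x (?e n) * ((LINT z:cube (\<delta> / 2)|lebesgue. g (?e n + z)) / \<delta> ^ CARD('n)))"
  proof (rule arg_cong[where f=suminf], rule ext)
    fix n
    let ?c = "(LINT z:cube (\<delta> / 2)|lebesgue. g (?e n + z)) / \<delta> ^ CARD('n)"
    have "(LINT y:cell \<delta> (?e n)|lebesgue. K x y * avg \<delta> g y) = (LINT y:cell \<delta> (?e n)|lebesgue. K x y * ?c)"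
      using cell_sets[OF d e] by (intro set_lebesgue_integral_cong) (auto simp: avg_def cell_def)
    also have "\<dots> = row_int \<delta> x (?e n) * ?c"
      unfolding row_int_eq[OF d e] by simp
    finally show "(LINT y:cell \<delta> (?e n)|lebesgue. K x y * avg \<delta> g y) = row_int \<delta> x (?e n) * ?c" .
  qed
  finally show ?thesis .
qed

text \<open>The integral operator of \<open>K_disc \<delta> K\<close>, on the range of \<open>T\<close>.\<close>

definition TPT :: "real \<Rightarrow> (real ^ 'n \<Rightarrow> real) \<Rightarrow> real ^ 'n \<Rightarrow> real" where
  "TPT \<delta> u = T (avg \<delta> (T u))"

lemma int_op_K_disc_eq: "\<delta> > 0 \<Longrightarrow> bdd D v \<Longrightarrow> continuous_on UNIV v \<Longrightarrow> int_op (K_disc \<delta> K) v = TPT \<delta> v"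
  using int_op_K_disc T_avg[OF _ T_bdd] by (simp add: TPT_def fun_eq_iff)

section \<open>Generators as images of cell indicators\<close>

lemma bdd_indicator:
  assumes "A \<in> sets borel" "bounded A"
  obtains D where "bdd D (indicator A)"
proof -
  \<comment> \<open>An upper bound for \<mu> on \<open>A\<close> is needed;
    \<open>\<mu> x \<le> \<omega> (0 - x) * \<mu> 0\<close> reduces it to the continuity of \<omega>
    on the compact closure.\<close>
  have "compact ((\<lambda>x. \<omega> (0 - x)) ` closure A)"
    using assms(2) by (intro compact_continuous_image continuous_on_compose2[OF cont_\<omega>] continuous_intros) auto
  then have "bounded ((\<lambda>x. \<omega> (0 - x)) ` closure A)" by (rule compact_imp_bounded)
  then obtain B where B: "\<And>x. x \<in> closure A \<Longrightarrow> norm (\<omega> (0 - x)) \<le> B" by (auto simp: bounded_iff)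
  have "bdd (\<bar>B\<bar> * \<mu> 0) (indicator A)"
    unfolding bdd_def
  proof (intro conjI allI)
    show "indicator A \<in> borel_measurable lebesgue" using assms(1) by (intro borel_measurable_indicator) simp
    fix x show "\<mu> x * \<bar>indicator A x\<bar> \<le> \<bar>B\<bar> * \<mu> 0"
    proof (cases "x \<in> A")
      case True
      then have "norm (\<omega> (0 - x)) \<le> B" using closure_subset by (intro B) auto
      then have "\<omega> (0 - x) * \<mu> 0 \<le> \<bar>B\<bar> * \<mu> 0"
        using \<mu>_pos[of 0] by (intro mult_right_mono) auto
      then have "\<mu> x \<le> \<bar>B\<bar> * \<mu> 0" by (rule order_trans[OF \<mu>_mod])
      then show ?thesis using True by simp
    qed (use \<mu>_pos[of 0] in auto)
  qed
  then show thesis by (rule that)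
qed

lemma bounded_cell: "\<delta> > 0 \<Longrightarrow> bounded (cell \<delta> l)"
  by (rule bounded_subset[OF compact_imp_bounded[OF compact_shifted_cube] cell_subset_image])

text \<open>The cube integral of \<open>K z1\<close> about \<open>l\<close> is \<open>T\<close> of
  the cell indicator. That function is bounded and continuous, as the identification of
  \<open>K_disc\<close> with \<open>TPT\<close> requires.\<close>

lemma gen_eq:
  assumes d: "\<delta> > 0" and l: "l \<in> lattice \<delta>"
  shows "gen p \<delta> K l x = \<delta> powr (- (real CARD('n) * recip_exp p)) * TPT \<delta> (T (indicator (cell \<delta> l))) x"
proof -
  obtain D where D: "bdd D (indicator (cell \<delta> l))"
    using bdd_indicator[OF cell_sets[OF d l] bounded_cell[OF d]] by blast
  have inner: "(LINT z2:cube (\<delta> / 2)|lebesgue. K_disc \<delta> K x z1 * K z1 (l + z2))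
      = K_disc \<delta> K x z1 * T (indicator (cell \<delta> l)) z1" for z1
  proof -
    have "(LINT z2:cube (\<delta> / 2)|lebesgue. K z1 (l + z2)) = (LINT y:cell \<delta> l|lebesgue. K z1 y)"
      by (rule integral_cube_shift[OF d l K_meas_right])
    also have "\<dots> = T (indicator (cell \<delta> l)) z1"
      by (simp add: int_op_def set_lebesgue_integral_def mult.commute)
    finally have "(LINT z2:cube (\<delta> / 2)|lebesgue. K z1 (l + z2)) = T (indicator (cell \<delta> l)) z1" .
    then show ?thesis by simp
  qed
  have "gen p \<delta> K l x = \<delta> powr (- (real CARD('n) * recip_exp p)) * int_op (K_disc \<delta> K) (T (indicator (cell \<delta> l))) x"
    unfolding gen_def inner int_op_def[of "K_disc \<delta> K"] ..
  then show ?thesis using int_op_K_disc_eq[OF d T_bdd[OF D] T_cont[OF D]] by simp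
qed

end

subsection \<open>Neumann series in the weighted sup norm\<close>

lemma continuous_AE_eq_imp_eq:
  fixes f g :: "'a::euclidean_space \<Rightarrow> real"
  assumes "continuous_on UNIV f" "continuous_on UNIV g" "AE x in lebesgue. f x = g x"
  shows "f = g"
proof (rule ccontr)
  assume "f \<noteq> g"
  then have "{x. f x \<noteq> g x} \<noteq> {}" by auto
  moreover have "open {x. f x \<noteq> g x}" by (intro open_Collect_neq assms)
  ultimately have "\<not> negligible {x. f x \<noteq> g x}" by (intro open_not_negligible)
  moreover have "negligible {x. f x \<noteq> g x}"
    using assms(3) unfolding negligible_iff_null_sets completion.AE_iff_null_sets
    by (auto intro: completion.complete2)
  ultimately show False by simp
qed

lemma finite_lattice_cube:
  assumes "\<delta> > 0"
  shows "finite (lattice \<delta> \<inter> cube r :: (real ^ 'n) set)"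
proof -
  define m where "m = \<lceil>r / \<delta>\<rceil>"
  have "lattice \<delta> \<inter> cube r \<subseteq> (\<lambda>k. (\<chi> i. \<delta> * of_int (k i)) :: real ^ 'n) ` (PiE UNIV (\<lambda>_. {- m..m}))"
  proof
    fix x :: "real ^ 'n" assume x: "x \<in> lattice \<delta> \<inter> cube r"
    then have "\<forall>i. \<exists>k::int. x $ i = \<delta> * of_int k" by (simp add: lattice_def)
    then obtain k where k: "\<And>i. x $ i = \<delta> * of_int (k i :: int)" by metis
    have "k i \<in> {- m..m}" for i
    proof -
      have "\<bar>x $ i\<bar> \<le> r" using x by (simp add: cube_def)
      then have "\<bar>\<delta> * of_int (k i)\<bar> \<le> r" by (simp only: k)
      then have "\<bar>of_int (k i) :: real\<bar> \<le> r / \<delta>" using assms by (simp add: abs_mult field_simps)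
      then have "\<bar>of_int (k i) :: real\<bar> \<le> of_int m" unfolding m_def by linarith
      then show ?thesis by (simp add: abs_le_iff)
    qed
    moreover have "x = (\<chi> i. \<delta> * of_int (k i))" using k by (simp add: vec_eq_iff)
    ultimately show "x \<in> (\<lambda>k. (\<chi> i. \<delta> * of_int (k i)) :: real ^ 'n) ` (PiE UNIV (\<lambda>_. {- m..m}))"
      by (intro image_eqI[of _ _ k]) (auto simp: PiE_def)
  qed
  then show ?thesis by (rule finite_subset) (intro finite_imageI finite_PiE, auto)
qed

section \<open>Tails and linearity\<close>

context decaying_kernel begin

text \<open>A bound for \<open>T\<close> on functions vanishing on \<open>cube n\<close>. It tends
  to 0 because \<open>wt\<close> is integrable, and it measures every truncation error.\<close>

definition tau :: "nat \<Rightarrow> real" where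
  "tau n = C * (LINT y:(- cube (real n))|lebesgue. wt y)"

lemma Compl_cube_sets: "- cube r \<in> sets lebesgue"
  using sets_cube[of r] by (metis Compl_in_sets_lebesgue sets_completionI_sets sets_lborel)

lemma T_tail: "bdd D u \<Longrightarrow> (\<And>y. y \<in> cube (real n) \<Longrightarrow> u y = 0) \<Longrightarrow> bdd (D * tau n) (T u)"
  unfolding bdd_def[of "D * tau n"]
  using T_bound_tail[of D u "- cube (real n)"] bdd_meas[OF T_bdd[of D u]] Compl_cube_sets
  by (auto simp: tau_def mult.assoc)

lemma tau_tendsto: "tau \<longlonglongrightarrow> 0"
proof -
  have "(\<lambda>n. LINT y|lebesgue. indicator (- cube (real n)) y *\<^sub>R wt y) \<longlonglongrightarrow> (LINT y|(lebesgue :: (real ^ 'n) measure). 0 :: real)"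
  proof (rule integral_dominated_convergence[where w=wt])
    show "(\<lambda>y. indicator (- cube (real n)) y *\<^sub>R wt y) \<in> borel_measurable lebesgue" for n
      using Compl_cube_sets borel_measurable_integrable[OF wt_integrable]
      by (intro borel_measurable_scaleR borel_measurable_indicator) auto
    show "AE y in lebesgue. (\<lambda>n. indicator (- cube (real n)) y *\<^sub>R wt y) \<longlonglongrightarrow> 0"
    proof (rule AE_I2)
      fix y :: "real ^ 'n"
      obtain m :: nat where m: "norm_l1 y \<le> real m" using real_arch_simple by blast
      have "\<forall>\<^sub>F n in sequentially. indicator (- cube (real n)) y *\<^sub>R wt y = 0"
      proof (rule eventually_sequentiallyI[of m])
        fix n assume "m \<le> n"
        then have "y \<in> cube (real n)"
          unfolding cube_def using m order_trans[OF abs_nth_le_norm_l1[of y]] by force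
        then show "indicator (- cube (real n)) y *\<^sub>R wt y = 0" by simp
      qed
      then show "(\<lambda>n. indicator (- cube (real n)) y *\<^sub>R wt y) \<longlonglongrightarrow> 0" by (rule tendsto_eventually)
    qed
    show "AE y in lebesgue. norm (indicator (- cube (real n)) y *\<^sub>R wt y) \<le> wt y" for n
      by (intro AE_I2) (auto split: split_indicator)
  qed auto
  from tendsto_mult_left[OF this, of C] show ?thesis
    unfolding tau_def[abs_def] set_lebesgue_integral_def by simp
qed

lemma bdd_mono: "bdd D u \<Longrightarrow> D \<le> D' \<Longrightarrow> bdd D' u" by (auto simp: bdd_def intro: order_trans)

lemma bdd_cmult: "bdd D u \<Longrightarrow> bdd (\<bar>c\<bar> * D) (\<lambda>y. c * u y)"
  using mult_left_mono[OF bdd_le, of D u "\<bar>c\<bar>"] by (auto simp: bdd_def abs_mult mult_ac)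

lemma bdd_restrict:
  assumes "bdd D u" "A \<in> sets lebesgue"
  shows "bdd D (\<lambda>y. indicator A y * u y)"
  unfolding bdd_def
proof (intro conjI allI)
  show "(\<lambda>y. indicator A y * u y) \<in> borel_measurable lebesgue"
    using assms by (intro borel_measurable_times borel_measurable_indicator bdd_meas)
  show "\<mu> x * \<bar>indicator A x * u x\<bar> \<le> D" for x
    using bdd_le[OF assms(1), of x] bdd_nonneg[OF assms(1)] by (auto split: split_indicator)
qed

lemma avg_integrable:
  assumes d: "\<delta> > 0" and g: "bdd D g"
  shows "set_integrable lebesgue (cube (\<delta> / 2)) (\<lambda>z. g (nearest \<delta> x + z))"
proof (rule set_integrable_cube)
  show "(\<lambda>z. g (nearest \<delta> x + z)) \<in> borel_measurable lebesgue"
    by (rule measurable_compose[OF measurable_lebesgue_plus bdd_meas[OF g]])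
  fix z :: "real ^ 'n" assume z: "z \<in> cube (\<delta> / 2)"
  let ?y = "nearest \<delta> x + z"
  have "\<mu> x * \<bar>g ?y\<bar> \<le> (kap \<delta> * \<mu> ?y) * \<bar>g ?y\<bar>"
    by (intro mult_right_mono \<mu>_le_kap nearest_cube[OF d z]) auto
  also have "\<dots> = kap \<delta> * (\<mu> ?y * \<bar>g ?y\<bar>)" by simp
  also have "\<dots> \<le> kap \<delta> * D" by (intro mult_left_mono bdd_le[OF g] kap_nonneg d)
  finally show "\<bar>g ?y\<bar> \<le> kap \<delta> * D / \<mu> x" using \<mu>_pos[of x] by (simp add: field_simps)
qed

lemma avg_add:
  assumes d: "\<delta> > 0" and "bdd D g" "bdd D' h"
  shows "avg \<delta> (\<lambda>y. g y + h y) x = avg \<delta> g x + avg \<delta> h x"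
  unfolding avg_def using set_integral_add(2)[OF avg_integrable avg_integrable, OF d assms(2) d assms(3)]
  by (simp add: add_divide_distrib)

lemma avg_cmult: "avg \<delta> (\<lambda>y. c * g y) x = c * avg \<delta> g x"
  unfolding avg_def by simp

lemma T_cmult: "T (\<lambda>y. c * u y) x = c * T u x"
  unfolding int_op_def by (simp add: mult.left_commute[of _ c])

lemma TPT_bdd: "\<delta> > 0 \<Longrightarrow> bdd D u \<Longrightarrow> bdd (D * (CT * kap \<delta> * CT)) (TPT \<delta> u)"
  unfolding TPT_def using T_bdd[OF avg_bdd[OF _ T_bdd]] by (simp add: mult.assoc)

lemma TPT_add:
  assumes d: "\<delta> > 0" and u: "bdd D u" and v: "bdd D' v"
  shows "TPT \<delta> (\<lambda>y. u y + v y) = (\<lambda>x. TPT \<delta> u x + TPT \<delta> v x)"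
  unfolding TPT_def T_add[OF u v] avg_add[OF d T_bdd[OF u] T_bdd[OF v]]
  by (rule ext) (rule T_add[OF avg_bdd[OF d T_bdd[OF u]] avg_bdd[OF d T_bdd[OF v]]])

lemma TPT_cmult: "TPT \<delta> (\<lambda>y. c * u y) = (\<lambda>x. c * TPT \<delta> u x)"
  unfolding TPT_def T_cmult avg_cmult ..

lemma TPT_diff:
  assumes d: "\<delta> > 0" and u: "bdd D u" and v: "bdd D' v"
  shows "TPT \<delta> (\<lambda>y. u y - v y) = (\<lambda>x. TPT \<delta> u x - TPT \<delta> v x)"
  using TPT_add[OF d u bdd_cmult[OF v, of "- 1"]] unfolding TPT_cmult by simp

lemma bdd_sum:
  "finite A \<Longrightarrow> (\<And>l. l \<in> A \<Longrightarrow> bdd (D l) (u l)) \<Longrightarrow> bdd (\<Sum>l\<in>A. D l) (\<lambda>y. \<Sum>l\<in>A. u l y)"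
proof (induction rule: finite_induct)
  case empty then show ?case by (simp add: bdd_def)
next
  case (insert a A)
  then show ?case using bdd_add[of "D a" "u a"] by simp
qed

lemma TPT_T_sum:
  assumes d: "\<delta> > 0" and "finite A" "\<And>l. l \<in> A \<Longrightarrow> bdd (D l) (u l)"
  shows "TPT \<delta> (T (\<lambda>y. \<Sum>l\<in>A. c l * u l y)) = (\<lambda>x. \<Sum>l\<in>A. c l * TPT \<delta> (T (u l)) x)"
  using assms(2,3)
proof (induction rule: finite_induct)
  case empty
  have "T (\<lambda>y. 0) = (\<lambda>x. 0)" using T_cmult[of 0 "\<lambda>_. 0"] by (simp add: fun_eq_iff)
  then show ?case using TPT_cmult[of \<delta> 0 "\<lambda>_. 0"] by simp
next
  case (insert a A)
  have b: "bdd (\<bar>c a\<bar> * D a) (\<lambda>y. c a * u a y)" using insert.prems by (intro bdd_cmult) auto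
  have b': "bdd (\<Sum>l\<in>A. \<bar>c l\<bar> * D l) (\<lambda>y. \<Sum>l\<in>A. c l * u l y)"
    using insert by (intro bdd_sum bdd_cmult) auto
  have "T (\<lambda>y. \<Sum>l\<in>insert a A. c l * u l y) = (\<lambda>x. T (\<lambda>y. c a * u a y) x + T (\<lambda>y. \<Sum>l\<in>A. c l * u l y) x)"
    by (rule ext) (simp add: insert.hyps T_add[OF b b'])
  then show ?case
    using insert TPT_add[OF d T_bdd[OF b] T_bdd[OF b']] by (simp add: T_cmult[abs_def] TPT_cmult)
qed

end

text \<open>\<open>Ga\<close> and \<open>Gb\<close> are Borel majorants, in the difference variable,
  of the kernel and of its oscillation. The constants may be infinite, as \<open>a * b < 1\<close>
  admits the product of 0 and infinity. Idempotence is required on bounded functions vanishing off a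
  cube, because these lie in every weighted L^p space.\<close>

locale contracting_kernel = decaying_kernel \<omega> \<mu> K C \<alpha> E
  for \<omega> \<mu> :: "real ^ 'n \<Rightarrow> real" and K :: "real ^ 'n \<Rightarrow> real ^ 'n \<Rightarrow> real"
    and C \<alpha> :: real and E :: "(real ^ 'n) set" +
  fixes \<delta> :: real and a b :: ennreal and Ga Gb :: "real ^ 'n \<Rightarrow> ennreal"
  assumes \<delta>_pos: "\<delta> > 0"
    and Ga_meas: "Ga \<in> borel_measurable borel" and Gb_meas: "Gb \<in> borel_measurable borel"
    and Ga_int: "(\<integral>\<^sup>+v. Ga v * ennreal (\<omega> v) \<partial>lebesgue) \<le> a"
    and Gb_int: "(\<integral>\<^sup>+v. Gb v * ennreal (\<omega> v) \<partial>lebesgue) \<le> b"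
    and ab: "a * b < 1"
    and K_Ga: "y - x \<notin> E \<Longrightarrow> ennreal \<bar>K x y\<bar> \<le> Ga (y - x)"
    and K_Gb: "y - x \<notin> E \<Longrightarrow> x' - x \<in> cube \<delta> \<Longrightarrow> ennreal \<bar>K x y - K x' y\<bar> \<le> Gb (y - x)"
    and idem: "bdd D u \<Longrightarrow> (\<And>x. x \<notin> cube r \<Longrightarrow> u x = 0) \<Longrightarrow> AE x in lebesgue. T (T u) x = T u x"
begin

text \<open>Truncate \<open>u\<close> to \<open>cube n\<close>: the inner part obeys
  \<open>idem\<close>, and the outer part costs at most \<open>D * tau n * (CT + 1)\<close>, which
  tends to 0. Both sides are continuous, so equality almost everywhere suffices.\<close>

lemma T_idem:
  assumes u: "bdd D u"
  shows "T (T u) = T u"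
proof (rule continuous_AE_eq_imp_eq)
  let ?u = "\<lambda>n y. indicator (cube (real n)) y * u y" and ?v = "\<lambda>n y. indicator (- cube (real n)) y * u y"
  have bu: "bdd D (?u n)" for n using bdd_restrict[OF u, of "cube (real n)"] sets_cube[of "real n"] by simp
  have bv: "bdd D (?v n)" for n by (rule bdd_restrict[OF u Compl_cube_sets])
  have tv: "bdd (D * tau n) (T (?v n))" for n by (rule T_tail[OF bv]) auto
  have Tu: "T u = (\<lambda>x. T (?u n) x + T (?v n) x)" for n
  proof
    fix x
    have "u = (\<lambda>y. ?u n y + ?v n y)" by (auto simp: fun_eq_iff split: split_indicator)
    then have "T u x = T (\<lambda>y. ?u n y + ?v n y) x" by (rule arg_cong)
    also have "\<dots> = T (?u n) x + T (?v n) x" by (rule T_add[OF bu bv])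
    finally show "T u x = T (?u n) x + T (?v n) x" .
  qed
  have TTu: "T (T u) x = T (T (?u n)) x + T (T (?v n)) x" for n x
    unfolding Tu[of n] by (rule T_add[OF T_bdd[OF bu] T_bdd[OF bv]])
  have "AE x in lebesgue. \<forall>n. T (T (?u n)) x = T (?u n) x"
    unfolding AE_all_countable
  proof
    fix n
    show "AE x in lebesgue. T (T (?u n)) x = T (?u n) x"
      by (rule idem[OF bu, of "real n"]) simp
  qed
  then show "AE x in lebesgue. T (T u) x = T u x"
  proof eventually_elim
    case (elim x)
    have le: "\<mu> x * \<bar>T (T u) x - T u x\<bar> \<le> D * tau n * (CT + 1)" for n
    proof -
      have "T (T u) x - T u x = T (T (?v n)) x - T (?v n) x"
        using TTu[of x n] fun_cong[OF Tu[of n], of x] elim by simp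
      then have "\<mu> x * \<bar>T (T u) x - T u x\<bar> \<le> D * tau n * CT + D * tau n"
        using bdd_le[OF bdd_diff[OF T_bdd[OF tv[of n]] tv[of n]], of x] by simp
      then show ?thesis by (simp add: algebra_simps)
    qed
    have "(\<lambda>n. D * tau n * (CT + 1)) \<longlonglongrightarrow> D * 0 * (CT + 1)"
      by (intro tendsto_intros tau_tendsto)
    then have "\<mu> x * \<bar>T (T u) x - T u x\<bar> \<le> D * 0 * (CT + 1)"
      by (rule LIMSEQ_le_const) (use le in blast)
    then show ?case using \<mu>_pos[of x] by (simp add: mult_le_0_iff)
  qed
qed (use T_cont[OF T_bdd[OF u]] T_cont[OF u] in auto)

lemma T_osc:
  assumes f: "bdd D f" and x': "x' - x \<in> cube \<delta>"
  shows "ennreal (\<mu> x * \<bar>T f x - T f x'\<bar>) \<le> b * ennreal D"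
proof -
  have "T f x - T f x' = (LINT y|lebesgue. (K x y - K x' y) * f y)"
    unfolding int_op_def using T_integrable[OF f, of x] T_integrable[OF f, of x']
    by (simp add: left_diff_distrib)
  moreover have "ennreal (\<mu> x * \<bar>LINT y|lebesgue. (K x y - K x' y) * f y\<bar>) \<le> b * ennreal D"
  proof (rule schur[OF Gb_meas Gb_int])
    show "AE y in lebesgue. ennreal \<bar>K x y - K x' y\<bar> \<le> Gb (y - x)"
      using AE_E_right[of x] by eventually_elim (rule K_Gb[OF _ x'])
    show "ennreal (\<mu> y * \<bar>f y\<bar>) \<le> ennreal D" for y by (intro ennreal_leI bdd_le[OF f])
  qed
  ultimately show ?thesis by simp
qed

text \<open>Every point entering the average lies within \<open>cube \<delta>\<close> of
  \<open>x\<close>, so \<open>T_osc\<close> bounds each difference and hence their mean.\<close>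

lemma avg_osc:
  assumes f: "bdd D f"
  shows "ennreal (\<mu> x * \<bar>T f x - avg \<delta> (T f) x\<bar>) \<le> b * ennreal D"
\<comment> \<open>If \<open>b\<close> is infinite the bound can be \<open>top\<close> and says
  nothing; otherwise it is a real number and \<open>avg_bound\<close> applies.\<close>
proof (cases "b * ennreal D = top")
  case False
  define B where "B = enn2real (b * ennreal D)"
  have B: "b * ennreal D = ennreal B" using False by (simp add: B_def less_top)
  have "\<bar>avg \<delta> (T f) x - T f x\<bar> \<le> B / \<mu> x"
  proof (rule avg_bound[OF \<delta>_pos bdd_meas[OF T_bdd[OF f]]])
    fix z :: "real ^ 'n" assume "z \<in> cube (\<delta> / 2)"
    from T_osc[OF f nearest_cube[OF \<delta>_pos this], of x]
    have "\<mu> x * \<bar>T f x - T f (nearest \<delta> x + z)\<bar> \<le> B"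
      unfolding B by (subst (asm) ennreal_le_iff) (simp_all add: B_def)
    then show "\<bar>T f (nearest \<delta> x + z) - T f x\<bar> \<le> B / \<mu> x"
      using \<mu>_pos[of x] by (simp add: field_simps abs_minus_commute)
  qed
  then have "\<mu> x * \<bar>T f x - avg \<delta> (T f) x\<bar> \<le> B"
    using \<mu>_pos[of x] by (simp add: field_simps abs_minus_commute)
  then show ?thesis unfolding B by (rule ennreal_leI)
qed simp

definition rate :: real where "rate = enn2real (a * b)"

lemma rate_bounds: "0 \<le> rate" "rate < 1" "a * b = ennreal rate"
proof -
  have "a * b < top" using ab by (rule order_less_trans) simp
  then show e: "a * b = ennreal rate" by (simp add: rate_def)
  show "0 \<le> rate" by (simp add: rate_def)
  then show "rate < 1" using ab unfolding e by (simp add: ennreal_less_iff flip: ennreal_1)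
qed

text \<open>By \<open>T_idem\<close> the bounded fixed points are the range of \<open>T\<close> on
  bounded functions, the space on which \<open>TPT\<close> is close to the identity.\<close>

definition bdd_fixed :: "real \<Rightarrow> (real ^ 'n \<Rightarrow> real) \<Rightarrow> bool" where
  "bdd_fixed D f \<longleftrightarrow> bdd D f \<and> T f = f"

text \<open>\<open>avg_osc\<close> gives the factor \<open>b\<close> for the inner function and
  \<open>schur\<close> with \<open>Ga\<close> the factor \<open>a\<close> for the outer
  \<open>T\<close>. The residual is a value of \<open>T\<close>, hence again a fixed point, which
  permits iteration.\<close>

lemma residual:
  assumes f: "bdd_fixed D f"
  shows "bdd_fixed (rate * D) (\<lambda>x. f x - TPT \<delta> f x)"
proof -
  have fb: "bdd D f" and Tf: "T f = f" using f by (auto simp: bdd_fixed_def)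
  define u where "u = (\<lambda>x. T f x - avg \<delta> (T f) x)"
  \<comment> \<open>A crude bound, used only for measurability and for \<open>T_idem\<close>; the
    sharp estimate comes from \<open>schur\<close>.\<close>
  have ub: "bdd (D * CT + D * CT * kap \<delta>) u"
    unfolding u_def by (intro bdd_diff T_bdd avg_bdd \<delta>_pos fb)
  have Tu: "T u = (\<lambda>x. f x - TPT \<delta> f x)"
    unfolding u_def TPT_def
  proof
    fix x
    have "T (\<lambda>x. T f x - avg \<delta> (T f) x) x = T (T f) x - T (avg \<delta> (T f)) x"
      by (rule T_diff[OF T_bdd[OF fb] avg_bdd[OF \<delta>_pos T_bdd[OF fb]]])
    also have "\<dots> = f x - T (avg \<delta> (T f)) x" by (simp only: Tf)
    finally show "T (\<lambda>x. T f x - avg \<delta> (T f) x) x = f x - T (avg \<delta> (T f)) x" .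
  qed
  have "\<mu> x * \<bar>T u x\<bar> \<le> rate * D" for x
  proof -
    have "ennreal (\<mu> x * \<bar>LINT y|lebesgue. K x y * u y\<bar>) \<le> a * (b * ennreal D)"
    proof (rule schur[OF Ga_meas Ga_int])
      show "AE y in lebesgue. ennreal \<bar>K x y\<bar> \<le> Ga (y - x)"
        using AE_E_right[of x] by eventually_elim (rule K_Ga)
      show "ennreal (\<mu> y * \<bar>u y\<bar>) \<le> b * ennreal D" for y
        unfolding u_def by (rule avg_osc[OF fb])
    qed
    also have "\<dots> = ennreal (rate * D)"
      using rate_bounds bdd_nonneg[OF fb] by (simp add: mult.assoc[symmetric] ennreal_mult)
    finally show ?thesis
      using rate_bounds bdd_nonneg[OF fb] by (simp add: int_op_def ennreal_le_iff)
  qed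
  moreover have "T u \<in> borel_measurable lebesgue" by (rule bdd_meas[OF T_bdd[OF ub]])
  ultimately have "bdd (rate * D) (T u)" by (simp add: bdd_def)
  moreover have "T (T u) = T u" by (rule T_idem[OF ub])
  ultimately show ?thesis unfolding bdd_fixed_def Tu[symmetric] by simp
qed

text \<open>\<open>h\<close> is the m-th partial sum of the Neumann series for the inverse of
  \<open>TPT\<close>, applied to \<open>f\<close>. Each step adds the current residual to
  \<open>h\<close>, whence the geometric sum in its bound.\<close>

lemma neumann:
  assumes f: "bdd_fixed D f"
  shows "\<exists>h. bdd_fixed (D * (\<Sum>i<m. rate ^ i)) h \<and> bdd_fixed (rate ^ m * D) (\<lambda>x. f x - TPT \<delta> h x)"
proof (induction m)
  case 0
  have "T (\<lambda>y. 0) = (\<lambda>x. 0)" using T_cmult[of 0 "\<lambda>_. 0"] by (simp add: fun_eq_iff)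
  moreover have "TPT \<delta> (\<lambda>_. 0) = (\<lambda>_. 0)" using TPT_cmult[of \<delta> 0 "\<lambda>_. 0"] by simp
  ultimately show ?case using f by (intro exI[of _ "\<lambda>_. 0"]) (simp add: bdd_fixed_def bdd_def)
next
  case (Suc m)
  then obtain h where h: "bdd_fixed (D * (\<Sum>i<m. rate ^ i)) h" and g: "bdd_fixed (rate ^ m * D) (\<lambda>x. f x - TPT \<delta> h x)" by blast
  let ?g = "\<lambda>x. f x - TPT \<delta> h x"
  have hb: "bdd (D * (\<Sum>i<m. rate ^ i)) h" "T h = h" and gb: "bdd (rate ^ m * D) ?g" "T ?g = ?g"
    using h g by (auto simp: bdd_fixed_def)
  have "bdd (D * (\<Sum>i<Suc m. rate ^ i)) (\<lambda>x. h x + ?g x)"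
    using bdd_add[OF hb(1) gb(1)] by (simp add: algebra_simps)
  moreover have "T (\<lambda>x. h x + ?g x) = (\<lambda>x. h x + ?g x)"
    by (rule ext) (simp only: T_add[OF hb(1) gb(1)] hb(2) gb(2))
  ultimately have 1: "bdd_fixed (D * (\<Sum>i<Suc m. rate ^ i)) (\<lambda>x. h x + ?g x)"
    unfolding bdd_fixed_def by blast
  have eq: "(\<lambda>x. f x - TPT \<delta> (\<lambda>x. h x + ?g x) x) = (\<lambda>x. ?g x - TPT \<delta> ?g x)"
    unfolding TPT_add[OF \<delta>_pos hb(1) gb(1)] by (rule ext) simp
  have "bdd_fixed (rate ^ Suc m * D) (\<lambda>x. f x - TPT \<delta> (\<lambda>x. h x + ?g x) x)"
    unfolding eq using residual[OF g] by (simp only: power_Suc mult.assoc)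
  with 1 show ?case by blast
qed

text \<open>The number of Neumann steps is chosen from \<open>D\<close> and \<epsilon> before
  \<open>f\<close> is given, so \<open>D'\<close> serves all \<open>f\<close> at once.\<close>

lemma TPT_approx:
  assumes "\<epsilon> > 0"
  obtains D' where "\<And>f. bdd_fixed D f \<Longrightarrow> \<exists>h. bdd_fixed D' h \<and> bdd \<epsilon> (\<lambda>x. f x - TPT \<delta> h x)"
proof -
  have "(\<lambda>m. rate ^ m * D) \<longlonglongrightarrow> 0 * D"
    using rate_bounds by (intro tendsto_mult LIMSEQ_power_zero tendsto_const) auto
  then have "\<forall>\<^sub>F m in sequentially. rate ^ m * D < \<epsilon>" using assms by (intro order_tendstoD(2)) auto
  then obtain m where m: "rate ^ m * D < \<epsilon>" by (auto simp: eventually_sequentially)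
  show thesis
  proof (rule that)
    fix f assume "bdd_fixed D f"
    then obtain h where "bdd_fixed (D * (\<Sum>i<m. rate ^ i)) h" "bdd_fixed (rate ^ m * D) (\<lambda>x. f x - TPT \<delta> h x)"
      using neumann by blast
    moreover from this(2) have "bdd \<epsilon> (\<lambda>x. f x - TPT \<delta> h x)"
      unfolding bdd_fixed_def using m by (blast intro: bdd_mono less_imp_le)
    ultimately show "\<exists>h. bdd_fixed (D * (\<Sum>i<m. rate ^ i)) h \<and> bdd \<epsilon> (\<lambda>x. f x - TPT \<delta> h x)"
      by blast
  qed
qed

text \<open>
  \<open>f\<close> is close to \<open>TPT h1\<close> and \<open>h1\<close> to \<open>TPT h2\<close>, so \<open>f\<close> is close to \<open>TPT (TPT h2) = TPT (T w)\<close> with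
  the step function \<open>w = avg (T h2)\<close>, and \<open>TPT (T (indicator (cell l)))\<close> is a multiple of \<open>gen l\<close>.
\<close>

lemma finite_combination_approx:
  assumes eps: "\<epsilon> > 0"
  shows "\<exists>N::nat. N > 0 \<and> (\<forall>f. bdd_fixed D f \<longrightarrow> (\<exists>c. bdd \<epsilon> (\<lambda>x. f x - (\<Sum>l\<in>lattice \<delta> \<inter> cube (real N). c l * gen p \<delta> K l x))))"
proof -
  define s where "s = CT * kap \<delta> * CT"
  have s: "0 \<le> s" using CT_nonneg kap_nonneg[OF \<delta>_pos] by (simp add: s_def)
  note TPT_bdd' = TPT_bdd[OF \<delta>_pos, folded s_def]
  have eps3: "\<epsilon> / 3 > 0" using eps by simp
  obtain D1 where D1: "\<And>f. bdd_fixed D f \<Longrightarrow> \<exists>h. bdd_fixed D1 h \<and> bdd (\<epsilon> / 3) (\<lambda>x. f x - TPT \<delta> h x)"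
    using TPT_approx[OF eps3] by blast
  \<comment> \<open>The outer \<open>TPT\<close> amplifies the second error by at most
    \<open>s\<close>; dividing by \<open>s + 1\<close> also covers \<open>s = 0\<close>.\<close>
  have "\<epsilon> / 3 / (s + 1) > 0" using eps s by simp
  then obtain D2 where D2: "\<And>f. bdd_fixed D1 f \<Longrightarrow> \<exists>h. bdd_fixed D2 h \<and> bdd (\<epsilon> / 3 / (s + 1)) (\<lambda>x. f x - TPT \<delta> h x)"
    using TPT_approx[of "\<epsilon> / 3 / (s + 1)"] by blast
  define D3 where "D3 = D2 * CT * kap \<delta>"
  have "(\<lambda>n. D3 * tau n * s) \<longlonglongrightarrow> D3 * 0 * s" by (intro tendsto_intros tau_tendsto)
  then have "\<forall>\<^sub>F n in sequentially. D3 * tau n * s < \<epsilon> / 3" using eps by (intro order_tendstoD(2)) auto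
  then obtain n where n: "D3 * tau n * s < \<epsilon> / 3" by (auto simp: eventually_sequentially)
  \<comment> \<open>Rounding moves a point by at most half a mesh, so the lattice points of all
    cells meeting \<open>cube n\<close> lie in \<open>cube N\<close>.\<close>
  obtain N :: nat where N: "real n + \<delta> / 2 \<le> real N" using real_arch_simple by blast
  then have N0: "N > 0" using \<delta>_pos by (cases N) auto
  let ?L = "lattice \<delta> \<inter> cube (real N) :: (real ^ 'n) set"
  have fin: "finite ?L" by (rule finite_lattice_cube[OF \<delta>_pos])
  define A where "A = (\<Union>l\<in>?L. cell \<delta> l)"
  have A: "A \<in> sets lebesgue"
    unfolding A_def using fin cell_sets[OF \<delta>_pos]
    by (intro sets.finite_UN sets_completionI_sets) auto
  have "\<exists>c. bdd \<epsilon> (\<lambda>x. f x - (\<Sum>l\<in>?L. c l * gen p \<delta> K l x))" if f: "bdd_fixed D f" for f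
  proof -
    obtain h1 where h1: "bdd_fixed D1 h1" "bdd (\<epsilon> / 3) (\<lambda>x. f x - TPT \<delta> h1 x)" using D1[OF f] by blast
    obtain h2 where h2: "bdd_fixed D2 h2" "bdd (\<epsilon> / 3 / (s + 1)) (\<lambda>x. h1 x - TPT \<delta> h2 x)" using D2[OF h1(1)] by blast
    have h1b: "bdd D1 h1" and h2b: "bdd D2 h2" using h1 h2 by (auto simp: bdd_fixed_def)
    define w where "w = avg \<delta> (T h2)"
    have wb: "bdd D3 w" unfolding w_def D3_def by (intro avg_bdd T_bdd \<delta>_pos h2b)
    \<comment> \<open>\<open>w1\<close> is a finite combination of cell indicators;
      \<open>w2\<close> vanishes on \<open>cube n\<close>, so \<open>T_tail\<close> makes
      \<open>T w2\<close> small.\<close>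
    define w1 w2 where "w1 = (\<lambda>y. indicator A y * w y)" and "w2 = (\<lambda>y. indicator (- A) y * w y)"
    have w1b: "bdd D3 w1" unfolding w1_def by (rule bdd_restrict[OF wb A])
    have "- A \<in> sets lebesgue" using A by (rule Compl_in_sets_lebesgue[THEN iffD2])
    then have w2b: "bdd D3 w2" unfolding w2_def by (rule bdd_restrict[OF wb])
    have w: "w = (\<lambda>y. w1 y + w2 y)" by (auto simp: w1_def w2_def fun_eq_iff split: split_indicator)
    define c where "c l = (LINT z:cube (\<delta> / 2)|lebesgue. T h2 (l + z)) / \<delta> ^ CARD('n)" for l
    have w1: "w1 = (\<lambda>y. \<Sum>l\<in>?L. c l * indicator (cell \<delta> l) y)"
    proof
      fix y
      have "w1 y = (\<Sum>l\<in>?L. if l = nearest \<delta> y then c l else 0)"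
        using fin by (auto simp: w1_def A_def w_def avg_def c_def cell_def sum.delta' split: split_indicator)
      also have "\<dots> = (\<Sum>l\<in>?L. c l * indicator (cell \<delta> l) y)"
        by (intro sum.cong) (auto simp: cell_def)
      finally show "w1 y = (\<Sum>l\<in>?L. c l * indicator (cell \<delta> l) y)" .
    qed
    have "\<exists>D. bdd D (indicator (cell \<delta> l))" if "l \<in> ?L" for l
      using bdd_indicator[OF cell_sets[OF \<delta>_pos] bounded_cell[OF \<delta>_pos]] that by blast
    then obtain Dc where Dc: "\<And>l. l \<in> ?L \<Longrightarrow> bdd (Dc l) (indicator (cell \<delta> l))" by metis
    have S1: "TPT \<delta> (T w1) = (\<lambda>x. \<Sum>l\<in>?L. c l * TPT \<delta> (T (indicator (cell \<delta> l))) x)"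
      unfolding w1 by (rule TPT_T_sum[OF \<delta>_pos fin Dc])
    have S2: "bdd (D3 * tau n * s) (TPT \<delta> (T w2))"
    proof (intro TPT_bdd' T_tail w2b)
      fix y :: "real ^ 'n" assume y: "y \<in> cube (real n)"
      have "nearest \<delta> y \<in> cube (real n + \<delta> / 2)"
        using cube_add[OF y cube_minus[OF diff_nearest_in_cube[OF \<delta>_pos, of y]]] by simp
      then have "nearest \<delta> y \<in> cube (real N)" using N unfolding cube_def by (auto intro: order_trans)
      then have "y \<in> A" by (auto simp: A_def cell_def nearest_in_lattice)
      then show "w2 y = 0" by (simp add: w2_def)
    qed
    have Tw: "T w = (\<lambda>x. T w1 x + T w2 x)" unfolding w using T_add[OF w1b w2b] by blast
    have SS: "TPT \<delta> (TPT \<delta> h2) = (\<lambda>x. TPT \<delta> (T w1) x + TPT \<delta> (T w2) x)"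
    proof -
      have "TPT \<delta> h2 = T w" by (simp add: TPT_def w_def)
      then show ?thesis unfolding Tw using TPT_add[OF \<delta>_pos T_bdd[OF w1b] T_bdd[OF w2b]] by simp
    qed
    \<comment> \<open>The three errors: \<open>f\<close> against \<open>TPT h1\<close>,
      \<open>h1\<close> against \<open>TPT h2\<close> seen through the outer \<open>TPT\<close>, and
      the discarded tail. Their sum telescopes.\<close>
    have "bdd (\<epsilon> / 3 + \<epsilon> / 3 / (s + 1) * s + D3 * tau n * s)
      (\<lambda>x. (f x - TPT \<delta> h1 x) + TPT \<delta> (\<lambda>x. h1 x - TPT \<delta> h2 x) x + TPT \<delta> (T w2) x)"
      by (intro bdd_add h1 TPT_bdd' h2 S2)
    moreover have "\<epsilon> / 3 + \<epsilon> / 3 / (s + 1) * s + D3 * tau n * s \<le> \<epsilon>"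
    proof -
      have "\<epsilon> / 3 / (s + 1) * s \<le> \<epsilon> / 3" using s eps by (simp add: field_simps)
      then show ?thesis using n by linarith
    qed
    moreover have "(\<lambda>x. (f x - TPT \<delta> h1 x) + TPT \<delta> (\<lambda>x. h1 x - TPT \<delta> h2 x) x + TPT \<delta> (T w2) x)
      = (\<lambda>x. f x - TPT \<delta> (T w1) x)"
      unfolding TPT_diff[OF \<delta>_pos h1b TPT_bdd'[OF h2b]] SS by (simp add: fun_eq_iff)
    ultimately have "bdd \<epsilon> (\<lambda>x. f x - TPT \<delta> (T w1) x)" by (metis bdd_mono)
    \<comment> \<open>The power of \<delta> in the coefficients cancels the normalising factor of
      \<open>gen\<close>.\<close>
    moreover have "TPT \<delta> (T w1) x = (\<Sum>l\<in>?L. (c l * \<delta> powr (real CARD('n) * recip_exp p)) * gen p \<delta> K l x)" for x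
      unfolding S1 using \<delta>_pos
      by (intro sum.cong) (auto simp: gen_eq[OF \<delta>_pos] powr_minus field_simps)
    ultimately show ?thesis
      by (intro exI[of _ "\<lambda>l. c l * \<delta> powr (real CARD('n) * recip_exp p)"]) simp
  qed
  then show ?thesis using N0 by blast
qed

end

subsection \<open>Weights and the modulus of continuity\<close>

text \<open>Submultiplicativity at 0 gives \<open>1 \<le> \<omega> 0\<close>, and symmetry bounds
  \<open>\<omega> 0\<close> by the square of \<open>\<omega> x\<close>.\<close>

lemma submultiplicative_weight_ge1:
  assumes "submultiplicative_weight \<omega>"
  shows "1 \<le> \<omega> x"
proof -
  have pos: "0 < \<omega> x" "0 < \<omega> 0" and sym: "\<omega> (- x) = \<omega> x"
    and sub: "\<omega> (x + - x) \<le> \<omega> x * \<omega> (- x)" "\<omega> (0 + 0) \<le> \<omega> 0 * \<omega> 0"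
    using assms unfolding submultiplicative_weight_def by blast+
  have "1 \<le> \<omega> 0" using sub(2) pos(2) by simp
  also have "\<omega> 0 \<le> (\<omega> x)\<^sup>2" using sub(1) sym by (simp add: power2_eq_square)
  finally show ?thesis using pos(1) by (simp add: abs_le_square_iff[of 1 "\<omega> x", simplified, symmetric])
qed

text \<open>
  The witness is \<open>\<mu> x = sup\<^sub>s \<nu> (x + s) / \<omega> s\<close>.  As \<open>\<mu>\<close> is moderate with constant \<open>1\<close>, kernels of
  small \<open>W_norm\<close> are contractions in the \<open>\<mu>\<close>-weighted sup norm.
\<close>

lemma moderate_weight_equivalent:
  assumes \<omega>: "submultiplicative_weight \<omega>" and \<nu>: "moderate_weight \<omega> \<nu>"
  obtains \<mu> C\<^sub>0 where "C\<^sub>0 > 0" "\<And>x y. \<mu> x \<le> \<omega> (y - x) * \<mu> y"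
    "\<And>x. \<nu> x \<le> \<omega> 0 * \<mu> x" "\<And>x. \<mu> x \<le> C\<^sub>0 * \<nu> x"
proof -
  obtain C\<^sub>0 where C\<^sub>0: "C\<^sub>0 > 0" "\<And>x y. \<nu> (x + y) \<le> C\<^sub>0 * \<omega> x * \<nu> y"
    using \<nu> unfolding moderate_weight_def by blast
  have \<nu>_pos: "0 < \<nu> x" for x using \<nu> unfolding moderate_weight_def by blast
  have sub: "\<omega> (x + y) \<le> \<omega> x * \<omega> y" and sym: "\<omega> (- x) = \<omega> x" and \<omega>_pos: "0 < \<omega> x" for x y
    using \<omega> unfolding submultiplicative_weight_def by blast+
  define \<mu> where "\<mu> x = (SUP s. \<nu> (x + s) / \<omega> s)" for x
  have le: "\<nu> (x + s) / \<omega> s \<le> C\<^sub>0 * \<nu> x" for x s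
    using C\<^sub>0(2)[of s x] \<omega>_pos[of s] by (simp add: field_simps add.commute)
  then have bdd: "bdd_above (range (\<lambda>s. \<nu> (x + s) / \<omega> s))" for x by (intro bdd_aboveI2)
  show thesis
  proof (rule that[of C\<^sub>0 \<mu>])
    show "C\<^sub>0 > 0" by (rule C\<^sub>0)
    show "\<mu> x \<le> C\<^sub>0 * \<nu> x" for x unfolding \<mu>_def using le by (intro cSUP_least) auto
    show "\<nu> x \<le> \<omega> 0 * \<mu> x" for x
    proof -
      have "\<nu> (x + 0) / \<omega> 0 \<le> \<mu> x" unfolding \<mu>_def by (intro cSUP_upper bdd) auto
      then show ?thesis using \<omega>_pos[of 0] by (simp add: field_simps)
    qed
    show "\<mu> x \<le> \<omega> (y - x) * \<mu> y" for x y
      unfolding \<mu>_def[of x]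
    proof (rule cSUP_least)
      fix s
      \<comment> \<open>Since \<open>y + ?t = x + s\<close>, the term at \<open>s\<close> for
        \<open>x\<close> is compared with the term at \<open>?t\<close> for
        \<open>y\<close>.\<close>
      let ?t = "(x - y) + s"
      have "\<omega> ?t \<le> \<omega> (x - y) * \<omega> s" by (rule sub)
      also have "\<omega> (x - y) = \<omega> (y - x)" using sym[of "x - y"] by simp
      finally have "1 / \<omega> s \<le> \<omega> (y - x) / \<omega> ?t"
        using \<omega>_pos[of s] \<omega>_pos[of ?t] by (simp add: field_simps)
      from mult_left_mono[OF this, of "\<nu> (x + s)"]
      have "\<nu> (x + s) / \<omega> s \<le> \<omega> (y - x) * (\<nu> (y + ?t) / \<omega> ?t)"
        using \<nu>_pos[of "x + s"] by (simp add: mult_ac)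
      also have "\<dots> \<le> \<omega> (y - x) * \<mu> y"
        unfolding \<mu>_def using \<omega>_pos[of "y - x"] by (intro mult_left_mono cSUP_upper bdd) auto
      finally show "\<nu> (x + s) / \<omega> s \<le> \<omega> (y - x) * \<mu> y" .
    qed simp
  qed
qed

text \<open>The supremum over the diagonal of pairs with difference \<open>v\<close>, as it stands
  in the first integral of \<open>W_norm\<close>.\<close>

definition diag_sup :: "(real ^ 'n \<Rightarrow> real ^ 'n \<Rightarrow> ennreal) \<Rightarrow> real ^ 'n \<Rightarrow> ennreal" where
  "diag_sup k v = (SUP z. k z (v + z))"

lemma diag_sup_upper: "k x y \<le> diag_sup k (y - x)"
  unfolding diag_sup_def by (rule SUP_upper2[of x]) auto

lemma W_norm_lsc_env: "(\<integral>\<^sup>+v. lsc_env (diag_sup k) v * ennreal (\<omega> v) \<partial>lebesgue) \<le> W_norm \<omega> k"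
proof -
  have "(\<integral>\<^sup>+v. lsc_env (diag_sup k) v * ennreal (\<omega> v) \<partial>lebesgue) \<le> (\<integral>\<^sup>+v. diag_sup k v * ennreal (\<omega> v) \<partial>lebesgue)"
    by (intro nn_integral_mono mult_right_mono lsc_env_le) auto
  also have "\<dots> \<le> W_norm \<omega> k" unfolding W_norm_def diag_sup_def by (rule max.cobounded1)
  finally show ?thesis .
qed

lemma modulus_upper:
  assumes "x' - x \<in> cube \<delta>" "y' - y \<in> cube \<delta>"
  shows "ennreal \<bar>K x' y' - K x y\<bar> \<le> diag_sup (modulus \<delta> K) (y - x)"
proof -
  have "ennreal \<bar>K x' y' - K x y\<bar> \<le> modulus \<delta> K x y"
    unfolding modulus_def
    by (rule SUP_upper2[OF assms(1)], rule SUP_upper2[OF assms(2)]) simp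
  also have "\<dots> \<le> diag_sup (modulus \<delta> K) (y - x)" by (rule diag_sup_upper)
  finally show ?thesis .
qed

text \<open>The envelope may fall below \<open>F\<close> at a point, but not below a minorant of
  \<open>F\<close> that is continuous there. Hence pointwise bounds survive the passage to the
  envelope wherever \<open>K\<close> is continuous.\<close>

lemma le_lsc_env_isCont:
  fixes \<phi> :: "'a::metric_space \<Rightarrow> real"
  assumes c: "isCont \<phi> v" and d: "d > 0" and le: "\<And>w. dist v w < d \<Longrightarrow> ennreal (\<phi> w) \<le> F w"
  shows "ennreal (\<phi> v) \<le> lsc_env F v"
proof (rule ennreal_le_epsilon)
  fix e :: real assume e: "0 < e"
  obtain d' where d': "d' > 0" "\<And>w. dist w v < d' \<Longrightarrow> dist (\<phi> w) (\<phi> v) < e"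
    using c e unfolding continuous_at_eps_delta by blast
  have "ennreal (\<phi> v - e) \<le> lsc_env F v"
  proof (rule le_lsc_envI[of "min d d'"])
    show "min d d' > 0" using d d' by simp
    fix w assume w: "dist v w < min d d'"
    then have "\<phi> v - e \<le> \<phi> w" using d'(2)[of w] by (auto simp: dist_commute dist_real_def)
    then have "ennreal (\<phi> v - e) \<le> ennreal (\<phi> w)" by (rule ennreal_leI)
    also have "\<dots> \<le> F w" using w by (intro le) simp
    finally show "ennreal (\<phi> v - e) \<le> F w" .
  qed
  moreover have "ennreal (\<phi> v) \<le> ennreal (\<phi> v - e) + ennreal e"
    using e by (cases "\<phi> v \<ge> e") (auto simp flip: ennreal_plus intro!: ennreal_leI order_trans[OF ennreal_leI[of "\<phi> v" e]])
  ultimately show "ennreal (\<phi> v) \<le> lsc_env F v + ennreal e"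
    by (meson add_right_mono order_trans)
qed

lemma diff_in_cube: "dist (x :: real ^ 'n) y \<le> r \<Longrightarrow> x - y \<in> cube r"
  unfolding cube_def dist_norm using component_le_norm_cart[of "x - y"] by (auto intro: order_trans)

text \<open>For \<open>u\<close> near \<open>v\<close> both values of \<open>K\<close> are compared
  with \<open>K z (u + z)\<close>. All shifts stay within \<delta>, and the triangle inequality
  costs a factor 2. Smallness of the envelope thus passes back to the supremum itself.\<close>

lemma diag_sup_modulus_half:
  assumes "\<delta> > 0"
  shows "diag_sup (modulus (\<delta> / 2) K) v / 2 \<le> lsc_env (diag_sup (modulus \<delta> K)) v"
proof (rule le_lsc_envI[of "\<delta> / 2"])
  show "\<delta> / 2 > 0" using assms by simp
  fix u assume "dist v u < \<delta> / 2"
  then have vu: "v - u \<in> cube (\<delta> / 2)" by (intro diff_in_cube) simp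
  have half: "x \<in> cube (\<delta> / 2) \<Longrightarrow> x \<in> cube \<delta>" for x :: "real ^ 'a"
    using assms unfolding cube_def by (auto intro: order_trans[of _ "\<delta> / 2"])
  let ?m = "diag_sup (modulus \<delta> K) u"
  have "diag_sup (modulus (\<delta> / 2) K) v \<le> 2 * ?m"
    unfolding diag_sup_def[of "modulus (\<delta> / 2) K"] modulus_def[of "\<delta> / 2"]
  proof (intro SUP_least)
    fix z x' y' :: "real ^ 'a" assume x': "x' \<in> cube (\<delta> / 2)" and y': "y' \<in> cube (\<delta> / 2)"
    have "ennreal \<bar>K (z + x') (v + z + y') - K z (u + z)\<bar> \<le> diag_sup (modulus \<delta> K) ((u + z) - z)"
      using half[OF x'] cube_add[OF vu y'] by (intro modulus_upper) (auto simp: algebra_simps)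
    moreover have "ennreal \<bar>K z (v + z) - K z (u + z)\<bar> \<le> diag_sup (modulus \<delta> K) ((u + z) - z)"
      using half[OF vu] assms by (intro modulus_upper) (auto simp: cube_def)
    moreover have "ennreal \<bar>K (z + x') (v + z + y') - K z (v + z)\<bar>
      \<le> ennreal \<bar>K (z + x') (v + z + y') - K z (u + z)\<bar> + ennreal \<bar>K z (v + z) - K z (u + z)\<bar>"
      by (simp add: ennreal_plus[symmetric] ennreal_leI del: ennreal_plus)
    ultimately show "ennreal \<bar>K (z + x') (v + z + y') - K z (v + z)\<bar> \<le> 2 * ?m"
      by (simp add: mult_2) (meson add_mono order_trans)
  qed
  then show "diag_sup (modulus (\<delta> / 2) K) v / 2 \<le> ?m"
    by (intro divide_le_posI_ennreal) auto
qed

text \<open>The countable infimum \<open>h\<close> of the envelopes is Borel, and its weighted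
  integral lies below norms that tend to 0. So \<open>h\<close> vanishes almost everywhere, and
  \<open>diag_sup_modulus_half\<close> returns from envelopes to suprema.\<close>

lemma modulus_vanishes_AE:
  assumes c: "continuous_on UNIV \<omega>" and pos: "\<And>x. 0 < \<omega> x"
    and lim: "((\<lambda>\<delta>. W_norm \<omega> (modulus \<delta> K)) \<longlongrightarrow> 0) (at_right 0)"
  shows "AE v in lebesgue. \<forall>e>0. \<exists>\<delta>>0. diag_sup (modulus \<delta> K) v < ennreal e"
proof -
  let ?d = "\<lambda>n. inverse (real (Suc n))"
  define h where "h v = (INF n. lsc_env (diag_sup (modulus (?d n) K)) v)" for v
  have \<omega>m: "(\<lambda>v. ennreal (\<omega> v)) \<in> borel_measurable borel"
    using c by (intro measurable_compose[OF borel_measurable_continuous_onI measurable_ennreal])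
  have "h \<in> borel_measurable borel" unfolding h_def by measurable
  then have hm: "(\<lambda>v. h v * ennreal (\<omega> v)) \<in> borel_measurable lebesgue"
    using \<omega>m by (intro borel_measurable_lebesgue_borel borel_measurable_times_ennreal)
  have "filterlim ?d (at_right 0) sequentially"
    unfolding filterlim_at using LIMSEQ_inverse_real_of_nat by simp
  then have "(\<lambda>n. W_norm \<omega> (modulus (?d n) K)) \<longlonglongrightarrow> 0" by (rule filterlim_compose[OF lim])
  moreover have "(\<integral>\<^sup>+v. h v * ennreal (\<omega> v) \<partial>lebesgue) \<le> W_norm \<omega> (modulus (?d n) K)" for n
  proof -
    have "(\<integral>\<^sup>+v. h v * ennreal (\<omega> v) \<partial>lebesgue) \<le> (\<integral>\<^sup>+v. lsc_env (diag_sup (modulus (?d n) K)) v * ennreal (\<omega> v) \<partial>lebesgue)"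
      unfolding h_def by (intro nn_integral_mono mult_right_mono INF_lower) auto
    also have "\<dots> \<le> W_norm \<omega> (modulus (?d n) K)" by (rule W_norm_lsc_env)
    finally show ?thesis .
  qed
  ultimately have "(\<integral>\<^sup>+v. h v * ennreal (\<omega> v) \<partial>lebesgue) \<le> 0"
    by (intro LIMSEQ_le_const) auto
  then have "AE v in lebesgue. h v * ennreal (\<omega> v) = 0"
    using nn_integral_0_iff_AE[OF hm] by simp
  then show ?thesis
  proof eventually_elim
    case (elim v)
    then have h0: "h v = 0" using pos[of v] by simp
    show ?case
    proof (intro allI impI)
      fix e :: real assume e: "e > 0"
      then have "h v < ennreal (e / 2)" using h0 by simp
      then obtain n where n: "lsc_env (diag_sup (modulus (?d n) K)) v < ennreal (e / 2)"
        unfolding h_def INF_less_iff by auto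
      have "diag_sup (modulus (?d n / 2) K) v / 2 < ennreal (e / 2)"
        by (rule order_le_less_trans[OF diag_sup_modulus_half n]) simp
      then have "diag_sup (modulus (?d n / 2) K) v < ennreal e"
        using e by (simp add: divide_less_ennreal ennreal_mult[symmetric] flip: ennreal_numeral)
      moreover have "?d n / 2 > 0" by simp
      ultimately show "\<exists>\<delta>>0. diag_sup (modulus \<delta> K) v < ennreal e" by blast
    qed
  qed
qed

lemma isCont_kernel:
  fixes K :: "real ^ 'n \<Rightarrow> real ^ 'n \<Rightarrow> real"
  assumes "\<forall>e>0. \<exists>\<delta>>0. diag_sup (modulus \<delta> K) (y - x) < ennreal e"
  shows "isCont (\<lambda>z. K (fst z) (snd z)) (x, y)"
  unfolding continuous_at_eps_delta
proof (intro allI impI)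
  fix e :: real assume e: "0 < e"
  then obtain d where d: "d > 0" "diag_sup (modulus d K) (y - x) < ennreal e" using assms by blast
  show "\<exists>d>0. \<forall>z. dist z (x, y) < d \<longrightarrow> dist (K (fst z) (snd z)) (K (fst (x, y)) (snd (x, y))) < e"
  proof (intro exI[of _ d] conjI allI impI d(1))
    fix z :: "(real ^ 'n) \<times> (real ^ 'n)" assume z: "dist z (x, y) < d"
    have "dist (fst z) x \<le> dist z (x, y)" "dist (snd z) y \<le> dist z (x, y)"
      using dist_fst_le[of z "(x, y)"] dist_snd_le[of z "(x, y)"] by simp_all
    then have "fst z - x \<in> cube d" "snd z - y \<in> cube d" using z by (auto intro!: diff_in_cube)
    from order_le_less_trans[OF modulus_upper[OF this, of K] d(2)] e
    show "dist (K (fst z) (snd z)) (K (fst (x, y)) (snd (x, y))) < e"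
      by (simp add: ennreal_less_iff dist_real_def)
  qed
qed

text \<open>The factor is the volume of the cube to the power 1/p, which \<open>recip_exp\<close>
  turns into 1 for infinite \<open>p\<close>.\<close>

lemma Lp_norm_on_cube_le:
  fixes f :: "real ^ 'n \<Rightarrow> real"
  assumes p: "1 \<le> p" and r: "r > 0" and \<nu>: "\<nu> \<in> borel_measurable lebesgue" and f: "f \<in> borel_measurable lebesgue"
    and B: "AE x in lebesgue. x \<in> cube r \<longrightarrow> \<bar>\<nu> x * f x\<bar> \<le> B" "0 \<le> B"
  shows "Lp_norm_on p \<nu> (cube r) f \<le> ennreal (B * (2 * r) powr (real CARD('n) * recip_exp p))"
proof (cases "p = \<infinity>")
  case True
  have "(\<lambda>x. ennreal (indicator (cube r) x * \<bar>\<nu> x * f x\<bar>)) \<in> borel_measurable lebesgue"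
    using sets_cube[of r] by (intro measurable_compose[OF _ measurable_ennreal] borel_measurable_times borel_measurable_indicator borel_measurable_abs \<nu> f) auto
  moreover have "AE x in lebesgue. ennreal (indicator (cube r) x * \<bar>\<nu> x * f x\<bar>) \<le> ennreal B"
    using B(1) by eventually_elim (use B(2) in \<open>auto intro!: ennreal_leI split: split_indicator\<close>)
  ultimately have "esssup lebesgue (\<lambda>x. ennreal (indicator (cube r) x * \<bar>\<nu> x * f x\<bar>)) \<le> ennreal B"
    by (rule esssup_I)
  then show ?thesis using True r by (simp add: Lp_norm_on_def recip_exp_def)
next
  case False
  define q where "q = enn2real p"
  have pq: "p = ennreal q" using False by (simp add: q_def less_top)
  have q: "q \<ge> 1" using p unfolding pq by (simp flip: ennreal_1 add: ennreal_le_iff2)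
  define I where "I = (\<integral>\<^sup>+ x. ennreal (indicator (cube r) x * \<bar>\<nu> x * f x\<bar> powr q) \<partial>lebesgue)"
  have "I \<le> (\<integral>\<^sup>+ x. ennreal (B powr q) * indicator (cube r) x \<partial>(lebesgue :: (real ^ 'n) measure))"
    unfolding I_def
  proof (rule nn_integral_mono_AE)
    show "AE x in lebesgue. ennreal (indicator (cube r) x * \<bar>\<nu> x * f x\<bar> powr q) \<le> ennreal (B powr q) * indicator (cube r) x"
      using B(1) by eventually_elim (use q in \<open>auto intro!: ennreal_leI powr_mono2 split: split_indicator\<close>)
  qed
  also have "\<dots> = ennreal (B powr q) * emeasure lebesgue (cube r :: (real ^ 'n) set)"
    by (intro nn_integral_cmult_indicator) (simp add: sets_cube)
  also have "\<dots> = ennreal (B powr q * (2 * r) ^ CARD('n))"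
    using r by (subst emeasure_cube) (auto simp: ennreal_mult)
  finally have I: "I \<le> ennreal (B powr q * (2 * r) ^ CARD('n))" .
  then have Ifin: "I \<noteq> \<infinity>" by (auto simp: top_unique)
  have "enn2real I \<le> B powr q * (2 * r) ^ CARD('n)"
    using enn2real_mono[OF I] r by simp
  then have "enn2real I powr (1 / q) \<le> (B powr q * (2 * r) ^ CARD('n)) powr (1 / q)"
    using q by (intro powr_mono2) auto
  also have "\<dots> = B * (2 * r) powr (real CARD('n) * (1 / q))"
    using B(2) r q by (simp add: powr_mult powr_powr flip: powr_realpow)
  finally have "enn2real I powr (1 / q) \<le> B * (2 * r) powr (real CARD('n) * (1 / q))" .
  moreover have "Lp_norm_on p \<nu> (cube r) f = ennreal (enn2real I powr (1 / q))"
    unfolding Lp_norm_on_def using False Ifin by (simp add: Let_def I_def q_def)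
  moreover have "recip_exp p = 1 / q" using False by (simp add: recip_exp_def q_def)
  ultimately show ?thesis by (simp add: ennreal_leI)
qed

subsection \<open>Finite generator expansions\<close>

text \<open>An element of the range is \<open>T g\<close> only almost everywhere, but
  \<open>int_op\<close> ignores null sets. Hence the second identity holds at every point.\<close>

lemma V_space_fixed:
  fixes K :: "real ^ 'n \<Rightarrow> real ^ 'n \<Rightarrow> real"
  assumes idem: "idempotent_on_Lp p \<nu> K" and K: "\<And>x. K x \<in> borel_measurable lebesgue"
    and f: "f \<in> V_space p \<nu> K"
  shows "AE x in lebesgue. f x = int_op K f x" "int_op K (int_op K f) = int_op K f"
proof -
  obtain g where fm: "f \<in> borel_measurable lebesgue" and g: "g \<in> Lp_space p \<nu>" "AE x in lebesgue. f x = int_op K g x"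
    using f unfolding V_space_def Lp_space_def by blast
  have cong: "int_op K u = int_op K v"
    if "u \<in> borel_measurable lebesgue" "AE x in lebesgue. u x = v x" for u v
  proof
    fix x
    have v: "v \<in> borel_measurable lebesgue" by (rule borel_measurable_AE[OF that])
    show "int_op K u x = int_op K v x"
      unfolding int_op_def
      by (rule integral_cong_AE)
        (use that v K[of x] in \<open>auto intro!: borel_measurable_times elim!: eventually_mono\<close>)
  qed
  have "AE x in lebesgue. int_op K (int_op K g) x = int_op K g x"
    using idem g(1) unfolding idempotent_on_Lp_def by blast
  then have "AE x in lebesgue. int_op K f x = f x"
    unfolding cong[OF fm g(2)] using g(2) by eventually_elim simp
  then show 1: "AE x in lebesgue. f x = int_op K f x" by (auto elim!: eventually_mono)
  show "int_op K (int_op K f) = int_op K f" by (rule cong[OF fm 1, symmetric])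
qed

section \<open>Weighted sup bounds from a unit Lp norm\<close>

context decaying_kernel begin

lemma wt_integral_nonneg: "0 \<le> (LINT y|lebesgue. wt y)"
  by (rule integral_nonneg_AE) simp

text \<open>Hoelder's inequality is avoided by \<open>wt * t \<le> wt + t powr q\<close> for \<open>t \<ge> 0\<close>, \<open>q \<ge> 1\<close> and \<open>0 \<le> wt \<le> 1\<close>.\<close>

lemma nn_integral_wt_le:
  assumes p: "1 \<le> p" and \<nu>: "\<nu> \<in> borel_measurable lebesgue" and f: "f \<in> borel_measurable lebesgue"
    and n: "Lp_norm_on p \<nu> UNIV f = 1"
  shows "(\<integral>\<^sup>+y. ennreal (wt y * \<bar>\<nu> y * f y\<bar>) \<partial>lebesgue) \<le> ennreal ((LINT y|lebesgue. wt y) + 1)"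
proof -
  have wm: "wt \<in> borel_measurable lebesgue" using wt_integrable by (rule borel_measurable_integrable)
  have w: "(\<integral>\<^sup>+y. ennreal (wt y) \<partial>lebesgue) = ennreal (LINT y|lebesgue. wt y)"
    by (intro nn_integral_eq_integral) auto
  have w0: "0 \<le> (LINT y|lebesgue. wt y)" by (rule wt_integral_nonneg)
  show ?thesis
  proof (cases "p = \<infinity>")
    case True
    have "AE y in lebesgue. ennreal (indicator UNIV y * \<bar>\<nu> y * f y\<bar>) \<le> esssup lebesgue (\<lambda>y. ennreal (indicator UNIV y * \<bar>\<nu> y * f y\<bar>))"
      by (rule esssup_AE)
    then have "AE y in lebesgue. ennreal \<bar>\<nu> y * f y\<bar> \<le> 1"
      using n True by (simp add: Lp_norm_on_def)
    then have "(\<integral>\<^sup>+y. ennreal (wt y * \<bar>\<nu> y * f y\<bar>) \<partial>lebesgue) \<le> (\<integral>\<^sup>+y. ennreal (wt y) \<partial>lebesgue)"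
    proof (intro nn_integral_mono_AE, eventually_elim)
      case (elim y)
      then have "\<bar>\<nu> y * f y\<bar> \<le> 1" by simp
      then show "ennreal (wt y * \<bar>\<nu> y * f y\<bar>) \<le> ennreal (wt y)"
        using mult_left_mono[of "\<bar>\<nu> y * f y\<bar>" 1 "wt y"] by (intro ennreal_leI) simp
    qed
    also have "\<dots> \<le> ennreal ((LINT y|lebesgue. wt y) + 1)"
      unfolding w by (intro ennreal_leI) simp
    finally show ?thesis .
  next
    case False
    define q where "q = enn2real p"
    have pq: "p = ennreal q" using False by (simp add: q_def less_top)
    have q: "q \<ge> 1" using p unfolding pq by (simp flip: ennreal_1 add: ennreal_le_iff2)
    define I where "I = (\<integral>\<^sup>+y. ennreal (\<bar>\<nu> y * f y\<bar> powr q) \<partial>lebesgue)"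
    have "Lp_norm_on p \<nu> UNIV f = (if I = \<infinity> then \<infinity> else ennreal (enn2real I powr (1 / q)))"
      using False by (simp add: Lp_norm_on_def I_def q_def Let_def)
    with n have nI: "(if I = \<infinity> then \<infinity> else ennreal (enn2real I powr (1 / q))) = 1"
      by (simp only:)
    then have fin: "I \<noteq> \<infinity>" by auto
    with nI have "enn2real I powr (1 / q) = 1" by simp
    then have "(enn2real I powr (1 / q)) powr q = 1" by simp
    then have "enn2real I = 1" using q by (simp add: powr_powr split: if_splits)
    then have I: "I = 1" using fin by (metis ennreal_1 ennreal_enn2real_if infinity_ennreal_def)
    have mm: "(\<lambda>y. \<bar>\<nu> y * f y\<bar> powr q) \<in> borel_measurable lebesgue"
      using \<nu> f by measurable
    have "(\<integral>\<^sup>+y. ennreal (wt y * \<bar>\<nu> y * f y\<bar>) \<partial>lebesgue)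
      \<le> (\<integral>\<^sup>+y. ennreal (wt y) + ennreal (\<bar>\<nu> y * f y\<bar> powr q) \<partial>lebesgue)"
    proof (intro nn_integral_mono)
      fix y
      let ?t = "\<bar>\<nu> y * f y\<bar>"
      have "wt y * ?t \<le> wt y + ?t powr q"
      proof (cases "?t \<le> 1")
        case True
        then have "wt y * ?t \<le> wt y * 1" by (intro mult_left_mono) auto
        then show ?thesis using powr_ge_zero[of ?t q] by linarith
      next
        case False
        then have "?t \<le> ?t powr q" using powr_mono[of 1 q ?t] q by simp
        moreover have "wt y * ?t \<le> 1 * ?t" by (intro mult_right_mono wt_le1) auto
        ultimately show ?thesis using wt_nonneg[of y] by linarith
      qed
      then show "ennreal (wt y * ?t) \<le> ennreal (wt y) + ennreal (?t powr q)"
        by (simp add: ennreal_plus[symmetric] ennreal_leI del: ennreal_plus)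
    qed
    also have "\<dots> = (\<integral>\<^sup>+y. ennreal (wt y) \<partial>lebesgue) + I"
      unfolding I_def by (intro nn_integral_add measurable_compose[OF _ measurable_ennreal] wm mm)
    also have "\<dots> = ennreal ((LINT y|lebesgue. wt y) + 1)"
      unfolding w I using w0 by simp
    finally show ?thesis .
  qed
qed

text \<open>In the constant, \<open>C\<close> comes from the decay, \<open>C\<^sub>0\<close> from
  the passage from \<mu> to \<nu>, and the summand 1 from the unit norm in
  \<open>nn_integral_wt_le\<close>.\<close>

lemma T_bound_Lp:
  assumes p: "1 \<le> p" and \<nu>: "\<nu> \<in> borel_measurable lebesgue" "\<And>x. 0 < \<nu> x" and f: "f \<in> borel_measurable lebesgue"
    and n: "Lp_norm_on p \<nu> UNIV f = 1" and \<mu>\<nu>: "\<And>x. \<mu> x \<le> C\<^sub>0 * \<nu> x" and C\<^sub>0: "0 < C\<^sub>0"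
  shows "\<mu> x * \<bar>T f x\<bar> \<le> C * C\<^sub>0 * ((LINT y|lebesgue. wt y) + 1)"
proof (cases "integrable lebesgue (\<lambda>y. K x y * f y)")
  case False
  have "0 \<le> (LINT y|lebesgue. wt y)" by (rule wt_integral_nonneg)
  then show ?thesis using False C_nonneg C\<^sub>0 by (simp add: int_op_def not_integrable_integral_eq)
next
  case True
  have w0: "0 \<le> (LINT y|lebesgue. wt y)" by (rule wt_integral_nonneg)
  have wm: "wt \<in> borel_measurable lebesgue" using wt_integrable by (rule borel_measurable_integrable)
  have m: "(\<lambda>y. wt y * \<bar>\<nu> y * f y\<bar>) \<in> borel_measurable lebesgue"
    using \<nu>(1) f wm by measurable
  have "ennreal (\<mu> x * \<bar>T f x\<bar>) = ennreal (\<mu> x) * ennreal \<bar>LINT y|lebesgue. K x y * f y\<bar>"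
    using \<mu>_pos[of x] by (simp add: ennreal_mult int_op_def)
  also have "\<dots> \<le> ennreal (\<mu> x) * (\<integral>\<^sup>+y. ennreal \<bar>K x y * f y\<bar> \<partial>lebesgue)"
    using integral_norm_bound_ennreal[OF True] by (intro mult_left_mono) auto
  also have "\<dots> = (\<integral>\<^sup>+y. ennreal (\<mu> x) * ennreal \<bar>K x y * f y\<bar> \<partial>lebesgue)"
    using True by (intro nn_integral_cmult[symmetric]) auto
  also have "\<dots> \<le> (\<integral>\<^sup>+y. ennreal (C * C\<^sub>0) * ennreal (wt y * \<bar>\<nu> y * f y\<bar>) \<partial>lebesgue)"
  proof (intro nn_integral_mono)
    fix y
    have "\<mu> x * \<bar>K x y * f y\<bar> \<le> (\<omega> (y - x) * \<mu> y) * \<bar>K x y * f y\<bar>"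
      by (intro mult_right_mono \<mu>_mod) auto
    also have "\<dots> = (\<bar>K x y\<bar> * \<omega> (y - x)) * (\<mu> y * \<bar>f y\<bar>)" by (simp add: abs_mult)
    also have "\<dots> \<le> (C * wt y) * (\<mu> y * \<bar>f y\<bar>)"
      using \<mu>_pos[of y] by (intro mult_right_mono decay_right) auto
    also have "\<dots> \<le> (C * wt y) * ((C\<^sub>0 * \<nu> y) * \<bar>f y\<bar>)"
      using C_nonneg by (intro mult_left_mono mult_right_mono \<mu>\<nu>) auto
    also have "\<dots> = C * C\<^sub>0 * (wt y * \<bar>\<nu> y * f y\<bar>)" using \<nu>(2)[of y] by (simp add: abs_mult)
    finally show "ennreal (\<mu> x) * ennreal \<bar>K x y * f y\<bar> \<le> ennreal (C * C\<^sub>0) * ennreal (wt y * \<bar>\<nu> y * f y\<bar>)"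
      using \<mu>_pos[of x] C_nonneg C\<^sub>0 by (simp add: ennreal_leI flip: ennreal_mult)
  qed
  also have "\<dots> = ennreal (C * C\<^sub>0) * (\<integral>\<^sup>+y. ennreal (wt y * \<bar>\<nu> y * f y\<bar>) \<partial>lebesgue)"
    by (intro nn_integral_cmult measurable_compose[OF m measurable_ennreal])
  also have "\<dots> \<le> ennreal (C * C\<^sub>0) * ennreal ((LINT y|lebesgue. wt y) + 1)"
    by (intro mult_left_mono nn_integral_wt_le[OF p \<nu>(1) f n]) auto
  also have "\<dots> = ennreal (C * C\<^sub>0 * ((LINT y|lebesgue. wt y) + 1))"
    using C_nonneg C\<^sub>0 w0 by (simp add: ennreal_mult)
  finally show ?thesis using C_nonneg C\<^sub>0 w0 by (subst (asm) ennreal_le_iff) auto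
qed

text \<open>This makes idempotence on the L^p space available for the truncated bounded functions of
  \<open>T_idem\<close>.\<close>

lemma bdd_in_Lp_space:
  assumes p: "1 \<le> p" and \<nu>: "\<nu> \<in> borel_measurable lebesgue" "\<And>x. 0 < \<nu> x" "\<And>x. \<nu> x \<le> A * \<mu> x"
    and u: "bdd D u" "\<And>x. x \<notin> cube r \<Longrightarrow> u x = 0"
  shows "u \<in> Lp_space p \<nu>"
proof -
  \<comment> \<open>The radius is enlarged to be positive, as \<open>Lp_norm_on_cube_le\<close>
    requires.\<close>
  define s where "s = max r 1"
  have s: "s > 0" "\<And>x. x \<notin> cube s \<Longrightarrow> u x = 0"
    using u(2) by (auto simp: s_def cube_def) (meson max.cobounded1 order_trans)
  have A: "0 \<le> A" using \<nu>(2,3)[of 0] \<mu>_pos[of 0] by (smt (verit) mult_neg_pos)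
  have b: "\<bar>\<nu> x * u x\<bar> \<le> A * D" for x
  proof -
    have "\<bar>\<nu> x * u x\<bar> = \<nu> x * \<bar>u x\<bar>" using \<nu>(2)[of x] by (simp add: abs_mult)
    also have "\<dots> \<le> (A * \<mu> x) * \<bar>u x\<bar>" by (intro mult_right_mono \<nu>(3)) auto
    also have "\<dots> = A * (\<mu> x * \<bar>u x\<bar>)" by simp
    also have "\<dots> \<le> A * D" by (intro mult_left_mono bdd_le[OF u(1)] A)
    finally show ?thesis .
  qed
  have eqs: "indicator (cube s) x * \<bar>\<nu> x * u x\<bar> = indicator UNIV x * \<bar>\<nu> x * u x\<bar>"
    "indicator (cube s) x * \<bar>\<nu> x * u x\<bar> powr q = indicator UNIV x * \<bar>\<nu> x * u x\<bar> powr q" for x q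
    using s(2)[of x] by (auto split: split_indicator)
  have "Lp_norm_on p \<nu> UNIV u = Lp_norm_on p \<nu> (cube s) u" unfolding Lp_norm_on_def eqs ..
  also have "\<dots> \<le> ennreal (A * D * (2 * s) powr (real CARD('n) * recip_exp p))"
    using b A bdd_nonneg[OF u(1)] by (intro Lp_norm_on_cube_le p s \<nu>(1) bdd_meas[OF u(1)]) auto
  also have "\<dots> < \<infinity>" by simp
  finally show ?thesis using bdd_meas[OF u(1)] by (simp add: Lp_space_def)
qed

end

theorem lemma2p4:
  fixes p :: ennreal
    and \<omega> \<nu> :: "real ^ 'n \<Rightarrow> real"
    and K :: "real ^ 'n \<Rightarrow> real ^ 'n \<Rightarrow> real"
    and C \<alpha> \<delta>\<^sub>0 M :: real
  assumes "1 \<le> p"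
    and "submultiplicative_weight \<omega>"
    and "moderate_weight \<omega> \<nu>"
    and "(\<lambda>z. K (fst z) (snd z)) \<in> borel_measurable lebesgue"
    and "\<alpha> > real CARD('n)"
    and "\<And>x y. \<bar>K x y\<bar> * \<omega> (y - x) \<le> C * (1 + norm_l1 x + norm_l1 y) powr (- \<alpha>)"
    and "((\<lambda>\<delta>. W_norm \<omega> (modulus \<delta> K)) \<longlongrightarrow> 0) (at_right 0)"
    and "idempotent_on_Lp p \<nu> K"
    and "\<delta>\<^sub>0 > 0"
    and "W_norm \<omega> (abs_kernel K) * W_norm \<omega> (modulus \<delta>\<^sub>0 K) < 1"
    and "M > 0"
  shows "\<forall>\<epsilon>>0. \<exists>N::nat. N > 0 \<and>
           (\<forall>f\<in>V_space p \<nu> K. Lp_norm_on p \<nu> UNIV f = 1 \<longrightarrow>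
              (\<exists>f\<^sub>N\<in>V_fin p \<delta>\<^sub>0 K N.
                 Lp_norm_on p \<nu> (cube M) (\<lambda>x. f x - f\<^sub>N x) \<le> ennreal \<epsilon> \<and>
                 Lp_norm_on \<infinity> \<nu> (cube M) (\<lambda>x. f x - f\<^sub>N x)
                   \<le> ennreal (\<epsilon> / (2 * M) powr (real CARD('n) * recip_exp p))))"
proof (intro allI impI)
  fix \<epsilon> :: real assume \<epsilon>: "0 < \<epsilon>"
  obtain \<mu> C\<^sub>0 where C\<^sub>0: "C\<^sub>0 > 0" and \<mu>_mod: "\<And>x y. \<mu> x \<le> \<omega> (y - x) * \<mu> y"
    and \<nu>_le: "\<And>x. \<nu> x \<le> \<omega> 0 * \<mu> x" and \<mu>_le: "\<And>x. \<mu> x \<le> C\<^sub>0 * \<nu> x"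
    by (rule moderate_weight_equivalent[OF assms(2,3)]) (rule that)
  have \<omega>c: "continuous_on UNIV \<omega>" and \<omega>_pos: "\<And>x. 0 < \<omega> x"
    using assms(2) unfolding submultiplicative_weight_def by blast+
  have \<nu>c: "continuous_on UNIV \<nu>" and \<nu>_pos: "\<And>x. 0 < \<nu> x"
    using assms(3) unfolding moderate_weight_def by blast+
  have \<nu>m: "\<nu> \<in> borel_measurable lebesgue"
    by (intro borel_measurable_lebesgue_borel borel_measurable_continuous_onI \<nu>c)
  have \<mu>_pos: "0 < \<mu> x" for x
    by (rule zero_less_mult_pos[OF order_less_le_trans[OF \<nu>_pos \<nu>_le] \<omega>_pos])
  define E where "E = {v. \<not> (\<forall>e>0. \<exists>\<delta>>0. diag_sup (modulus \<delta> K) v < ennreal e)}"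
  interpret decaying_kernel \<omega> \<mu> K C \<alpha> E
  proof
    show "AE v in lebesgue. v \<notin> E"
      using modulus_vanishes_AE[OF \<omega>c \<omega>_pos assms(7)] by (simp add: E_def)
    show "isCont (\<lambda>z. K (fst z) (snd z)) (x, y)" if "y - x \<notin> E" for x y
      using that by (intro isCont_kernel) (simp add: E_def)
  qed (rule \<omega>c submultiplicative_weight_ge1[OF assms(2)] \<mu>_pos \<mu>_mod assms(4-6))+
  interpret contracting_kernel \<omega> \<mu> K C \<alpha> E \<delta>\<^sub>0 "W_norm \<omega> (abs_kernel K)" "W_norm \<omega> (modulus \<delta>\<^sub>0 K)"
    "lsc_env (diag_sup (abs_kernel K))" "lsc_env (diag_sup (modulus \<delta>\<^sub>0 K))"
  proof
    have cont: "isCont (\<lambda>w. K x (w + x)) (y - x)" if "y - x \<notin> E" for x y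
    proof (rule isCont_o2[where f="\<lambda>w. w + x" and g="K x"])
      show "isCont (\<lambda>w. w + x) (y - x)" by simp
      show "isCont (K x) (y - x + x)" using isCont_K_right[OF that] by simp
    qed
    show "ennreal \<bar>K x y\<bar> \<le> lsc_env (diag_sup (abs_kernel K)) (y - x)" if "y - x \<notin> E" for x y
    proof -
      have "isCont (\<lambda>w. \<bar>K x (w + x)\<bar>) (y - x)"
        by (intro isCont_rabs cont that)
      then have "ennreal \<bar>K x ((y - x) + x)\<bar> \<le> lsc_env (diag_sup (abs_kernel K)) (y - x)"
      proof (rule le_lsc_env_isCont[OF _ zero_less_one])
        show "ennreal \<bar>K x (w + x)\<bar> \<le> diag_sup (abs_kernel K) w" for w
          using diag_sup_upper[of "abs_kernel K" x "w + x"] by simp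
      qed
      then show ?thesis by simp
    qed
    show "ennreal \<bar>K x y - K x' y\<bar> \<le> lsc_env (diag_sup (modulus \<delta>\<^sub>0 K)) (y - x)"
      if E: "y - x \<notin> E" and x': "x' - x \<in> cube \<delta>\<^sub>0" for x y x'
    proof -
      \<comment> \<open>The point \<open>(x', y)\<close> stays fixed while \<open>w\<close> varies;
        for \<open>w\<close> near \<open>y - x\<close> it is reached from \<open>(x, w + x)\<close>
        by shifts within the cube.\<close>
      have "isCont (\<lambda>w. \<bar>K x (w + x) - K x' y\<bar>) (y - x)"
        by (intro isCont_rabs isCont_diff continuous_const cont E)
      then have "ennreal \<bar>K x ((y - x) + x) - K x' y\<bar> \<le> lsc_env (diag_sup (modulus \<delta>\<^sub>0 K)) (y - x)"
      proof (rule le_lsc_env_isCont[OF _ assms(9)])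
        fix w assume "dist (y - x) w < \<delta>\<^sub>0"
        then have "(y - x) - w \<in> cube \<delta>\<^sub>0" by (intro diff_in_cube) simp
        then have "y - (w + x) \<in> cube \<delta>\<^sub>0" by (simp add: algebra_simps)
        from modulus_upper[OF x' this, of K]
        show "ennreal \<bar>K x (w + x) - K x' y\<bar> \<le> diag_sup (modulus \<delta>\<^sub>0 K) w"
          by (simp add: abs_minus_commute)
      qed
      then show ?thesis by simp
    qed
    show "AE x in lebesgue. T (T u) x = T u x" if "bdd D u" "\<And>x. x \<notin> cube r \<Longrightarrow> u x = 0" for D u r
      using bdd_in_Lp_space[OF assms(1) \<nu>m \<nu>_pos \<nu>_le that] assms(8) unfolding idempotent_on_Lp_def by blast
  qed (rule assms(9,10) borel_measurable_lsc_env W_norm_lsc_env)+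
  \<comment> \<open>The bound of \<open>T_bound_Lp\<close>; it does not involve \<open>f\<close>, so
    \<open>N\<close> can be fixed before \<open>f\<close>.\<close>
  define D where "D = C * C\<^sub>0 * ((LINT y|lebesgue. wt y) + 1)"
  \<comment> \<open>The sup norm target; the volume factor of \<open>Lp_norm_on_cube_le\<close>
    turns it into \<epsilon> for the L^p norm.\<close>
  define \<eta> where "\<eta> = \<epsilon> / (2 * M) powr (real CARD('n) * recip_exp p)"
  have \<eta>: "\<eta> > 0" using \<epsilon> assms(11) by (simp add: \<eta>_def)
  \<comment> \<open>As \<open>\<nu> x \<le> \<omega> 0 * \<mu> x\<close>, an error of
    \<open>\<eta> / \<omega> 0\<close> weighted by \<mu> is at most \<eta> weighted by
    \<nu>.\<close>
  then have "\<eta> / \<omega> 0 > 0" using \<omega>_pos[of 0] by simp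
  from finite_combination_approx[OF this, of D p]
  obtain N :: nat where N: "N > 0" and appr: "\<And>f. bdd_fixed D f \<Longrightarrow>
      \<exists>c. bdd (\<eta> / \<omega> 0) (\<lambda>x. f x - (\<Sum>l\<in>lattice \<delta>\<^sub>0 \<inter> cube (real N). c l * gen p \<delta>\<^sub>0 K l x))"
    by blast
  show "\<exists>N::nat. N > 0 \<and> (\<forall>f\<in>V_space p \<nu> K. Lp_norm_on p \<nu> UNIV f = 1 \<longrightarrow>
        (\<exists>f\<^sub>N\<in>V_fin p \<delta>\<^sub>0 K N. Lp_norm_on p \<nu> (cube M) (\<lambda>x. f x - f\<^sub>N x) \<le> ennreal \<epsilon> \<and>
           Lp_norm_on \<infinity> \<nu> (cube M) (\<lambda>x. f x - f\<^sub>N x)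
             \<le> ennreal (\<epsilon> / (2 * M) powr (real CARD('n) * recip_exp p))))"
  proof (intro exI[of _ N] conjI N ballI impI)
    fix f assume f: "f \<in> V_space p \<nu> K" and norm: "Lp_norm_on p \<nu> UNIV f = 1"
    have fm: "f \<in> borel_measurable lebesgue" using f by (auto simp: V_space_def Lp_space_def)
    note Tf = V_space_fixed[OF assms(8) K_meas_right f]
    have "T f \<in> borel_measurable lebesgue" by (rule borel_measurable_AE[OF fm Tf(1)])
    moreover have "\<mu> x * \<bar>T f x\<bar> \<le> D" for x
      unfolding D_def by (rule T_bound_Lp[OF assms(1) \<nu>m \<nu>_pos fm norm \<mu>_le C\<^sub>0])
    \<comment> \<open>\<open>f\<close> is fixed by \<open>T\<close> only almost everywhere, whereas
      \<open>bdd_fixed\<close> speaks of every point; \<open>T f\<close> is its continuous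
      representative.\<close>
    ultimately have "bdd_fixed D (T f)" using Tf(2) by (simp add: bdd_fixed_def bdd_def)
    then obtain c where c: "bdd (\<eta> / \<omega> 0) (\<lambda>x. T f x - (\<Sum>l\<in>lattice \<delta>\<^sub>0 \<inter> cube (real N). c l * gen p \<delta>\<^sub>0 K l x))"
      using appr by blast
    define g where "g = (\<lambda>x. \<Sum>l\<in>lattice \<delta>\<^sub>0 \<inter> cube (real N). c l * gen p \<delta>\<^sub>0 K l x)"
    have c: "bdd (\<eta> / \<omega> 0) (\<lambda>x. T f x - g x)" using c unfolding g_def .
    have gV: "g \<in> V_fin p \<delta>\<^sub>0 K N" unfolding V_fin_def g_def by blast
    have eq: "AE x in lebesgue. T f x - g x = f x - g x" using Tf(1) by eventually_elim simp
    have dm: "(\<lambda>x. f x - g x) \<in> borel_measurable lebesgue" by (rule borel_measurable_AE[OF bdd_meas[OF c] eq])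
    have le: "AE x in lebesgue. x \<in> cube M \<longrightarrow> \<bar>\<nu> x * (f x - g x)\<bar> \<le> \<eta>"
      using eq
    proof eventually_elim
      case (elim x)
      have "\<bar>\<nu> x * (f x - g x)\<bar> = \<nu> x * \<bar>T f x - g x\<bar>" using \<nu>_pos[of x] elim by (simp add: abs_mult)
      also have "\<dots> \<le> (\<omega> 0 * \<mu> x) * \<bar>T f x - g x\<bar>" by (intro mult_right_mono \<nu>_le) auto
      also have "\<dots> = \<omega> 0 * (\<mu> x * \<bar>T f x - g x\<bar>)" by simp
      also have "\<dots> \<le> \<omega> 0 * (\<eta> / \<omega> 0)" using \<omega>_pos[of 0] by (intro mult_left_mono bdd_le[OF c]) auto
      also have "\<dots> = \<eta>" using \<omega>_pos[of 0] by simp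
      finally show ?case by simp
    qed
    have "Lp_norm_on p \<nu> (cube M) (\<lambda>x. f x - g x) \<le> ennreal (\<eta> * (2 * M) powr (real CARD('n) * recip_exp p))"
      using \<eta> by (intro Lp_norm_on_cube_le assms(1,11) \<nu>m dm le) auto
    also have "\<eta> * (2 * M) powr (real CARD('n) * recip_exp p) = \<epsilon>"
      using assms(11) by (simp add: \<eta>_def)
    finally have 1: "Lp_norm_on p \<nu> (cube M) (\<lambda>x. f x - g x) \<le> ennreal \<epsilon>" .
    have "Lp_norm_on \<infinity> \<nu> (cube M) (\<lambda>x. f x - g x) \<le> ennreal (\<eta> * (2 * M) powr (real CARD('n) * recip_exp \<infinity>))"
      using \<eta> by (intro Lp_norm_on_cube_le assms(11) \<nu>m dm le) auto
    also have "\<eta> * (2 * M) powr (real CARD('n) * recip_exp \<infinity>) = \<eta>"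
      using assms(11) by (simp add: recip_exp_def)
    finally have 2: "Lp_norm_on \<infinity> \<nu> (cube M) (\<lambda>x. f x - g x) \<le> ennreal \<eta>" .
    show "\<exists>f\<^sub>N\<in>V_fin p \<delta>\<^sub>0 K N. Lp_norm_on p \<nu> (cube M) (\<lambda>x. f x - f\<^sub>N x) \<le> ennreal \<epsilon> \<and>
        Lp_norm_on \<infinity> \<nu> (cube M) (\<lambda>x. f x - f\<^sub>N x)
          \<le> ennreal (\<epsilon> / (2 * M) powr (real CARD('n) * recip_exp p))"
      using gV 1 2 unfolding \<eta>_def by blast
  qed
qed

end
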